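(* Let $n\ge 1$ and let $\beta_1,\dots,\beta_n$ be distinct nonzero points of the open unit disc $\Delta$. Let $\Lambda=\{(f(\beta_1),\dots,f(\beta_n)) : f\in H^1,\ \|f\|_1\le 1\}\subset\mathbb{C}^n$ and $P(z)=\prod_{k=1}^n(1-\overline{\beta_k}z)^{-2}$. Let $F\in H^1$ with $\|F\|_1=1$ be such that the point $(F(\beta_1),\dots,F(\beta_n))$ lies in the boundary of $\Lambda$. Then $(F(\beta_1),\dots,F(\beta_n))$ is an extreme point of $\Lambda$ if and only if $F$ is outer, and in that case $F$ is of the form $F=q^2P$, where $q$ is a polynomial of degree at most $n-1$ with no zeros in $\Delta$.
   Context: $\Delta=\{z\in\mathbb{C}:|z|<1\}$ and $\mathbf{T}=\{z\in\mathbb{C}:|z|=1\}$. $H^1$ is the Hardy space of the disc $\Delta$, with norm $\|f\|_1=\int_{\mathbf{T}}|f|\,d\sigma$ (boundary values), where $\sigma$ is normalized Lebesgue measure on $\mathbf{T}$. "Outer" is meant in the usual sense of the inner-outer factorization, with unimodular constant factors allowed. The set $\Lambda$ is a closed convex set in $\mathbb{C}^n$ containing a neighborhood of the origin. A point $\vec P$ of a convex set $\Lambda$ is an extreme point if $\vec P=\lambda\vec P_1+(1-\lambda)\vec P_2$ with $0<\lambda<1$ and $\vec P_1,\vec P_2\in\Lambda$ implies $\vec P_1=\vec P_2$. *)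

theory Defs
  imports
    "HOL-Complex_Analysis.Complex_Analysis"
    "HOL-Computational_Algebra.Polynomial"
begin

text \<open>
  Functions on the open unit disc are represented by total functions on the complex plane;
  no notion below depends on their values outside \<^term>\<open>ball (0::complex) 1\<close>.
\<close>

text \<open>
  Normalized arc length. The underlying space is the unit circle itself rather than the whole
  plane, so that measurability of boundary functions does not involve junk values off the circle.
\<close>

definition circle_measure :: "complex measure" where
  "circle_measure =
     distr (uniform_measure lborel {0..<2 * pi}) (restrict_space borel (sphere 0 1)) cis"

definition hardy1 :: "(complex \<Rightarrow> complex) set" where
  "hardy1 = {f. f holomorphic_on ball 0 1 \<and>
     (\<exists>C. \<forall>r::real. 0 \<le> r \<and> r < 1 \<longrightarrow>
        (\<integral>\<zeta>. cmod (f (of_real r * \<zeta>)) \<partial>circle_measure) \<le> C)}"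

text \<open>
  Radial limit. By Fatou's theorem it exists at almost every point of the circle for
  functions in \<^const>\<open>hardy1\<close>; elsewhere \<^const>\<open>Lim\<close> returns a fixed unspecified value.
\<close>

definition boundary_value :: "(complex \<Rightarrow> complex) \<Rightarrow> complex \<Rightarrow> complex" where
  "boundary_value f \<zeta> = Lim (at_left 1) (\<lambda>r::real. f (of_real r * \<zeta>))"

definition hardy1_norm :: "(complex \<Rightarrow> complex) \<Rightarrow> real" where
  "hardy1_norm f = (\<integral>\<zeta>. cmod (boundary_value f \<zeta>) \<partial>circle_measure)"

definition outer_function :: "(complex \<Rightarrow> complex) \<Rightarrow> bool" where
  "outer_function F \<longleftrightarrow>
     (\<exists>(c::complex) (\<phi>::complex \<Rightarrow> real).
        cmod c = 1 \<and>
        \<phi> \<in> borel_measurable circle_measure \<and>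
        (\<forall>\<zeta>\<in>sphere 0 1. 0 < \<phi> \<zeta>) \<and>
        integrable circle_measure (\<lambda>\<zeta>. ln (\<phi> \<zeta>)) \<and>
        (\<forall>z\<in>ball 0 1.
           F z = c * exp (\<integral>\<zeta>. (\<zeta> + z) / (\<zeta> - z) * of_real (ln (\<phi> \<zeta>)) \<partial>circle_measure)))"

definition eval_at :: "('n::finite \<Rightarrow> complex) \<Rightarrow> (complex \<Rightarrow> complex) \<Rightarrow> complex ^ 'n" where
  "eval_at \<beta> f = (\<chi> k. f (\<beta> k))"

definition interp_body :: "('n::finite \<Rightarrow> complex) \<Rightarrow> (complex ^ 'n) set" where
  "interp_body \<beta> = {eval_at \<beta> f | f. f \<in> hardy1 \<and> hardy1_norm f \<le> 1}"

definition kernel_prod :: "('n::finite \<Rightarrow> complex) \<Rightarrow> complex \<Rightarrow> complex" where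
  "kernel_prod \<beta> z = (\<Prod>k\<in>UNIV. 1 / (1 - cnj (\<beta> k) * z)\<^sup>2)"

end

theory Submission
  imports Defs "HOL-Computational_Algebra.Fundamental_Theorem_Algebra"
begin

text \<open>
  A supporting functional \<open>L\<close> of \<open>\<Lambda>\<close> at the point given by \<open>F\<close> is maximized by \<open>F\<close> over the unit ball of
  \<open>H\<^sup>1\<close>. Comparing \<open>F\<close> with \<open>F (1 + e h)\<close> for small \<open>e\<close> gives \<open>L (F h) = M \<integral> \<bar>F\<bar> h d\<sigma>\<close>; for \<open>h\<close> the
  analytic completion of the Poisson kernel this computes the Poisson integral of \<open>\<bar>F\<bar>\<close>. Hence \<open>\<bar>F\<bar>\<close> is almost
  everywhere an explicit nonnegative rational function on the circle, determined by the values \<open>F (\<beta>\<^sub>k)\<close>, and the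
  Fejer-Riesz theorem writes it as \<open>\<bar>G\<bar>\<close> with \<open>G = q\<^sup>2 P\<close> and \<open>q\<close> zero-free in the disc. So \<open>F = I G\<close> with \<open>I\<close>
  inner, and \<open>F\<close> is outer iff \<open>I\<close> is constant. A nonconstant \<open>I\<close> yields a proper segment through the point; if
  \<open>I\<close> is constant, any two functions whose values at the \<open>\<beta>\<^sub>k\<close> have the point as a convex combination are real
  multiples of \<open>F\<close> on the circle with bounded quotient, hence equal to \<open>F\<close>.

  Every \<open>f\<close> in \<open>H\<^sup>1\<close> is the Poisson integral of its radial limits: \<open>f = a b\<close> with \<open>a\<close>, \<open>b\<close> in \<open>H\<^sup>2\<close>, so the
  dilations of \<open>f\<close> converge in \<open>L\<^sup>1\<close>, and Poisson integrals of \<open>L\<^sup>1\<close> functions have radial limits almost everywhere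
  by the maximal inequality.
\<close>

section \<open>Integrals over the circle\<close>

text \<open>The variation of F is multiplicative because |F (1 + e h)| = |F| |1 + e h| is smooth in
  small e even where F vanishes on the circle, with an error of second order. Since the resulting
  formula for |F| sees only the node values, two maximisers with the same node values have the same
  modulus as their average, and the parallelogram law makes them equal almost everywhere. This
  uniqueness is what turns an equality at finitely many nodes into an equality on the circle. The
  obstacle to dividing by G is that q may vanish on the circle, so 1 / G need not be bounded there;
  such quotients are controlled through dilations of q. That q has degree at most n - 1 rather than
  n reflects that the complex functional takes the real value M at F, which is seen by testing with
  the constant function i.\<close>

abbreviation (input) \<sigma> :: "complex measure" where "\<sigma> \<equiv> circle_measure"

lemma cis_measurable_circle [measurable]:
  "cis \<in> measurable lborel (restrict_space borel (sphere 0 1))"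
  by (rule measurable_restrict_space2) (auto intro!: borel_measurable_continuous_onI continuous_intros)

lemma space_circle [simp]: "space \<sigma> = sphere 0 1"
  by (simp add: circle_measure_def space_restrict_space)

lemma sets_circle [measurable_cong]: "sets \<sigma> = sets (restrict_space borel (sphere 0 1))"
  by (simp add: circle_measure_def)

lemma emeasure_circle:
  assumes "A \<in> sets \<sigma>"
  shows "emeasure \<sigma> A = emeasure lborel ({0..<2*pi} \<inter> cis -` A) / (2 * pi)"
proof -
  have A: "A \<in> sets (restrict_space borel (sphere 0 1))" using assms by (simp add: sets_circle)
  have m: "cis -` A \<in> sets lborel"
    using measurable_sets[OF cis_measurable_circle A] by simp
  have "emeasure \<sigma> A = emeasure (uniform_measure lborel {0..<2*pi}) (cis -` A)"
    unfolding circle_measure_def by (subst emeasure_distr) (use A in auto)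
  then show ?thesis using m by simp
qed

interpretation circle: finite_measure circle_measure
proof (rule finite_measureI)
  have "{0..<2*pi} \<inter> cis -` sphere 0 1 = {0..<2*pi}" by auto
  then show "emeasure \<sigma> (space \<sigma>) \<noteq> \<infinity>"
    by (subst emeasure_circle) (auto simp: sets_circle sets_restrict_space ennreal_divide_eq_top_iff)
qed

lemma measure_circle_space [simp]: "measure \<sigma> (sphere 0 1) = 1"
proof -
  have "emeasure \<sigma> (sphere 0 1) = emeasure lborel ({0..<2*pi} \<inter> cis -` sphere 0 1) / (2 * pi)"
    by (rule emeasure_circle) (auto simp: sets_circle sets_restrict_space)
  also have "{0..<2*pi} \<inter> cis -` sphere 0 1 = {0..<2*pi}" by auto
  also have "emeasure lborel \<dots> / (2*pi) = 1" by (simp add: divide_ennreal)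
  finally show ?thesis by (simp add: measure_def)
qed

lemma circle_measurable_id [measurable]: "(\<lambda>x. x) \<in> borel_measurable \<sigma>"
  by (subst measurable_cong_sets[OF sets_circle refl]) (rule measurable_restrict_space1, simp)

lemma circle_measurable_continuous:
  fixes h :: "complex \<Rightarrow> 'b::{topological_space}"
  assumes "continuous_on (sphere 0 1) h"
  shows "h \<in> borel_measurable \<sigma>"
  by (subst measurable_cong_sets[OF sets_circle refl])
    (rule borel_measurable_continuous_on_restrict[OF assms])

lemma circle_borel_sets: "A \<in> sets borel \<Longrightarrow> A \<inter> sphere 0 1 \<in> sets \<sigma>"
  by (auto simp: sets_circle sets_restrict_space)

lemma circle_integrable_bounded:
  fixes h :: "complex \<Rightarrow> 'b::{banach, second_countable_topology}"
  assumes "h \<in> borel_measurable \<sigma>" "\<And>x. norm x = 1 \<Longrightarrow> norm (h x) \<le> B"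
  shows "integrable \<sigma> h"
  by (rule circle.integrable_const_bound[of _ B]) (use assms in \<open>auto intro!: AE_I2\<close>)

lemma circle_integrable_continuous:
  fixes h :: "complex \<Rightarrow> 'b::{banach, second_countable_topology}"
  assumes "continuous_on (sphere 0 1) h"
  shows "integrable \<sigma> h"
proof -
  have "compact (h ` sphere 0 1)" using assms by (intro compact_continuous_image) auto
  then obtain B where "\<forall>x\<in>sphere 0 1. norm (h x) \<le> B"
    using compact_imp_bounded[of "h ` sphere 0 1"] unfolding bounded_iff by auto
  then show ?thesis
    using circle_measurable_continuous[OF assms] by (intro circle_integrable_bounded) auto
qed

lemma integral_circle_cis:
  fixes h :: "complex \<Rightarrow> complex"
  assumes h: "continuous_on (sphere 0 1) h"
  shows "((\<lambda>t. h (cis t)) has_integral (2 * pi) *\<^sub>R (\<integral>x. h x \<partial>\<sigma>)) {0..2*pi}"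
proof -
  have hm: "h \<in> borel_measurable (restrict_space borel (sphere 0 1))"
    by (rule borel_measurable_continuous_on_restrict[OF h])
  have cm: "continuous_on UNIV (\<lambda>t. h (cis t))"
    by (rule continuous_on_compose2[OF h]) (auto intro!: continuous_intros)
  then have hcm [measurable]: "(\<lambda>t. h (cis t)) \<in> borel_measurable lborel"
    by (auto intro: borel_measurable_continuous_onI)
  have "(\<integral>x. h x \<partial>\<sigma>) = (\<integral>t. h (cis t) \<partial>uniform_measure lborel {0..<2*pi})"
    unfolding circle_measure_def by (rule integral_distr) (use hm in auto)
  also have "uniform_measure lborel {0..<2*pi} = density lborel (\<lambda>t. ennreal (indicator {0..<2*pi} t / (2*pi)))"
    unfolding uniform_measure_def
    by (rule arg_cong[where f="density lborel"])
      (auto simp: indicator_def divide_ennreal[symmetric] fun_eq_iff)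
  also have "(\<integral>t. h (cis t) \<partial>\<dots>) = (\<integral>t. (indicator {0..<2*pi} t / (2*pi)) *\<^sub>R h (cis t) \<partial>lborel)"
    by (rule integral_density) auto
  \<comment> \<open>The endpoint 2 pi may be added because it is a null set; the closed interval is
    the one that \<open>has_integral\<close> refers to.\<close>
  also have "\<dots> = (\<integral>t. (1 / (2*pi)) *\<^sub>R (indicator {0..2*pi} t *\<^sub>R h (cis t)) \<partial>lborel)"
  proof (rule integral_cong_AE)
    show "AE x in lborel. (indicator {0..<2*pi} x / (2*pi)) *\<^sub>R h (cis x) = (1 / (2*pi)) *\<^sub>R (indicator {0..2*pi} x *\<^sub>R h (cis x))"
      using AE_lborel_singleton[of "2*pi"] by eventually_elim (auto simp: indicator_def)
  qed auto
  also have "\<dots> = (1 / (2*pi)) *\<^sub>R (\<integral>t. indicator {0..2*pi} t *\<^sub>R h (cis t) \<partial>lborel)"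
    by (rule Bochner_Integration.integral_scaleR_right)
  also have "(\<integral>t. indicator {0..2*pi} t *\<^sub>R h (cis t) \<partial>lborel) = integral {0..2*pi} (\<lambda>t. h (cis t))"
    using set_borel_integral_eq_integral(2)[of "{0..2*pi}" "\<lambda>t. h (cis t)"]
      borel_integrable_atLeastAtMost'[OF continuous_on_subset[OF cm], of 0 "2*pi"]
    by (simp add: set_lebesgue_integral_def)
  finally have eq: "(2 * pi) *\<^sub>R (\<integral>x. h x \<partial>\<sigma>) = integral {0..2*pi} (\<lambda>t. h (cis t))"
    by simp
  show ?thesis unfolding eq
    by (rule integrable_integral, rule integrable_continuous_real, rule continuous_on_subset[OF cm]) auto
qed

text \<open>Along the unit circle dz = i z dt, which explains the factor x in the integrand; the
  factor 2 pi undoes the normalization. This carries Cauchy's formula over to integrals against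
  \<sigma>.\<close>

lemma integral_circle_contour:
  fixes h :: "complex \<Rightarrow> complex"
  assumes h: "continuous_on (sphere 0 1) h"
  shows "(h has_contour_integral (2 * pi * \<i> * (\<integral>x. x * h x \<partial>\<sigma>))) (circlepath 0 1)"
proof -
  have "((\<lambda>t. cis t * h (cis t)) has_integral (2 * pi) *\<^sub>R (\<integral>x. x * h x \<partial>\<sigma>)) {0..2*pi}"
    by (rule integral_circle_cis) (intro continuous_intros h)
  from has_integral_mult_right[OF this, of \<i>] show ?thesis
    unfolding circlepath_def
    by (subst has_contour_integral_part_circlepath_iff) (auto simp: scaleR_conv_of_real mult_ac)
qed

lemma cauchy_circle:
  assumes f: "continuous_on (cball 0 1) f" "f holomorphic_on ball 0 1" and w: "w \<in> ball 0 1"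
  shows "(\<integral>x. x / (x - w) * f x \<partial>\<sigma>) = f w"
proof -
  have "continuous_on (sphere 0 1) f" by (rule continuous_on_subset[OF f(1)]) auto
  then have "continuous_on (sphere 0 1) (\<lambda>x. f x / (x - w))"
    using w by (auto intro!: continuous_intros)
  from integral_circle_contour[OF this] Cauchy_integral_circlepath[OF f, of w] w
  have "2 * pi * \<i> * (\<integral>x. x * (f x / (x - w)) \<partial>\<sigma>) = 2 * pi * \<i> * f w"
    by (intro has_contour_integral_unique) auto
  then show ?thesis by (simp add: mult_ac)
qed

lemma mean_value_circle:
  assumes f: "continuous_on (cball 0 1) f" "f holomorphic_on ball 0 1"
  shows "(\<integral>x. f x \<partial>\<sigma>) = f 0"
proof -
  have "(\<integral>x. f x \<partial>\<sigma>) = (\<integral>x. x / (x - 0) * f x \<partial>\<sigma>)"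
    by (rule Bochner_Integration.integral_cong) auto
  then show ?thesis using cauchy_circle[OF f, of 0] by simp
qed

section \<open>The Poisson kernel and its reproducing property\<close>

definition poisson :: "complex \<Rightarrow> complex \<Rightarrow> real" where
  "poisson z x = (1 - (norm z)\<^sup>2) / (norm (x - z))\<^sup>2"

lemma poisson_nonneg: "norm z < 1 \<Longrightarrow> 0 \<le> poisson z x"
  by (simp add: poisson_def power_le_one)

lemma poisson_continuous: "norm z < 1 \<Longrightarrow> continuous_on (sphere 0 1) (poisson z)"
  unfolding poisson_def by (auto intro!: continuous_intros)

lemma poisson_measurable [measurable]: "poisson z \<in> borel_measurable \<sigma>"
  unfolding poisson_def by measurable

lemma cnj_eq_inverse: "norm (x::complex) = 1 \<Longrightarrow> cnj x = 1 / x"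
  by (metis complex_div_cnj complex_norm_square mult_1 of_real_1 one_power2 div_by_1)

lemma one_minus_cnj_ne: "norm z < 1 \<Longrightarrow> norm x \<le> 1 \<Longrightarrow> 1 - cnj z * x \<noteq> 0"
proof
  assume a: "norm z < 1" "norm x \<le> 1" "1 - cnj z * x = 0"
  then have "norm (cnj z * x) = 1" by (metis eq_iff_diff_eq_0 norm_one)
  moreover have "norm (cnj z * x) \<le> norm z * 1" unfolding norm_mult using a by (intro mult_mono) auto
  ultimately show False using a by simp
qed

text \<open>On the circle cnj x = 1 / x, which turns the real kernel into a rational function of x
  whose only pole in the closed disc is x = z, so that Cauchy's formula becomes applicable.\<close>

lemma poisson_eq:
  fixes z x :: complex
  assumes "norm z < 1" "norm x = 1"
  shows "of_real (poisson z x) = (1 - (norm z)\<^sup>2) * x / ((x - z) * (1 - cnj z * x))"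
proof -
  have x0: "x \<noteq> 0" using assms by auto
  have xz: "x \<noteq> z" using assms by auto
  have "cnj x = 1 / x" using assms(2) by (rule cnj_eq_inverse)
  then have "of_real ((norm (x - z))\<^sup>2) = (x - z) * (1 / x - cnj z)"
    by (simp add: complex_norm_square del: of_real_power)
  also have "\<dots> = (x - z) * (1 - cnj z * x) / x" using x0 by (simp add: field_simps)
  finally show ?thesis unfolding poisson_def by (simp add: del: of_real_power)
qed

text \<open>The two quotients are conjugate to each other on the circle. The first is holomorphic in
  z and leads to Herglotz integrals; the second is holomorphic in x on the disc and can multiply
  functions of H^1.\<close>

lemma poisson_Re:
  assumes "norm z < 1" "norm x = 1"
  shows "poisson z x = Re ((x + z) / (x - z))"
    and "poisson z x = Re ((1 + cnj z * x) / (1 - cnj z * x))"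
proof -
  show *: "poisson z x = Re ((x + z) / (x - z))"
    using assms unfolding poisson_def complex_div_cnj[of "x+z" "x-z"]
    by (simp add: Re_divide_of_real cmod_power2 del: of_real_power)
       (simp add: algebra_simps power2_eq_square cmod_def)
  have x0: "x \<noteq> 0" using assms by auto
  have c: "cnj x = 1 / x" using assms(2) by (rule cnj_eq_inverse)
  have "(1 + cnj z * x) / (1 - cnj z * x) = cnj ((x + z) / (x - z))"
    using x0 assms one_minus_cnj_ne[of z x] by (auto simp add: c divide_simps algebra_simps)
  then show "poisson z x = Re ((1 + cnj z * x) / (1 - cnj z * x))"
    using * by (simp only: cnj.sel)
qed

text \<open>By \<open>poisson_eq\<close> the kernel is the Cauchy kernel times a function that is
  holomorphic in x and equals 1 at x = w.\<close>

lemma poisson_integral_holomorphic: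
  assumes f: "continuous_on (cball 0 1) f" "f holomorphic_on ball 0 1" and w: "norm w < 1"
  shows "(\<integral>x. of_real (poisson w x) * f x \<partial>\<sigma>) = f w"
proof -
  let ?h = "\<lambda>x. f x * ((1 - (norm w)\<^sup>2) / (1 - cnj w * x))"
  have ne: "1 - cnj w * x \<noteq> 0" if "norm x \<le> 1" for x using one_minus_cnj_ne[OF w that] .
  have "(\<integral>x. of_real (poisson w x) * f x \<partial>\<sigma>) = (\<integral>x. x / (x - w) * ?h x \<partial>\<sigma>)"
    by (rule Bochner_Integration.integral_cong) (use w in \<open>auto simp: poisson_eq\<close>)
  also have "\<dots> = ?h w"
    by (rule cauchy_circle) (use w ne in \<open>auto intro!: continuous_intros holomorphic_intros f\<close>)
  also have "(1 - (norm w)\<^sup>2) / (1 - cnj w * w) = (1::complex)"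
    using ne[of w] w by (simp add: complex_norm_square mult.commute del: of_real_power)
  finally show ?thesis by simp
qed

lemma poisson_integral_one:
  assumes w: "norm w < 1" shows "(\<integral>x. poisson w x \<partial>\<sigma>) = 1"
proof -
  have "(\<integral>x. of_real (poisson w x) * 1 \<partial>\<sigma>) = (1::complex)"
    by (rule poisson_integral_holomorphic[OF _ _ w]) auto
  then show ?thesis by simp
qed

lemma poisson_le:
  assumes "norm w < 1" "norm x = 1" shows "poisson w x \<le> 2 / (1 - norm w)"
proof -
  have "1 - norm w \<le> norm (x - w)" using norm_triangle_ineq2[of x w] assms by simp
  then have "(1 - norm w)\<^sup>2 \<le> (norm (x - w))\<^sup>2" using assms by (intro power_mono) auto
  then have "poisson w x \<le> (1 - (norm w)\<^sup>2) / (1 - norm w)\<^sup>2"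
    unfolding poisson_def using assms \<open>1 - norm w \<le> norm (x - w)\<close>
    by (intro divide_left_mono mult_pos_pos zero_less_power) (auto simp: power_le_one)
  also have "\<dots> = (1 + norm w) / (1 - norm w)"
  proof -
    have "1 - (norm w)\<^sup>2 = (1 + norm w) * (1 - norm w)" by (simp add: power2_eq_square algebra_simps)
    then show ?thesis using assms by (simp add: power2_eq_square)
  qed
  also have "\<dots> \<le> 2 / (1 - norm w)" using assms by (intro divide_right_mono) auto
  finally show ?thesis .
qed

lemma poisson_mult_integrable:
  fixes g :: "complex \<Rightarrow> 'b::{banach, second_countable_topology}"
  assumes g: "integrable \<sigma> g" and w: "norm w < 1"
  shows "integrable \<sigma> (\<lambda>x. poisson w x *\<^sub>R g x)"
proof (rule Bochner_Integration.integrable_bound[where f = "\<lambda>x. (2 / (1 - norm w)) *\<^sub>R g x"])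
  show "AE x in \<sigma>. norm (poisson w x *\<^sub>R g x) \<le> norm ((2 / (1 - norm w)) *\<^sub>R g x)"
    using mult_right_mono[OF poisson_le[OF w]] poisson_nonneg[OF w] w by (auto intro!: AE_I2)
  have "g \<in> borel_measurable \<sigma>" using g by simp
  then show "(\<lambda>x. poisson w x *\<^sub>R g x) \<in> borel_measurable \<sigma>" by measurable
qed (use g in auto)

section \<open>Radial limits of Poisson integrals\<close>

text \<open>Jordan's inequality: the concave sine lies above its chord over [0, pi/2].\<close>

lemma sin_ge_linear: assumes "0 \<le> x" "x \<le> pi/2" shows "2 * x / pi \<le> sin x"
proof -
  have "concave_on {0..pi} sin"
    by (rule f''_le0_imp_concave[where f' = cos and f'' = "\<lambda>x. - sin x"])
       (auto intro!: derivative_eq_intros sin_ge_zero)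
  then have "convex_on {0..pi} (\<lambda>x. - sin x)" by (simp add: concave_on_def)
  from convex_onD[OF this, of "2*x/pi" 0 "pi/2"] assms
  have "- sin ((1 - 2*x/pi) *\<^sub>R 0 + (2*x/pi) *\<^sub>R (pi/2)) \<le> (1 - 2*x/pi) * (- sin 0) + (2*x/pi) * (- sin (pi/2))"
    by (auto simp: field_simps)
  then show ?thesis by simp
qed

lemma norm_cis_diff: "norm (cis a - cis b) = 2 * \<bar>sin ((a - b) / 2)\<bar>"
proof -
  have "(norm (cis a - cis b))\<^sup>2 = (cos a - cos b)\<^sup>2 + (sin a - sin b)\<^sup>2"
    by (simp add: cmod_power2)
  also have "\<dots> = 2 - 2 * cos (a - b)"
    using sin_cos_squared_add[of a] sin_cos_squared_add[of b]
    by (simp add: cos_diff power2_eq_square algebra_simps)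
  also have "cos (a - b) = 1 - 2 * (sin ((a - b) / 2))\<^sup>2"
  proof -
    have "a - b = 2 * ((a - b) / 2)" by simp
    then show ?thesis using cos_double_sin[of "(a - b) / 2"] by metis
  qed
  finally have "(norm (cis a - cis b))\<^sup>2 = (2 * \<bar>sin ((a - b) / 2)\<bar>)\<^sup>2"
    by (simp add: power_mult_distrib)
  then show ?thesis by (rule power2_eq_imp_eq) auto
qed

lemma sin_near_zero:
  assumes "\<bar>s\<bar> \<le> pi" shows "2 / pi * min \<bar>s\<bar> (pi - \<bar>s\<bar>) \<le> \<bar>sin s\<bar>"
proof -
  have *: "\<bar>sin s\<bar> = sin \<bar>s\<bar>"
    using assms sin_ge_zero[of "\<bar>s\<bar>"] by (cases "s \<ge> 0") auto
  show ?thesis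
  proof (cases "\<bar>s\<bar> \<le> pi / 2")
    case True
    then show ?thesis using sin_ge_linear[of "\<bar>s\<bar>"] * by (simp add: min_def field_simps)
  next
    case False
    then have "2 * (pi - \<bar>s\<bar>) / pi \<le> sin (pi - \<bar>s\<bar>)" using assms by (intro sin_ge_linear) auto
    moreover have "sin (pi - \<bar>s\<bar>) = sin \<bar>s\<bar>" by simp
    ultimately show ?thesis using * False by (simp add: min_def)
  qed
qed

section \<open>The maximal inequality on the circle\<close>

lemma measure_circle_ball:
  assumes \<eta>: "norm \<eta> = 1" and h: "h > 0"
  shows "measure \<sigma> (ball \<eta> h \<inter> sphere 0 1) \<le> 2 * h"
proof -
  define b where "b = Arg2pi \<eta>"
  have b: "cis b = \<eta>" "0 \<le> b" "b < 2 * pi"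
    using Arg2pi[of \<eta>] \<eta> by (auto simp: b_def cis_conv_exp is_Arg_def)
  \<comment> \<open>The arc around \<open>\<eta>\<close> may wrap around the cut at angle 0, so its
    angles are covered by an interval around b and its two translates by 2 pi. The half-length pi h
    / 2 comes from Jordan's inequality; the total length 3 pi h gives measure 3 h / 2.\<close>
  let ?I = "\<lambda>c. {c - pi * h / 2 .. c + pi * h / 2}"
  have sub: "{0..<2*pi} \<inter> cis -` (ball \<eta> h \<inter> sphere 0 1) \<subseteq> ?I b \<union> (?I (b + 2*pi) \<union> ?I (b - 2*pi))"
  proof
    fix t assume "t \<in> {0..<2*pi} \<inter> cis -` (ball \<eta> h \<inter> sphere 0 1)"
    then have t: "0 \<le> t" "t < 2 * pi" and "norm (cis t - cis b) < h"
      using b by (auto simp: dist_norm norm_minus_commute)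
    then have "2 * \<bar>sin ((t - b)/2)\<bar> < h" by (simp add: norm_cis_diff)
    moreover have "2 / pi * min \<bar>(t - b)/2\<bar> (pi - \<bar>(t - b)/2\<bar>) \<le> \<bar>sin ((t - b)/2)\<bar>"
      using t b by (intro sin_near_zero) auto
    ultimately have "4 / pi * min \<bar>(t - b)/2\<bar> (pi - \<bar>(t - b)/2\<bar>) < h" by simp
    then have "min \<bar>(t - b)/2\<bar> (pi - \<bar>(t - b)/2\<bar>) < pi * h / 4" by (simp add: field_simps)
    then have "\<bar>t - b\<bar> < pi * h / 2 \<or> 2 * pi - \<bar>t - b\<bar> < pi * h / 2"
      by (simp add: min_def split: if_splits; linarith)
    then have "\<bar>t - b\<bar> \<le> pi * h / 2 \<or> \<bar>t - (b + 2*pi)\<bar> \<le> pi * h / 2 \<or> \<bar>t - (b - 2*pi)\<bar> \<le> pi * h / 2"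
      using t b by linarith
    then show "t \<in> ?I b \<union> (?I (b + 2*pi) \<union> ?I (b - 2*pi))"
      unfolding abs_le_iff by auto
  qed
  have *: "emeasure lborel (?I c) = ennreal (pi * h)" for c
    using h by (simp add: field_simps)
  have "emeasure lborel ({0..<2*pi} \<inter> cis -` (ball \<eta> h \<inter> sphere 0 1)) \<le> emeasure lborel (?I b \<union> (?I (b + 2*pi) \<union> ?I (b - 2*pi)))"
    by (rule emeasure_mono[OF sub]) auto
  also have "\<dots> \<le> emeasure lborel (?I b) + (emeasure lborel (?I (b + 2*pi)) + emeasure lborel (?I (b - 2*pi)))"
    by (intro order_trans[OF emeasure_subadditive] add_mono order_refl) auto
  also have "\<dots> = ennreal (3 * pi * h)" using h unfolding * by (simp flip: ennreal_plus)
  finally have "emeasure \<sigma> (ball \<eta> h \<inter> sphere 0 1) \<le> ennreal (3 * pi * h) / ennreal (2 * pi)"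
    by (subst emeasure_circle) (auto intro!: divide_right_mono_ennreal circle_borel_sets)
  also have "\<dots> = ennreal (3 * h / 2)" using h by (subst divide_ennreal) (auto simp: field_simps)
  finally have "measure \<sigma> (ball \<eta> h \<inter> sphere 0 1) \<le> 3 * h / 2"
    using h by (simp add: circle.emeasure_eq_measure)
  then show ?thesis using h by simp
qed

text \<open>Weak type estimate by Vitali covering: K collects the centres and radii that violate the
  bound, and disjoint members of K have total radius at most the integral of g divided by L. The
  constant 10 is the Vitali enlargement 5 times the factor 2 of \<open>measure_circle_ball\<close>.
  The set A is a countable union of balls, so measurability of the maximal function itself never
  arises.\<close>

lemma maximal_weak_type:
  fixes g :: "complex \<Rightarrow> real"
  assumes g: "integrable \<sigma> g" and nonneg: "\<And>x. 0 \<le> g x" and "0 < L"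
  obtains A where "A \<in> sets \<sigma>" "measure \<sigma> A \<le> 10 / L * (\<integral>x. g x \<partial>\<sigma>)"
    "\<And>\<eta> h. norm \<eta> = 1 \<Longrightarrow> \<eta> \<notin> A \<Longrightarrow> 0 < h \<Longrightarrow> (\<integral>x. indicator (ball \<eta> h) x * g x \<partial>\<sigma>) \<le> L * h"
proof -
  define I where "I = (\<lambda>p::complex\<times>real. \<integral>x. indicator (ball (fst p) (snd p)) x * g x \<partial>\<sigma>)"
  define K where "K = {p. norm (fst p) = 1 \<and> 0 < snd p \<and> L * snd p < I p}"
  have gm [measurable]: "g \<in> borel_measurable \<sigma>" using g by simp
  have int: "integrable \<sigma> (\<lambda>x. indicator B x * g x)" if "B \<in> sets borel" for B
  proof -
    have [measurable]: "(\<lambda>x. indicator B x :: real) \<in> borel_measurable \<sigma>"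
      using measurable_compose[OF circle_measurable_id borel_measurable_indicator[OF that]] by simp
    have m: "(\<lambda>x. indicator B x * g x) \<in> borel_measurable \<sigma>" by measurable
    show ?thesis by (rule Bochner_Integration.integrable_bound[OF g m]) (auto simp: indicator_def)
  qed
  \<comment> \<open>Vitali's lemma requires bounded radii; a violating ball satisfies L h <
    (integral of g).\<close>
  have bound: "snd p \<le> (\<integral>x. g x \<partial>\<sigma>) / L" if "p \<in> K" for p
  proof -
    have "I p \<le> (\<integral>x. g x \<partial>\<sigma>)" unfolding I_def
      by (rule integral_mono[OF int g]) (use nonneg in \<open>auto simp: indicator_def\<close>)
    then show ?thesis using that \<open>0 < L\<close> by (auto simp: K_def field_simps)
  qed
  obtain C where C: "countable C" "C \<subseteq> K"
    and disj: "pairwise (\<lambda>i j. disjnt (ball (fst i) (snd i)) (ball (fst j) (snd j))) C"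
    and cover: "fst ` K \<subseteq> (\<Union>i\<in>C. ball (fst i) (5 * snd i))"
    by (rule Vitali_covering_lemma_balls[where S = "fst ` K" and K = K and a = fst and r = snd
            and B = "(\<integral>x. g x \<partial>\<sigma>) / L"])
       (use bound in \<open>auto simp: K_def intro!: exI\<close>)
  \<comment> \<open>The countable family C is exhausted by finite pieces, so that subadditivity and
    disjoint sums are finite and only the final measure is a limit.\<close>
  define Cn where "Cn n = {i\<in>C. to_nat_on C i < n}" for n
  have finCn: "finite (Cn n)" for n
  proof (rule finite_imageD)
    show "finite (to_nat_on C ` Cn n)" by (rule finite_subset[of _ "{..<n}"]) (auto simp: Cn_def)
    show "inj_on (to_nat_on C) (Cn n)"
      using inj_on_to_nat_on[OF C(1)] by (rule inj_on_subset) (auto simp: Cn_def)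
  qed
  define An where "An n = (\<Union>i\<in>Cn n. ball (fst i) (5 * snd i)) \<inter> sphere 0 1" for n
  have An_sets [measurable]: "An n \<in> sets \<sigma>" for n
    unfolding An_def by (intro circle_borel_sets borel_open open_UN) auto
  have sumr: "(\<Sum>i\<in>Cn n. L * snd i) \<le> (\<integral>x. g x \<partial>\<sigma>)" for n
  proof -
    have "(\<Sum>i\<in>Cn n. L * snd i) \<le> (\<Sum>i\<in>Cn n. I i)"
      by (rule sum_mono) (use C in \<open>auto simp: Cn_def K_def intro!: less_imp_le\<close>)
    also have "\<dots> = (\<integral>x. (\<Sum>i\<in>Cn n. indicator (ball (fst i) (snd i)) x * g x) \<partial>\<sigma>)"
      unfolding I_def by (subst Bochner_Integration.integral_sum) (auto intro!: int)
    also have "\<dots> \<le> (\<integral>x. g x \<partial>\<sigma>)"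
    proof (rule integral_mono)
      fix x
      have "(\<Sum>i\<in>Cn n. indicator (ball (fst i) (snd i)) x) = (indicator (\<Union>i\<in>Cn n. ball (fst i) (snd i)) x :: real)"
        using finCn[of n] disj
        by (subst indicator_UN_disjoint) (auto simp: Cn_def disjoint_family_on_def pairwise_def disjnt_def)
      then show "(\<Sum>i\<in>Cn n. indicator (ball (fst i) (snd i)) x * g x) \<le> g x"
        using nonneg[of x] unfolding sum_distrib_right[symmetric] by (auto simp: indicator_def)
    qed (auto intro!: int g)
    finally show ?thesis .
  qed
  have mAn: "measure \<sigma> (An n) \<le> 10 / L * (\<integral>x. g x \<partial>\<sigma>)" for n
  proof -
    have "measure \<sigma> (An n) \<le> (\<Sum>i\<in>Cn n. measure \<sigma> (ball (fst i) (5 * snd i) \<inter> sphere 0 1))"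
    proof -
      have "An n = (\<Union>i\<in>Cn n. ball (fst i) (5 * snd i) \<inter> sphere 0 1)" by (auto simp: An_def)
      then show ?thesis using finCn[of n]
        by (simp only:) (intro circle.finite_measure_subadditive_finite, auto intro!: circle_borel_sets)
    qed
    also have "\<dots> \<le> (\<Sum>i\<in>Cn n. 2 * (5 * snd i))"
      by (rule sum_mono, rule measure_circle_ball) (use C in \<open>auto simp: Cn_def K_def\<close>)
    also have "\<dots> = 10 / L * (\<Sum>i\<in>Cn n. L * snd i)"
      using \<open>0 < L\<close> by (simp add: sum_distrib_left mult.assoc)
    also have "\<dots> \<le> 10 / L * (\<integral>x. g x \<partial>\<sigma>)"
      using \<open>0 < L\<close> by (intro mult_left_mono sumr) auto
    finally show ?thesis .
  qed
  have UN: "(\<Union>n. An n) = (\<Union>i\<in>C. ball (fst i) (5 * snd i)) \<inter> sphere 0 1"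
  proof -
    have "(\<Union>n. Cn n) = C" by (auto simp: Cn_def)
    then show ?thesis unfolding An_def by blast
  qed
  show thesis
  proof (rule that[of "\<Union>n. An n"])
    show "(\<Union>n. An n) \<in> sets \<sigma>" by measurable
    have "(\<lambda>n. measure \<sigma> (An n)) \<longlonglongrightarrow> measure \<sigma> (\<Union>n. An n)"
    proof (rule circle.finite_Lim_measure_incseq)
      show "incseq An"
      proof (rule incseq_SucI)
        fix n
        have "Cn n \<subseteq> Cn (Suc n)" by (auto simp: Cn_def)
        then show "An n \<subseteq> An (Suc n)" unfolding An_def by blast
      qed
    qed (use An_sets in auto)
    then show "measure \<sigma> (\<Union>n. An n) \<le> 10 / L * (\<integral>x. g x \<partial>\<sigma>)"
      by (rule LIMSEQ_le_const2) (use mAn in auto)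
    fix \<eta> :: complex and h :: real
    assume a: "norm \<eta> = 1" "\<eta> \<notin> (\<Union>n. An n)" "0 < h"
    have "\<eta> \<notin> (\<Union>i\<in>C. ball (fst i) (5 * snd i))" using a(1,2) unfolding UN by simp
    then have "\<eta> \<notin> fst ` K" using contra_subsetD[OF cover] by simp
    then have "(\<eta>, h) \<notin> K" by (metis fst_conv image_eqI)
    then show "(\<integral>x. indicator (ball \<eta> h) x * g x \<partial>\<sigma>) \<le> L * h"
      using a by (auto simp: K_def I_def)
  qed
qed

text \<open>Every point of the circle has distance at least 1 - r from \<open>r * \<eta>\<close>,
  and 1 - r is exactly the distance from \<open>r * \<eta>\<close> to \<open>\<eta>\<close>.\<close>

lemma norm_minus_radial:
  fixes x \<eta> :: complex
  assumes "norm \<eta> = 1" "norm x = 1" "0 \<le> r" "r < 1"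
  shows "norm (x - \<eta>) \<le> 2 * norm (x - of_real r * \<eta>)"
proof -
  have "norm (x - \<eta>) \<le> norm (x - of_real r * \<eta>) + norm (of_real r * \<eta> - \<eta>)"
    using norm_triangle_ineq[of "x - of_real r * \<eta>" "of_real r * \<eta> - \<eta>"] by simp
  also have "norm (of_real r * \<eta> - \<eta>) = norm (of_real (r - 1) * \<eta>)"
    by (simp add: algebra_simps)
  also have "\<dots> = 1 - r"
    using assms by (simp add: norm_mult del: of_real_diff)
  also have "1 - r \<le> norm (x - of_real r * \<eta>)"
    using norm_triangle_ineq2[of x "of_real r * \<eta>"] assms by (simp add: norm_mult)
  finally show ?thesis by simp
qed

text \<open>With d = 1 - r, split the circle into dyadic rings around \<open>\<eta>\<close> of
  radius 2^k d. On the k-th ring the kernel is at most 32 / (4^k d), while the ball has g-mass at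
  most L 2^k d, so the terms are at most 32 L / 2^k, with sum at most 64 L.\<close>

lemma poisson_le_maximal:
  fixes g :: "complex \<Rightarrow> real"
  assumes g: "integrable \<sigma> g" and nonneg: "\<And>x. 0 \<le> g x" and \<eta>: "norm \<eta> = 1"
    and max: "\<And>h. 0 < h \<Longrightarrow> (\<integral>x. indicator (ball \<eta> h) x * g x \<partial>\<sigma>) \<le> L * h"
    and r: "0 \<le> r" "r < 1"
  shows "(\<integral>x. poisson (of_real r * \<eta>) x * g x \<partial>\<sigma>) \<le> 64 * L"
proof -
  define d where "d = 1 - r"
  have d: "0 < d" using r by (simp add: d_def)
  have nz: "norm (of_real r * \<eta>) = r" using \<eta> r by (simp add: norm_mult)
  \<comment> \<open>Radius greater than 2 makes the last ball contain the whole circle.\<close>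
  obtain N :: nat where N: "2 < 2 ^ N * d"
    using real_arch_pow[of 2 "2/d"] d by (auto simp: field_simps)
  have gm [measurable]: "g \<in> borel_measurable \<sigma>" using g by simp
  have int: "integrable \<sigma> (\<lambda>x. indicator (ball \<eta> h) x * g x)" for h
  proof -
    have [measurable]: "(\<lambda>x. indicator (ball \<eta> h) x :: real) \<in> borel_measurable \<sigma>"
      using measurable_compose[OF circle_measurable_id borel_measurable_indicator[of "ball \<eta> h"]] by simp
    have m: "(\<lambda>x. indicator (ball \<eta> h) x * g x) \<in> borel_measurable \<sigma>" by measurable
    show ?thesis by (rule Bochner_Integration.integrable_bound[OF g m]) (auto simp: indicator_def)
  qed
  have pw: "poisson (of_real r * \<eta>) x \<le> (\<Sum>k\<le>N. 32 / (4^k * d) * indicator (ball \<eta> (2^k * d)) x)"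
    if x: "norm x = 1" for x
  proof -
    define k where "k = (LEAST k. norm (x - \<eta>) < 2^k * d)"
    have NN: "norm (x - \<eta>) < 2^N * d" using norm_triangle_ineq4[of x \<eta>] N x \<eta> by simp
    have k: "norm (x - \<eta>) < 2^k * d" unfolding k_def by (rule LeastI[where k=N]) (rule NN)
    have kN: "k \<le> N" unfolding k_def by (rule Least_le) (rule NN)
    have "poisson (of_real r * \<eta>) x \<le> 32 / (4^k * d)"
    proof (cases k)
      case 0
      have "poisson (of_real r * \<eta>) x \<le> 2 / d"
        using poisson_le[of "of_real r * \<eta>" x] nz r x by (simp add: d_def)
      also have "\<dots> \<le> 32 / d" using d by (intro divide_right_mono) auto
      finally show ?thesis using 0 by simp
    next
      case (Suc j)
      have "\<not> norm (x - \<eta>) < 2^j * d" using not_less_Least[of j "\<lambda>k. norm (x - \<eta>) < 2^k * d"] Suc k_def by simp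
      then have "2^j * d / 2 \<le> norm (x - of_real r * \<eta>)"
        using norm_minus_radial[OF \<eta> x r] by simp
      then have le: "(2^j * d / 2)\<^sup>2 \<le> (norm (x - of_real r * \<eta>))\<^sup>2"
        using d by (intro power_mono) auto
      have pos: "0 < (2^j * d / 2)\<^sup>2" using d by simp
      have "poisson (of_real r * \<eta>) x \<le> (1 - r\<^sup>2) / (2^j * d / 2)\<^sup>2"
        unfolding poisson_def nz using r le pos
        by (intro divide_left_mono mult_pos_pos) (auto simp: power_le_one)
      also have "\<dots> \<le> (2 * d) / (2^j * d / 2)\<^sup>2"
      proof (rule divide_right_mono)
        have "1 - r\<^sup>2 = (1 + r) * d" by (simp add: d_def power2_eq_square algebra_simps)
        also have "\<dots> \<le> 2 * d" using r d by (intro mult_right_mono) auto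
        finally show "1 - r\<^sup>2 \<le> 2 * d" .
      qed auto
      also have "\<dots> = 32 / (4^k * d)"
        using d by (simp add: Suc power2_eq_square field_simps flip: power_mult_distrib)
      finally show ?thesis .
    qed
    also have "\<dots> = 32 / (4^k * d) * indicator (ball \<eta> (2^k * d)) x"
      using k by (simp add: dist_norm norm_minus_commute)
    also have "\<dots> \<le> (\<Sum>k\<le>N. 32 / (4^k * d) * indicator (ball \<eta> (2^k * d)) x)"
      by (rule member_le_sum[of k _ "\<lambda>k. 32 / (4^k * d) * indicator (ball \<eta> (2^k * d)) x"])
         (use kN d in auto)
    finally show ?thesis .
  qed
  have "(\<integral>x. poisson (of_real r * \<eta>) x * g x \<partial>\<sigma>)
      \<le> (\<integral>x. (\<Sum>k\<le>N. 32 / (4^k * d) * (indicator (ball \<eta> (2^k * d)) x * g x)) \<partial>\<sigma>)"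
  proof (rule integral_mono)
    show "integrable \<sigma> (\<lambda>x. poisson (of_real r * \<eta>) x * g x)"
      using poisson_mult_integrable[OF g, of "of_real r * \<eta>"] nz r by simp
    show "integrable \<sigma> (\<lambda>x. \<Sum>k\<le>N. 32 / (4^k * d) * (indicator (ball \<eta> (2^k * d)) x * g x))"
      by (intro Bochner_Integration.integrable_sum integrable_mult_right int)
    fix x assume "x \<in> space \<sigma>"
    then have "norm x = 1" by simp
    from mult_right_mono[OF pw[OF this] nonneg[of x]]
    show "poisson (of_real r * \<eta>) x * g x \<le> (\<Sum>k\<le>N. 32 / (4^k * d) * (indicator (ball \<eta> (2^k * d)) x * g x))"
      by (simp add: sum_distrib_right mult.assoc)
  qed
  also have "\<dots> = (\<Sum>k\<le>N. 32 / (4^k * d) * (\<integral>x. indicator (ball \<eta> (2^k * d)) x * g x \<partial>\<sigma>))"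
    by (subst Bochner_Integration.integral_sum) (auto intro!: int)
  also have "\<dots> \<le> (\<Sum>k\<le>N. 32 / (4^k * d) * (L * (2^k * d)))"
    using d by (intro sum_mono mult_left_mono max) auto
  also have "\<dots> = (\<Sum>k\<le>N. 32 * L * (1/2)^k)"
  proof (rule sum.cong)
    fix k
    have "(4::real)^k = 2^k * 2^k" by (simp flip: power_mult_distrib)
    then show "32 / (4^k * d) * (L * (2^k * d)) = 32 * L * (1/2)^k"
      using d by (simp add: field_simps)
  qed auto
  also have "\<dots> = 32 * L * (\<Sum>k\<le>N. (1/2)^k)" by (simp add: sum_distrib_left)
  also have "\<dots> \<le> 32 * L * 2"
  proof (rule mult_left_mono)
    have "(\<Sum>k\<le>N. (1/2::real)^k) = 2 - (1/2)^N" by (induction N) auto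
    then show "(\<Sum>k\<le>N. (1/2::real)^k) \<le> 2" by simp
    have "0 \<le> (\<integral>x. indicator (ball \<eta> 1) x * g x \<partial>\<sigma>)" using nonneg by (intro Bochner_Integration.integral_nonneg) auto
    then show "0 \<le> 32 * L" using max[of 1] by simp
  qed
  finally show ?thesis by simp
qed

lemma poisson_tendsto_uniformly:
  fixes g :: "complex \<Rightarrow> 'b::{banach, second_countable_topology}"
  assumes g: "continuous_on (sphere 0 1) g" and e: "0 < e"
  obtains R where "0 \<le> R" "R < 1"
    "\<And>r \<eta>. R \<le> r \<Longrightarrow> r < 1 \<Longrightarrow> norm \<eta> = 1 \<Longrightarrow>
       norm ((\<integral>x. poisson (of_real r * \<eta>) x *\<^sub>R g x \<partial>\<sigma>) - g \<eta>) \<le> e"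
proof -
  have cg: "compact (g ` sphere 0 1)" using g by (intro compact_continuous_image) auto
  obtain B where B: "B > 0" "\<And>x. norm x = 1 \<Longrightarrow> norm (g x) \<le> B"
  proof -
    have "bounded (g ` sphere 0 1)" using cg by (rule compact_imp_bounded)
    then obtain B where "B > 0" "\<forall>y\<in>g ` sphere 0 1. norm y \<le> B" unfolding bounded_pos by blast
    then show thesis by (intro that[of B]) auto
  qed
  have u: "uniformly_continuous_on (sphere 0 1) g"
    using g by (intro compact_uniformly_continuous) auto
  obtain d where d: "d > 0" "\<And>x y. norm x = 1 \<Longrightarrow> norm y = 1 \<Longrightarrow> norm (x - y) < d \<Longrightarrow> norm (g x - g y) < e/2"
  proof -
    obtain d where "d > 0" "\<forall>x\<in>sphere 0 1. \<forall>y\<in>sphere 0 1. dist y x < d \<longrightarrow> dist (g y) (g x) < e/2"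
      using u e unfolding uniformly_continuous_on_def by (meson half_gt_zero)
    then show thesis by (intro that[of d]) (auto simp: dist_norm)
  qed
  \<comment> \<open>Away from \<open>\<eta>\<close> the kernel is at most (1 - r^2) / (d/2)^2 and
    the oscillation of g at most 2 B, which gives 8 B / d^2 times 1 - r^2. Since 1 - r^2 \<le> 2 (1
    - r), the choice of R keeps this part below e/2.\<close>
  define c where "c = 8 * B / d\<^sup>2 + 1"
  have c: "c > 0" "8 * B / d\<^sup>2 \<le> c" using B(1) d(1) by (simp_all add: c_def add_nonneg_pos)
  define R where "R = max 0 (1 - e / (4 * c))"
  show thesis
  proof (rule that[of R])
    show "0 \<le> R" "R < 1" using e c by (auto simp: R_def)
    fix r \<eta> assume r: "R \<le> r" "r < 1" and \<eta>: "norm (\<eta>::complex) = 1"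
    have r0: "0 \<le> r" using r by (simp add: R_def)
    define z where "z = of_real r * \<eta>"
    have nz: "norm z = r" using \<eta> r0 by (simp add: norm_mult z_def)
    have z1: "norm z < 1" using nz r by simp
    have gi: "integrable \<sigma> g" by (rule circle_integrable_continuous[OF g])
    have "(\<integral>x. poisson z x *\<^sub>R g x \<partial>\<sigma>) - g \<eta> = (\<integral>x. poisson z x *\<^sub>R g x \<partial>\<sigma>) - (\<integral>x. poisson z x \<partial>\<sigma>) *\<^sub>R g \<eta>"
      using poisson_integral_one[OF z1] by simp
    also have "\<dots> = (\<integral>x. poisson z x *\<^sub>R g x - poisson z x *\<^sub>R g \<eta> \<partial>\<sigma>)"
      using poisson_mult_integrable[OF gi z1] circle_integrable_continuous[OF poisson_continuous[OF z1]]
      by (subst Bochner_Integration.integral_diff) auto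
    also have "norm \<dots> \<le> (\<integral>x. norm (poisson z x *\<^sub>R g x - poisson z x *\<^sub>R g \<eta>) \<partial>\<sigma>)"
      by (rule integral_norm_bound)
    also have "\<dots> \<le> (\<integral>x. e/2 * poisson z x + c * (1 - r\<^sup>2) \<partial>\<sigma>)"
    proof (rule integral_mono)
      show "integrable \<sigma> (\<lambda>x. norm (poisson z x *\<^sub>R g x - poisson z x *\<^sub>R g \<eta>))"
        by (rule circle_integrable_continuous) (intro continuous_intros g poisson_continuous z1)
      show "integrable \<sigma> (\<lambda>x. e/2 * poisson z x + c * (1 - r\<^sup>2))"
        by (rule circle_integrable_continuous) (intro continuous_intros poisson_continuous z1)
      fix x assume "x \<in> space \<sigma>"
      then have x: "norm x = 1" by simp
      have p0: "0 \<le> poisson z x" using z1 by (rule poisson_nonneg)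
      have r2: "r\<^sup>2 \<le> 1" using r r0 by (simp add: power_le_one)
      have eq: "norm (poisson z x *\<^sub>R g x - poisson z x *\<^sub>R g \<eta>) = poisson z x * norm (g x - g \<eta>)"
        using p0 by (simp flip: scaleR_diff_right)
      show "norm (poisson z x *\<^sub>R g x - poisson z x *\<^sub>R g \<eta>) \<le> e/2 * poisson z x + c * (1 - r\<^sup>2)"
      proof (cases "norm (x - \<eta>) < d")
        case True
        have "poisson z x * norm (g x - g \<eta>) \<le> poisson z x * (e/2)"
          using d(2)[OF x \<eta> True] by (intro mult_left_mono p0) auto
        moreover have "0 \<le> c * (1 - r\<^sup>2)" using c r2 by simp
        ultimately show ?thesis unfolding eq by (simp add: mult.commute)
      next
        case False
        then have "d / 2 \<le> norm (x - z)" using norm_minus_radial[OF \<eta> x r0 r(2)] by (simp add: z_def)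
        then have le: "(d/2)\<^sup>2 \<le> (norm (x - z))\<^sup>2" using d by (intro power_mono) auto
        have "poisson z x \<le> (1 - r\<^sup>2) / (d/2)\<^sup>2"
          unfolding poisson_def nz using le d r2
          by (intro divide_left_mono mult_pos_pos less_le_trans[OF _ le] zero_less_power) auto
        moreover have "norm (g x - g \<eta>) \<le> 2 * B"
          using norm_triangle_ineq4[of "g x" "g \<eta>"] B(2)[OF x] B(2)[OF \<eta>] by simp
        ultimately have "poisson z x * norm (g x - g \<eta>) \<le> (1 - r\<^sup>2) / (d/2)\<^sup>2 * (2 * B)"
          using r2 by (intro mult_mono) auto
        also have "\<dots> = 8 * B / d\<^sup>2 * (1 - r\<^sup>2)" by (simp add: field_simps power2_eq_square)
        also have "\<dots> \<le> c * (1 - r\<^sup>2)" using c r2 by (intro mult_right_mono) auto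
        finally show ?thesis unfolding eq using p0 e by (simp add: add_increasing)
      qed
    qed
    also have "\<dots> = e/2 + c * (1 - r\<^sup>2)"
      using poisson_integral_one[OF z1] circle_integrable_continuous[OF poisson_continuous[OF z1]]
      by (subst Bochner_Integration.integral_add) auto
    also have "c * (1 - r\<^sup>2) \<le> e/2"
    proof -
      have "1 - r\<^sup>2 = (1 + r) * (1 - r)" by (simp add: power2_eq_square algebra_simps)
      also have "\<dots> \<le> 2 * (e / (4 * c))" using r r0 by (intro mult_mono) (auto simp: R_def)
      finally have "c * (1 - r\<^sup>2) \<le> c * (2 * (e / (4 * c)))" using c by (intro mult_left_mono) auto
      then show ?thesis using c by simp
    qed
    finally show "norm ((\<integral>x. poisson (of_real r * \<eta>) x *\<^sub>R g x \<partial>\<sigma>) - g \<eta>) \<le> e"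
      by (simp add: z_def)
  qed
qed

section \<open>Fatou's theorem: from continuous functions to all integrable ones\<close>

definition fatou :: "(complex \<Rightarrow> 'b::{banach, second_countable_topology}) \<Rightarrow> bool" where
  "fatou g \<longleftrightarrow> (AE \<eta> in \<sigma>. ((\<lambda>r. \<integral>x. poisson (of_real r * \<eta>) x *\<^sub>R g x \<partial>\<sigma>) \<longlongrightarrow> g \<eta>) (at_left 1))"

lemma eventually_radius: "0 \<le> R \<Longrightarrow> R < 1 \<Longrightarrow> eventually (\<lambda>r::real. R \<le> r \<and> 0 \<le> r \<and> r < 1) (at_left 1)"
  using eventually_at_left_real[of R "1::real"] by (auto elim!: eventually_mono)

lemma fatou_continuous:
  fixes g :: "complex \<Rightarrow> 'b::{banach, second_countable_topology}"
  assumes g: "continuous_on (sphere 0 1) g"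
  shows "fatou g"
  unfolding fatou_def
proof (rule AE_I2)
  fix \<eta> assume "\<eta> \<in> space \<sigma>"
  then have \<eta>: "norm \<eta> = 1" by simp
  show "((\<lambda>r. \<integral>x. poisson (of_real r * \<eta>) x *\<^sub>R g x \<partial>\<sigma>) \<longlongrightarrow> g \<eta>) (at_left 1)"
  proof (rule tendstoI)
    fix e :: real assume "e > 0"
    then have "e / 2 > 0" by simp
    obtain R where R: "0 \<le> R" "R < 1"
      "\<And>r \<eta>. R \<le> r \<Longrightarrow> r < 1 \<Longrightarrow> norm \<eta> = 1 \<Longrightarrow>
       norm ((\<integral>x. poisson (of_real r * \<eta>) x *\<^sub>R g x \<partial>\<sigma>) - g \<eta>) \<le> e / 2"
      by (rule poisson_tendsto_uniformly[OF g \<open>e / 2 > 0\<close>]) (rule that)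
    from eventually_radius[OF R(1,2)]
    show "\<forall>\<^sub>F r in at_left 1. dist (\<integral>x. poisson (of_real r * \<eta>) x *\<^sub>R g x \<partial>\<sigma>) (g \<eta>) < e"
    proof eventually_elim
      case (elim r)
      then show ?case using R(3)[of r \<eta>] \<eta> \<open>e > 0\<close> by (simp add: dist_norm)
    qed
  qed
qed

lemma poisson_integral_diff:
  fixes f g :: "complex \<Rightarrow> 'b::{banach, second_countable_topology}"
  assumes "integrable \<sigma> f" "integrable \<sigma> g" "norm z < 1"
  shows "(\<integral>x. poisson z x *\<^sub>R (f x - g x) \<partial>\<sigma>) = (\<integral>x. poisson z x *\<^sub>R f x \<partial>\<sigma>) - (\<integral>x. poisson z x *\<^sub>R g x \<partial>\<sigma>)"
  using assms by (simp add: scaleR_diff_right poisson_mult_integrable)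

lemma poisson_integral_add:
  fixes f g :: "complex \<Rightarrow> 'b::{banach, second_countable_topology}"
  assumes "integrable \<sigma> f" "integrable \<sigma> g" "norm z < 1"
  shows "(\<integral>x. poisson z x *\<^sub>R (f x + g x) \<partial>\<sigma>) = (\<integral>x. poisson z x *\<^sub>R f x \<partial>\<sigma>) + (\<integral>x. poisson z x *\<^sub>R g x \<partial>\<sigma>)"
  using assms by (simp add: scaleR_add_right poisson_mult_integrable)

lemma fatou_add:
  assumes f: "integrable \<sigma> f" "fatou f" and g: "integrable \<sigma> g" "fatou g"
  shows "fatou (\<lambda>x. f x + g x)"
  using f(2) g(2) AE_space unfolding fatou_def
proof eventually_elim
  case (elim \<eta>)
  have "((\<lambda>r. (\<integral>x. poisson (of_real r * \<eta>) x *\<^sub>R f x \<partial>\<sigma>) + (\<integral>x. poisson (of_real r * \<eta>) x *\<^sub>R g x \<partial>\<sigma>)) \<longlongrightarrow> f \<eta> + g \<eta>) (at_left 1)"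
    by (intro tendsto_add elim)
  then show ?case
  proof (rule Lim_transform_eventually)
    show "\<forall>\<^sub>F r in at_left 1. (\<integral>x. poisson (of_real r * \<eta>) x *\<^sub>R f x \<partial>\<sigma>) + (\<integral>x. poisson (of_real r * \<eta>) x *\<^sub>R g x \<partial>\<sigma>)
        = (\<integral>x. poisson (of_real r * \<eta>) x *\<^sub>R (f x + g x) \<partial>\<sigma>)"
      using eventually_radius[of 0, simplified] elim(3)
      by (auto elim!: eventually_mono simp: norm_mult intro!: poisson_integral_add[symmetric] f g)
  qed
qed

lemma fatou_scaleR:
  fixes c :: "'b::{banach, second_countable_topology}"
  assumes int: "integrable \<sigma> f" and f: "fatou (f :: complex \<Rightarrow> real)"
  shows "fatou (\<lambda>x. f x *\<^sub>R c)"
  using f AE_space unfolding fatou_def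
proof eventually_elim
  case (elim \<eta>)
  have "((\<lambda>r. (\<integral>x. poisson (of_real r * \<eta>) x *\<^sub>R f x \<partial>\<sigma>) *\<^sub>R c) \<longlongrightarrow> f \<eta> *\<^sub>R c) (at_left 1)"
    by (intro tendsto_intros elim)
  then show ?case
  proof (rule Lim_transform_eventually)
    show "\<forall>\<^sub>F r in at_left 1. (\<integral>x. poisson (of_real r * \<eta>) x *\<^sub>R f x \<partial>\<sigma>) *\<^sub>R c
        = (\<integral>x. poisson (of_real r * \<eta>) x *\<^sub>R f x *\<^sub>R c \<partial>\<sigma>)"
      using eventually_radius[of 0, simplified]
    proof eventually_elim
      case (elim r)
      then have "norm (of_real r * \<eta>) < 1" using \<open>\<eta> \<in> space \<sigma>\<close> by (simp add: norm_mult)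
      from poisson_mult_integrable[OF int this]
      have "(\<integral>x. (poisson (of_real r * \<eta>) x *\<^sub>R f x) *\<^sub>R c \<partial>\<sigma>) = (\<integral>x. poisson (of_real r * \<eta>) x *\<^sub>R f x \<partial>\<sigma>) *\<^sub>R c"
        by (intro integral_scaleR_left)
      then show ?case by simp
    qed
  qed
qed

text \<open>
  The set where the oscillation at the boundary exceeds a fixed multiple of \<open>e\<close> is covered by the
  exceptional set of the maximal inequality for \<open>g - s i\<close> and by a set controlled by Markov's
  inequality; both have measure \<open>O(\<integral>\<bar>g - s i\<bar>)\<close>.
\<close>

lemma fatou_L1_limit:
  fixes g :: "complex \<Rightarrow> 'b::{banach, second_countable_topology}"
  assumes g: "integrable \<sigma> g" and s: "\<And>i::nat. integrable \<sigma> (s i)" "\<And>i. fatou (s i)"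
    and lim: "(\<lambda>i. \<integral>x. norm (g x - s i x) \<partial>\<sigma>) \<longlonglongrightarrow> 0"
  shows "fatou g"
proof -
  let ?P = "\<lambda>f z. \<integral>x. poisson z x *\<^sub>R f x \<partial>\<sigma>"
  \<comment> \<open>66 = 64 + 1 + 1: the maximal bound for g - s i, the value of g - s i at
    \<open>\<eta>\<close> itself, and the convergence already known for s i.\<close>
  have step: "AE \<eta> in \<sigma>. \<forall>\<^sub>F r in at_left 1. norm (?P g (of_real r * \<eta>) - g \<eta>) \<le> 66 * e"
    if e: "e > 0" for e :: real
  proof -
    have gs: "integrable \<sigma> (\<lambda>x. norm (g x - s i x))" for i using g s by auto
    define Q where "Q i A \<longleftrightarrow> A \<in> sets \<sigma> \<and> measure \<sigma> A \<le> 10 / e * (\<integral>x. norm (g x - s i x) \<partial>\<sigma>) \<and>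
      (\<forall>\<eta> h. norm \<eta> = 1 \<longrightarrow> \<eta> \<notin> A \<longrightarrow> 0 < h \<longrightarrow> (\<integral>x. indicator (ball \<eta> h) x * norm (g x - s i x) \<partial>\<sigma>) \<le> e * h)" for i A
    have "\<exists>A. Q i A" for i
    proof -
      obtain A where "A \<in> sets \<sigma>" "measure \<sigma> A \<le> 10 / e * (\<integral>x. norm (g x - s i x) \<partial>\<sigma>)"
        "\<And>\<eta> h. norm \<eta> = 1 \<Longrightarrow> \<eta> \<notin> A \<Longrightarrow> 0 < h \<Longrightarrow> (\<integral>x. indicator (ball \<eta> h) x * norm (g x - s i x) \<partial>\<sigma>) \<le> e * h"
        by (rule maximal_weak_type[OF gs[of i] norm_ge_zero e]) (rule that)
      then show ?thesis by (intro exI[of _ A]) (simp add: Q_def)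
    qed
    then obtain A where "\<And>i. Q i (A i)" using choice[of Q] by blast
    then have A: "\<And>i. A i \<in> sets \<sigma>"
      "\<And>i. measure \<sigma> (A i) \<le> 10 / e * (\<integral>x. norm (g x - s i x) \<partial>\<sigma>)"
      "\<And>i \<eta> h. norm \<eta> = 1 \<Longrightarrow> \<eta> \<notin> A i \<Longrightarrow> 0 < h \<Longrightarrow> (\<integral>x. indicator (ball \<eta> h) x * norm (g x - s i x) \<partial>\<sigma>) \<le> e * h"
      by (simp_all add: Q_def)
    define B where "B i = {x\<in>space \<sigma>. e \<le> norm (g x - s i x)}" for i
    have B_sets: "B i \<in> sets \<sigma>" for i
    proof -
      have [measurable]: "g \<in> borel_measurable \<sigma>" "s i \<in> borel_measurable \<sigma>" using g s by auto
      show ?thesis unfolding B_def by measurable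
    qed
    have mB: "measure \<sigma> (B i) \<le> 1 / e * (\<integral>x. norm (g x - s i x) \<partial>\<sigma>)" for i
      using integral_Markov_inequality_measure[OF gs[of i], of "{}" e] e unfolding B_def by simp
    \<comment> \<open>Outside N some index i is good in both respects. Each i bounds the measure of
      N, with 11 = 10 + 1 from the two estimates, and letting i grow shows that N is null.\<close>
    define N where "N = (\<Inter>i. A i \<union> B i)"
    have N_sets: "N \<in> sets \<sigma>" unfolding N_def using A(1) B_sets by auto
    have mN: "measure \<sigma> N \<le> 11 / e * (\<integral>x. norm (g x - s i x) \<partial>\<sigma>)" for i
    proof -
      have "measure \<sigma> N \<le> measure \<sigma> (A i \<union> B i)"
        by (rule circle.finite_measure_mono) (use A(1) B_sets in \<open>auto simp: N_def\<close>)
      also have "\<dots> \<le> measure \<sigma> (A i) + measure \<sigma> (B i)"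
        by (rule measure_Un_le) (use A(1) B_sets in auto)
      also have "\<dots> \<le> 10 / e * (\<integral>x. norm (g x - s i x) \<partial>\<sigma>) + 1 / e * (\<integral>x. norm (g x - s i x) \<partial>\<sigma>)"
        by (intro add_mono A mB)
      also have "\<dots> = 11 / e * (\<integral>x. norm (g x - s i x) \<partial>\<sigma>)" by (simp add: field_simps)
      finally show ?thesis .
    qed
    have "(\<lambda>i. 11 / e * (\<integral>x. norm (g x - s i x) \<partial>\<sigma>)) \<longlonglongrightarrow> 11 / e * 0"
      by (intro tendsto_mult tendsto_const lim)
    then have "measure \<sigma> N \<le> 11 / e * 0"
      by (rule LIMSEQ_le_const) (intro exI allI impI mN)
    then have "emeasure \<sigma> N = 0" by (simp add: circle.emeasure_eq_measure measure_le_0_iff)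
    then have "N \<in> null_sets \<sigma>" using N_sets by (simp add: null_sets_def)
    then have 1: "AE \<eta> in \<sigma>. \<eta> \<notin> N" by (rule AE_not_in)
    have 2: "AE \<eta> in \<sigma>. \<forall>i. ((\<lambda>r. ?P (s i) (of_real r * \<eta>)) \<longlongrightarrow> s i \<eta>) (at_left 1)"
      using s(2) unfolding fatou_def AE_all_countable by simp
    from 1 2 AE_space show ?thesis
    proof eventually_elim
      case (elim \<eta>)
      then have \<eta>: "norm \<eta> = 1" by simp
      obtain i where i: "\<eta> \<notin> A i" "\<eta> \<notin> B i" using elim(1) by (auto simp: N_def)
      have "\<forall>\<^sub>F r in at_left 1. dist (?P (s i) (of_real r * \<eta>)) (s i \<eta>) < e"
        by (rule tendstoD[OF elim(2)[rule_format] e])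
      with eventually_radius[of 0, simplified] show ?case
      proof eventually_elim
        case (elim r)
        then have r: "0 \<le> r" "r < 1" by auto
        define z where "z = of_real r * \<eta>"
        have z: "norm z < 1" using r \<eta> by (simp add: z_def norm_mult)
        have "norm (?P (\<lambda>x. g x - s i x) z) \<le> (\<integral>x. norm (poisson z x *\<^sub>R (g x - s i x)) \<partial>\<sigma>)"
          by (rule integral_norm_bound)
        also have "\<dots> = (\<integral>x. poisson z x * norm (g x - s i x) \<partial>\<sigma>)"
          using poisson_nonneg[OF z] by simp
        also have "\<dots> \<le> 64 * e"
          unfolding z_def by (rule poisson_le_maximal[OF gs _ \<eta> A(3)[OF \<eta> i(1)] r]) auto
        finally have a: "norm (?P (\<lambda>x. g x - s i x) z) \<le> 64 * e" .
        have b: "norm (g \<eta> - s i \<eta>) < e" using i(2) \<eta> by (simp add: B_def)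
        have c: "norm (?P (s i) z - s i \<eta>) < e" using elim(2) by (simp add: z_def dist_norm)
        have "?P g z - g \<eta> = ?P (\<lambda>x. g x - s i x) z + (?P (s i) z - s i \<eta>) - (g \<eta> - s i \<eta>)"
          by (simp add: poisson_integral_diff[OF g s(1) z])
        also have "norm \<dots> \<le> norm (?P (\<lambda>x. g x - s i x) z) + norm (?P (s i) z - s i \<eta>) + norm (g \<eta> - s i \<eta>)"
          by (rule order_trans[OF norm_triangle_ineq4 add_right_mono[OF norm_triangle_ineq]])
        finally show ?case using a b c by (simp add: z_def)
      qed
    qed
  qed
  have "AE \<eta> in \<sigma>. \<forall>k. \<forall>\<^sub>F r in at_left 1. norm (?P g (of_real r * \<eta>) - g \<eta>) \<le> 66 * (1 / real (Suc k))"
    unfolding AE_all_countable by (intro allI step) simp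
  then show ?thesis unfolding fatou_def
  proof eventually_elim
    case (elim \<eta>)
    show ?case
    proof (rule tendstoI)
      fix e :: real assume "e > 0"
      then have "e / 66 > 0" by simp
      then obtain k where k: "1 / real (Suc k) < e / 66" by (rule nat_approx_posE)
      then have k66: "66 * (1 / real (Suc k)) < e" by simp
      show "\<forall>\<^sub>F r in at_left 1. dist (?P g (of_real r * \<eta>)) (g \<eta>) < e"
        using elim[rule_format, of k]
      proof eventually_elim
        case (elim r)
        then show ?case using k66 unfolding dist_norm by (rule le_less_trans)
      qed
    qed
  qed
qed

lemma fatou_dominated:
  fixes g :: "complex \<Rightarrow> 'b::{banach, second_countable_topology}"
  assumes g: "integrable \<sigma> g" and s: "\<And>i::nat. integrable \<sigma> (s i)" "\<And>i. fatou (s i)"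
    and lim: "\<And>x. norm x = 1 \<Longrightarrow> (\<lambda>i. s i x) \<longlonglongrightarrow> g x"
    and w: "integrable \<sigma> w" "\<And>i x. norm x = 1 \<Longrightarrow> norm (g x - s i x) \<le> w x"
  shows "fatou g"
proof (rule fatou_L1_limit[OF g s])
  have [measurable]: "g \<in> borel_measurable \<sigma>" "s i \<in> borel_measurable \<sigma>" for i using g s by auto
  have t: "(\<lambda>i. norm (g x - s i x)) \<longlonglongrightarrow> norm (g x - g x)" if "norm x = 1" for x
    by (intro tendsto_intros lim that)
  have "(\<lambda>i. \<integral>x. norm (g x - s i x) \<partial>\<sigma>) \<longlonglongrightarrow> (\<integral>x. norm (g x - g x) \<partial>\<sigma>)"
  proof (rule integral_dominated_convergence[where w = w])
    show "AE x in \<sigma>. (\<lambda>i. norm (g x - s i x)) \<longlonglongrightarrow> norm (g x - g x)"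
      by (rule AE_I2) (use t in auto)
  qed (use w in auto)
  then show "(\<lambda>i. \<integral>x. norm (g x - s i x) \<partial>\<sigma>) \<longlonglongrightarrow> 0" by simp
qed

lemma circle_indicator_integrable:
  "A \<in> sets \<sigma> \<Longrightarrow> integrable \<sigma> (indicator A :: complex \<Rightarrow> real)"
  by (simp add: integrable_real_indicator less_top[symmetric])

lemma fatou_indicator_open:
  assumes "open U"
  shows "fatou (indicator (U \<inter> sphere 0 1) :: complex \<Rightarrow> real)"
proof -
  \<comment> \<open>The point 5 lies off the circle and only keeps C nonempty when U is the whole
    plane: \<open>infdist\<close> to the empty set is 0, which would give the wrong limit.\<close>
  define C where "C = insert 5 (- U)"
  have C: "closed C" "C \<noteq> {}" using closed_Un[of "{5}" "- U", OF closed_singleton closed_Compl[OF assms]] by (simp_all add: C_def)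
  let ?s = "\<lambda>i x. min 1 (real i * infdist x C)"
  show ?thesis
  proof (rule fatou_dominated[where s = ?s and w = "\<lambda>_. 1"])
    show "integrable \<sigma> (indicator (U \<inter> sphere 0 1) :: complex \<Rightarrow> real)"
      using assms by (intro circle_indicator_integrable circle_borel_sets) auto
    have c: "continuous_on (sphere 0 1) (?s i)" for i by (intro continuous_intros)
    show "integrable \<sigma> (?s i)" "fatou (?s i)" for i
      by (rule circle_integrable_continuous[OF c] fatou_continuous[OF c])+
    fix x :: complex assume x: "norm x = 1"
    then have "x \<noteq> 5" by auto
    show "(\<lambda>i. ?s i x) \<longlonglongrightarrow> indicator (U \<inter> sphere 0 1) x"
    proof (cases "x \<in> U")
      case True
      then have "x \<notin> C" using \<open>x \<noteq> 5\<close> by (simp add: C_def)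
      then have pos: "infdist x C > 0" using C in_closed_iff_infdist_zero[OF C] infdist_nonneg[of x C] by force
      obtain n where n: "1 / infdist x C < real n" using reals_Archimedean2 by blast
      have "\<forall>\<^sub>F i in sequentially. 1 = ?s i x"
        using eventually_ge_at_top[of n]
      proof eventually_elim
        case (elim i)
        have "1 < real n * infdist x C" using n pos by (simp add: field_simps)
        also have "\<dots> \<le> real i * infdist x C" using elim pos by (intro mult_right_mono) auto
        finally show ?case by simp
      qed
      then have "(\<lambda>i. ?s i x) \<longlonglongrightarrow> 1" by (rule Lim_transform_eventually[OF tendsto_const])
      then show ?thesis using True x by simp
    next
      case False
      then have "infdist x C = 0" by (auto simp: C_def)
      then show ?thesis using False by simp
    qed
    show "norm (indicator (U \<inter> sphere 0 1) x - ?s i x) \<le> 1" for i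
      using infdist_nonneg[of x C] by (auto simp: indicator_def min_def)
  qed auto
qed

lemma fatou_cong:
  assumes "\<And>x. norm x = 1 \<Longrightarrow> f x = g x"
  shows "fatou f \<longleftrightarrow> fatou g"
proof -
  have "(\<integral>x. poisson z x *\<^sub>R f x \<partial>\<sigma>) = (\<integral>x. poisson z x *\<^sub>R g x \<partial>\<sigma>)" for z
    by (rule Bochner_Integration.integral_cong) (use assms in auto)
  then show ?thesis unfolding fatou_def using assms by (intro AE_cong) auto
qed

lemma fatou_sum:
  assumes "finite J" "\<And>j. j \<in> J \<Longrightarrow> integrable \<sigma> (f j)" "\<And>j. j \<in> J \<Longrightarrow> fatou (f j)"
  shows "fatou (\<lambda>x. \<Sum>j\<in>J. f j x)"
  using assms
proof (induction J)
  case empty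
  then show ?case using fatou_continuous[of "\<lambda>_. 0"] by simp
next
  case (insert j J)
  then show ?case by (simp add: fatou_add)
qed

text \<open>Open sets are an intersection-stable generator, so Dynkin induction leaves complements
  and countable disjoint unions, which are handled by linearity and dominated convergence.
  Intersecting with the circle keeps every set inside the space of the measure.\<close>

lemma fatou_indicator:
  assumes "A \<in> sets \<sigma>"
  shows "fatou (indicator A :: complex \<Rightarrow> real)"
proof -
  define S where "S = sphere (0::complex) 1"
  have set_S: "B \<inter> S \<in> sets \<sigma>" if "B \<in> sigma_sets UNIV (Collect open)" for B
    using that unfolding S_def by (intro circle_borel_sets) (simp add: borel_def)
  have int_S: "integrable \<sigma> (indicator (B \<inter> S) :: complex \<Rightarrow> real)" if "B \<in> sigma_sets UNIV (Collect open)" for B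
    by (rule circle_indicator_integrable[OF set_S[OF that]])
  have stable: "Int_stable (Collect (open :: complex set \<Rightarrow> bool))" by (auto simp: Int_stable_def)
  have sub: "Collect (open :: complex set \<Rightarrow> bool) \<subseteq> Pow UNIV" by simp
  have key: "fatou (indicator (B \<inter> S) :: complex \<Rightarrow> real)" if "B \<in> sigma_sets UNIV (Collect open)" for B
    using stable sub that
  proof (induction rule: sigma_sets_induct_disjoint)
    case (basic A)
    then show ?case unfolding S_def by (intro fatou_indicator_open) auto
  next
    case empty
    show ?case using fatou_continuous[of "\<lambda>_. 0::real"] by (simp add: indicator_def[abs_def])
  next
    case (compl A)
    let ?f = "\<lambda>x. indicator (A \<inter> S) x *\<^sub>R (-1::real)"
    have c: "continuous_on (sphere 0 1) (\<lambda>_::complex. 1::real)" by (rule continuous_on_const)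
    have "fatou (\<lambda>x. 1 + ?f x)"
    proof (rule fatou_add[OF circle_integrable_continuous[OF c] fatou_continuous[OF c]])
      show "integrable \<sigma> ?f" using int_S[OF compl(1)] by (intro integrable_scaleR_left)
      show "fatou ?f" by (rule fatou_scaleR[OF int_S[OF compl(1)] compl(2)])
    qed
    moreover have "fatou (\<lambda>x. 1 + ?f x) \<longleftrightarrow> fatou (indicator ((UNIV - A) \<inter> S) :: complex \<Rightarrow> real)"
      by (rule fatou_cong) (auto simp: indicator_def S_def)
    ultimately show ?case by simp
  next
    case (union A)
    have un: "(\<Union>i. A i) \<in> sigma_sets UNIV (Collect open)" by (rule sigma_sets.Union) (use union(2) in auto)
    let ?s = "\<lambda>n x. \<Sum>j<n. indicator (A j \<inter> S) x :: real"
    have s: "?s n x = indicator ((\<Union>j<n. A j) \<inter> S) x" for n x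
    proof -
      have "?s n x = indicator (\<Union>j<n. A j \<inter> S) x"
      proof (rule indicator_UN_disjoint[symmetric])
        show "disjoint_family_on (\<lambda>j. A j \<inter> S) {..<n}"
          using union(1) unfolding disjoint_family_on_def by blast
      qed simp
      moreover have "(\<Union>j<n. A j \<inter> S) = (\<Union>j<n. A j) \<inter> S" by blast
      ultimately show ?thesis by simp
    qed
    show ?case
    proof (rule fatou_dominated[where s = ?s and w = "\<lambda>_. 1"])
      show "integrable \<sigma> (indicator ((\<Union>i. A i) \<inter> S) :: complex \<Rightarrow> real)" by (rule int_S[OF un])
      show "integrable \<sigma> (?s n)" for n by (intro Bochner_Integration.integrable_sum int_S) (use union(2) in auto)
      show "fatou (?s n)" for n by (intro fatou_sum int_S union(3)) (use union(2) in auto)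
      show "norm (indicator ((\<Union>i. A i) \<inter> S) x - ?s n x) \<le> 1" for x n
        unfolding s by (auto simp: indicator_def)
      fix x
      show "(\<lambda>n. ?s n x) \<longlonglongrightarrow> indicator ((\<Union>i. A i) \<inter> S) x"
      proof (cases "\<exists>i. x \<in> A i \<inter> S")
        case True
        then obtain i where i: "x \<in> A i \<inter> S" by blast
        have "\<forall>\<^sub>F n in sequentially. indicator ((\<Union>i. A i) \<inter> S) x = ?s n x"
          using eventually_gt_at_top[of i]
        proof eventually_elim
          case (elim n)
          then have "x \<in> (\<Union>j<n. A j) \<inter> S" "x \<in> (\<Union>i. A i) \<inter> S" using i by auto
          then show ?case unfolding s by (simp only: indicator_simps)
        qed
        then show ?thesis by (rule Lim_transform_eventually[OF tendsto_const])
      next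
        case False
        then have "?s n x = indicator ((\<Union>i. A i) \<inter> S) x" for n unfolding s by (auto simp: indicator_def)
        then show ?thesis by simp
      qed
    qed simp
  qed
  obtain B where "B \<in> sets borel" "A = B \<inter> S"
    using assms by (auto simp: sets_circle sets_restrict_space S_def)
  then show ?thesis using key[of B] by (simp add: borel_def)
qed

theorem fatou_integrable:
  fixes g :: "complex \<Rightarrow> 'b::{banach, second_countable_topology}"
  assumes "integrable \<sigma> g"
  shows "fatou g"
  using assms
proof (induction rule: integrable_induct)
  case (base A c)
  show ?case by (rule fatou_scaleR[OF circle_indicator_integrable fatou_indicator, OF base(1) base(1)])
next
  case (add f g)
  then show ?case by (intro fatou_add)
next
  case (lim f s)
  have b: "norm (s i x) \<le> 2 * norm (f x)" if "x \<in> space \<sigma>" for i x by (rule lim) (rule that)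
  show ?case
  proof (rule fatou_dominated[where s = s and w = "\<lambda>x. 3 * norm (f x)"])
    show "norm (f x - s i x) \<le> 3 * norm (f x)" if "norm x = 1" for i x
      using norm_triangle_ineq4[of "f x" "s i x"] b[of x i] that by simp
  qed (use lim in auto)
qed

lemma poisson_radial_limit:
  fixes g :: "complex \<Rightarrow> 'b::{banach, second_countable_topology}"
  assumes "integrable \<sigma> g"
  shows "AE \<eta> in \<sigma>. ((\<lambda>r. \<integral>x. poisson (of_real r * \<eta>) x *\<^sub>R g x \<partial>\<sigma>) \<longlongrightarrow> g \<eta>) (at_left 1)"
  using fatou_integrable[OF assms] unfolding fatou_def .

section \<open>Herglotz integrals and factorization of \<open>H\<^sup>1\<close>\<close>

definition herglotz :: "(complex \<Rightarrow> real) \<Rightarrow> complex \<Rightarrow> complex" where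
  "herglotz u z = (\<integral>x. (x + z) / (x - z) * of_real (u x) \<partial>\<sigma>)"

lemma herglotz_kernel_le:
  fixes x z :: complex
  assumes "norm x = 1" "norm z < 1"
  shows "norm ((x + z) / (x - z)) \<le> 2 / (1 - norm z)"
proof -
  have "norm (x + z) \<le> 2" using norm_triangle_ineq[of x z] assms by simp
  moreover have "1 - norm z \<le> norm (x - z)" using norm_triangle_ineq2[of x z] assms by simp
  ultimately show ?thesis using assms unfolding norm_divide by (intro frac_le) auto
qed

lemma herglotz_integrable:
  assumes u: "integrable \<sigma> u" and z: "norm z < 1"
  shows "integrable \<sigma> (\<lambda>x. (x + z) / (x - z) * of_real (u x))"
proof (rule Bochner_Integration.integrable_bound[where f = "\<lambda>x. (2 / (1 - norm z)) * u x"])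
  have [measurable]: "u \<in> borel_measurable \<sigma>" using u by simp
  show "(\<lambda>x. (x + z) / (x - z) * of_real (u x)) \<in> borel_measurable \<sigma>" by measurable
  show "AE x in \<sigma>. norm ((x + z) / (x - z) * of_real (u x)) \<le> norm ((2 / (1 - norm z)) * u x)"
  proof (rule AE_I2)
    fix x assume "x \<in> space \<sigma>"
    then have "norm ((x + z) / (x - z)) \<le> 2 / (1 - norm z)" using z by (intro herglotz_kernel_le) auto
    then have "norm ((x + z) / (x - z)) * \<bar>u x\<bar> \<le> 2 / (1 - norm z) * \<bar>u x\<bar>" by (rule mult_right_mono) simp
    moreover have "norm ((x + z) / (x - z) * of_real (u x)) = norm ((x + z) / (x - z)) * \<bar>u x\<bar>"
      by (simp add: norm_mult norm_divide)
    moreover have "norm ((2 / (1 - norm z)) * u x) = 2 / (1 - norm z) * \<bar>u x\<bar>"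
      using z by (simp add: abs_mult)
    ultimately show "norm ((x + z) / (x - z) * of_real (u x)) \<le> norm ((2 / (1 - norm z)) * u x)"
      by (simp only:)
  qed
qed (use u in simp)

lemma Re_herglotz:
  assumes u: "integrable \<sigma> u" and z: "norm z < 1"
  shows "Re (herglotz u z) = (\<integral>x. poisson z x * u x \<partial>\<sigma>)"
proof -
  have "Re (herglotz u z) = (\<integral>x. Re ((x + z) / (x - z) * of_real (u x)) \<partial>\<sigma>)"
    unfolding herglotz_def by (rule integral_Re[symmetric]) (rule herglotz_integrable[OF u z])
  also have "\<dots> = (\<integral>x. poisson z x * u x \<partial>\<sigma>)"
  proof (rule Bochner_Integration.integral_cong[OF refl])
    fix x assume "x \<in> space \<sigma>"
    then have "poisson z x = Re ((x + z) / (x - z))" using poisson_Re(1)[OF z] by simp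
    then show "Re ((x + z) / (x - z) * of_real (u x)) = poisson z x * u x"
      by (simp only: times_complex.sel Im_complex_of_real Re_complex_of_real mult_zero_right diff_zero)
  qed
  finally show ?thesis .
qed

lemma norm_exp_herglotz:
  assumes u: "integrable \<sigma> u" and z: "norm z < 1"
  shows "norm (exp (herglotz u z)) = exp (\<integral>x. poisson z x * u x \<partial>\<sigma>)"
  by (simp add: Re_herglotz[OF u z])

text \<open>Writing (x + w) / (x - w) as 2 x / (x - w) - 1 exhibits a Cauchy integral minus a
  constant, and Cauchy integrals of continuous functions are holomorphic off the contour.\<close>

lemma herglotz_holomorphic:
  assumes u: "continuous_on (sphere 0 1) u"
  shows "herglotz u holomorphic_on ball 0 1"
proof -
  let ?f = "\<lambda>x. complex_of_real (u x)"
  define g where "g w = 2 * pi * \<i> * (\<integral>x. x * (?f x / (x - w)) \<partial>\<sigma>)" for w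
  have cf: "continuous_on (sphere 0 1) ?f" by (intro continuous_intros u)
  have c: "continuous_on (sphere 0 1) (\<lambda>x. ?f x / (x - w))" if "norm w < 1" for w
    using that by (intro continuous_intros u) auto
  have "(g has_field_derivative (1 * contour_integral (circlepath 0 1) (\<lambda>x. ?f x / (x - w) ^ Suc 1))) (at w)"
    if w: "w \<in> ball 0 1" for w
    using Cauchy_next_derivative_circlepath(2)[of 0 1 ?f 1 g w] cf w integral_circle_contour[OF c]
    by (simp add: g_def)
  then have "g holomorphic_on ball 0 1"
    by (metis field_differentiable_at_within field_differentiable_def holomorphic_on_def)
  then have hol: "(\<lambda>w. g w / (pi * \<i>) - (\<integral>x. ?f x \<partial>\<sigma>)) holomorphic_on ball 0 1"
    by (intro holomorphic_intros) auto
  have eq: "g w / (pi * \<i>) - (\<integral>x. ?f x \<partial>\<sigma>) = herglotz u w" if w: "w \<in> ball 0 1" for w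
  proof -
    have w1: "norm w < 1" using w by simp
    have "g w / (pi * \<i>) = 2 * (\<integral>x. x * (?f x / (x - w)) \<partial>\<sigma>)" by (simp add: g_def field_simps)
    also have "\<dots> = (\<integral>x. 2 * (x * (?f x / (x - w))) \<partial>\<sigma>)"
      by (rule integral_mult_right_zero[symmetric])
    also have "\<dots> - (\<integral>x. ?f x \<partial>\<sigma>) = (\<integral>x. 2 * (x * (?f x / (x - w))) - ?f x \<partial>\<sigma>)"
      by (rule Bochner_Integration.integral_diff[symmetric])
         (intro circle_integrable_continuous continuous_intros c[OF w1] cf)+
    also have "\<dots> = herglotz u w"
      unfolding herglotz_def
    proof (rule Bochner_Integration.integral_cong[OF refl])
      fix x assume "x \<in> space \<sigma>"
      then have "x - w \<noteq> 0" using w1 by auto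
      then show "2 * (x * (?f x / (x - w))) - ?f x = (x + w) / (x - w) * ?f x"
        by (simp add: divide_simps) (simp add: algebra_simps)
    qed
    finally show ?thesis .
  qed
  show ?thesis by (rule holomorphic_transform[OF hol eq])
qed

section \<open>Circular means, Jensen's inequality and factors of class H^2\<close>

lemma poisson_radial_symmetric:
  assumes "norm x = 1" "norm y = 1"
  shows "poisson (of_real r * y) x = poisson (of_real r * x) y"
proof -
  have "(norm (x - of_real r * y))\<^sup>2 = (norm x)\<^sup>2 + r\<^sup>2 * (norm y)\<^sup>2 - 2 * r * (Re x * Re y + Im x * Im y)"
    unfolding cmod_power2 by (simp add: power2_eq_square algebra_simps)
  moreover have "(norm (y - of_real r * x))\<^sup>2 = (norm y)\<^sup>2 + r\<^sup>2 * (norm x)\<^sup>2 - 2 * r * (Re x * Re y + Im x * Im y)"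
    unfolding cmod_power2 by (simp add: power2_eq_square algebra_simps)
  ultimately show ?thesis using assms by (simp add: poisson_def norm_mult)
qed

text \<open>Fubini: by the symmetry of the kernel it integrates to 1 in y as well as in x.\<close>

lemma poisson_integral_mean:
  assumes v: "continuous_on (sphere 0 1) v" and r: "0 \<le> r" "r < 1"
  shows "(\<integral>y. (\<integral>x. poisson (of_real r * y) x * v x \<partial>\<sigma>) \<partial>\<sigma>) = (\<integral>x. v x \<partial>\<sigma>)"
    and "integrable \<sigma> (\<lambda>y. \<integral>x. poisson (of_real r * y) x * v x \<partial>\<sigma>)"
proof -
  interpret pair_sigma_finite \<sigma> \<sigma> by unfold_locales
  interpret pp: finite_measure "\<sigma> \<Otimes>\<^sub>M \<sigma>"
    by (rule finite_measure_pair_measure) unfold_locales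
  have [measurable]: "v \<in> borel_measurable \<sigma>" by (rule circle_measurable_continuous[OF v])
  have "bounded (v ` sphere 0 1)"
    by (intro compact_imp_bounded compact_continuous_image v) auto
  then obtain B where "\<forall>x\<in>sphere 0 1. \<bar>v x\<bar> \<le> B" unfolding bounded_iff by auto
  then have B: "\<bar>v x\<bar> \<le> B" if "norm x = 1" for x using that by simp
  have nz: "norm (of_real r * y) = r" if "norm y = 1" for y :: complex using r that by (simp add: norm_mult)
  have int: "integrable (\<sigma> \<Otimes>\<^sub>M \<sigma>) (\<lambda>(x, y). poisson (of_real r * y) x * v x)"
  proof (rule pp.integrable_const_bound[where B = "2 / (1 - r) * B"])
    show "AE p in \<sigma> \<Otimes>\<^sub>M \<sigma>. norm (case p of (x, y) \<Rightarrow> poisson (of_real r * y) x * v x) \<le> 2 / (1 - r) * B"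
    proof (rule AE_I2)
      fix p assume "p \<in> space (\<sigma> \<Otimes>\<^sub>M \<sigma>)"
      then obtain x y where p: "p = (x, y)" "norm x = 1" "norm y = 1" by (auto simp: space_pair_measure)
      have n1: "norm (of_real r * y) < 1" using nz[OF p(3)] r by simp
      have "\<bar>poisson (of_real r * y) x\<bar> * \<bar>v x\<bar> \<le> 2 / (1 - r) * B"
        using poisson_le[OF n1 p(2)] poisson_nonneg[OF n1, of x] nz[OF p(3)] B[OF p(2)] r
        by (intro mult_mono) auto
      then show "norm (case p of (x, y) \<Rightarrow> poisson (of_real r * y) x * v x) \<le> 2 / (1 - r) * B"
        by (simp add: p abs_mult)
    qed
    show "(\<lambda>(x, y). poisson (of_real r * y) x * v x) \<in> borel_measurable (\<sigma> \<Otimes>\<^sub>M \<sigma>)"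
      unfolding poisson_def by measurable
  qed
  show "integrable \<sigma> (\<lambda>y. \<integral>x. poisson (of_real r * y) x * v x \<partial>\<sigma>)"
    by (rule integrable_snd[OF int])
  have "(\<integral>y. (\<integral>x. poisson (of_real r * y) x * v x \<partial>\<sigma>) \<partial>\<sigma>) = (\<integral>x. (\<integral>y. poisson (of_real r * y) x * v x \<partial>\<sigma>) \<partial>\<sigma>)"
    by (rule Fubini_integral[OF int])
  also have "\<dots> = (\<integral>x. v x \<partial>\<sigma>)"
  proof (rule Bochner_Integration.integral_cong[OF refl])
    fix x assume "x \<in> space \<sigma>"
    then have x: "norm x = 1" by simp
    have "(\<integral>y. poisson (of_real r * y) x * v x \<partial>\<sigma>) = (\<integral>y. poisson (of_real r * x) y * v x \<partial>\<sigma>)"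
      by (rule Bochner_Integration.integral_cong[OF refl]) (use poisson_radial_symmetric[OF x] in simp)
    also have "\<dots> = v x" using poisson_integral_one[of "of_real r * x"] nz[OF x] r by simp
    finally show "(\<integral>y. poisson (of_real r * y) x * v x \<partial>\<sigma>) = v x" .
  qed
  finally show "(\<integral>y. (\<integral>x. poisson (of_real r * y) x * v x \<partial>\<sigma>) \<partial>\<sigma>) = (\<integral>x. v x \<partial>\<sigma>)" .
qed

text \<open>Jensen's inequality for the probability density \<open>poisson z\<close>: integrate the
  tangent bound \<open>exp m * (1 + (t - m)) \<le> exp t\<close> at t = ln (v x), where m is the
  mean of ln v.\<close>

lemma exp_poisson_le:
  assumes v: "continuous_on (sphere 0 1) v" "\<And>x. norm x = 1 \<Longrightarrow> v x > 0" and z: "norm z < 1"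
  shows "exp (\<integral>x. poisson z x * ln (v x) \<partial>\<sigma>) \<le> (\<integral>x. poisson z x * v x \<partial>\<sigma>)"
proof -
  define m where "m = (\<integral>x. poisson z x * ln (v x) \<partial>\<sigma>)"
  have cln: "continuous_on (sphere 0 1) (\<lambda>x. ln (v x))" by (intro continuous_intros v) (use v(2) in force)
  have i1: "integrable \<sigma> (\<lambda>x. poisson z x * ln (v x))" "integrable \<sigma> (\<lambda>x. poisson z x)"
    "integrable \<sigma> (\<lambda>x. poisson z x * v x)"
    by (intro circle_integrable_continuous continuous_intros poisson_continuous z v cln)+
  have "exp m = exp m * (1 - m) * (\<integral>x. poisson z x \<partial>\<sigma>) + exp m * m"
    using poisson_integral_one[OF z] by (simp add: algebra_simps)
  also have "\<dots> = (\<integral>x. exp m * (1 - m) * poisson z x + exp m * (poisson z x * ln (v x)) \<partial>\<sigma>)"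
    using i1 by (simp add: m_def)
  also have "\<dots> \<le> (\<integral>x. poisson z x * v x \<partial>\<sigma>)"
  proof (rule integral_mono)
    fix x assume "x \<in> space \<sigma>"
    then have pos: "v x > 0" using v(2) by simp
    have "1 + (ln (v x) - m) \<le> exp (ln (v x) - m)" by (rule exp_ge_add_one_self)
    then have "exp m * (1 + (ln (v x) - m)) \<le> exp m * exp (ln (v x) - m)" by (intro mult_left_mono) auto
    also have "\<dots> = v x" using pos by (simp flip: exp_add)
    finally have "poisson z x * (exp m * (1 + (ln (v x) - m))) \<le> poisson z x * v x"
      by (rule mult_left_mono) (rule poisson_nonneg[OF z])
    then show "exp m * (1 - m) * poisson z x + exp m * (poisson z x * ln (v x)) \<le> poisson z x * v x"
      by (simp add: algebra_simps)
  qed (use i1 in auto)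
  finally show ?thesis by (simp add: m_def)
qed

text \<open>
  The outer function with boundary modulus \<open>\<bar>f\<bar> + 1\<close> dominates \<open>f\<close>; its square root \<open>b\<close> and
  the quotient \<open>f / b\<close> split \<open>f\<close> into two factors of class \<open>H\<^sup>2\<close>, without any Blaschke product.
\<close>

lemma outer_majorant:
  assumes f: "continuous_on (cball 0 1) f" "f holomorphic_on ball 0 1"
    and z: "norm z < 1"
  shows "norm (f z) \<le> norm (exp (herglotz (\<lambda>x. ln (norm (f x) + 1)) z))"
proof -
  define u where "u x = ln (norm (f x) + 1)" for x
  have cf: "continuous_on (sphere 0 1) f" by (rule continuous_on_subset[OF f(1)]) auto
  have pos: "norm (f x) + 1 > 0" for x by (rule add_nonneg_pos) auto
  have cu: "continuous_on (sphere 0 1) u"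
    unfolding u_def using pos by (intro continuous_intros cf ballI) (simp add: less_imp_neq[symmetric])
  have iu: "integrable \<sigma> u" by (rule circle_integrable_continuous[OF cu])
  define w where "w z = f z * exp (- herglotz u z)" for z
  have hw: "w holomorphic_on ball 0 1"
    unfolding w_def by (intro holomorphic_intros f herglotz_holomorphic cu)
  \<comment> \<open>On a circle of radius r close to 1, both f and the Poisson integral of u are
    within e of their boundary values. The summand 1 in the modulus absorbs the error in f, since e
    \<le> 1, so |w| \<le> exp e there, and the maximum principle carries this inwards.\<close>
  have bound: "norm (w z) \<le> exp e" if e: "0 < e" "e \<le> 1" for e
  proof -
    obtain R1 where R1: "0 \<le> R1" "R1 < 1" "\<And>r \<eta>. R1 \<le> r \<Longrightarrow> r < 1 \<Longrightarrow> norm \<eta> = 1 \<Longrightarrow>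
       norm ((\<integral>x. poisson (of_real r * \<eta>) x *\<^sub>R u x \<partial>\<sigma>) - u \<eta>) \<le> e"
      by (rule poisson_tendsto_uniformly[OF cu e(1)]) (rule that)
    obtain R2 where R2: "0 \<le> R2" "R2 < 1" "\<And>r \<eta>. R2 \<le> r \<Longrightarrow> r < 1 \<Longrightarrow> norm \<eta> = 1 \<Longrightarrow>
       norm ((\<integral>x. poisson (of_real r * \<eta>) x *\<^sub>R f x \<partial>\<sigma>) - f \<eta>) \<le> e"
      by (rule poisson_tendsto_uniformly[OF cf e(1)]) (rule that)
    define r where "r = max (max R1 R2) ((norm z + 1) / 2)"
    have r: "R1 \<le> r" "R2 \<le> r" "0 \<le> r" "r < 1" "norm z < r" "0 < r"
    proof -
      have "0 < (norm z + 1) / 2" by (simp add: add_nonneg_pos)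
      then show "R1 \<le> r" "R2 \<le> r" "0 \<le> r" "r < 1" "norm z < r" "0 < r"
        using R1(1,2) R2(1,2) z unfolding r_def by (simp_all add: less_max_iff_disj le_max_iff_disj)
    qed
    have circ: "norm (w y) \<le> exp e" if "y \<in> frontier (ball 0 r)" for y
    proof -
      have y: "norm y = r" using that r by simp
      define \<eta> where "\<eta> = y / of_real r"
      have \<eta>: "norm \<eta> = 1" "of_real r * \<eta> = y" using y r by (auto simp: \<eta>_def norm_divide)
      have y1: "norm y < 1" using y r by simp
      have "norm (f y - f \<eta>) \<le> e"
        using R2(3)[OF r(2,4) \<eta>(1)] poisson_integral_holomorphic[OF f y1] by (simp add: \<eta> scaleR_conv_of_real)
      then have "norm (f y) \<le> norm (f \<eta>) + e" using norm_triangle_ineq2[of "f y" "f \<eta>"] by linarith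
      then have fy: "norm (f y) \<le> norm (f \<eta>) + 1" using e by linarith
      have "\<bar>(\<integral>x. poisson y x * u x \<partial>\<sigma>) - u \<eta>\<bar> \<le> e" using R1(3)[OF r(1,4) \<eta>(1)] by (simp add: \<eta>)
      then have "- (\<integral>x. poisson y x * u x \<partial>\<sigma>) \<le> e - u \<eta>" by linarith
      then have "exp (- Re (herglotz u y)) \<le> exp (e - u \<eta>)" using Re_herglotz[OF iu y1] by simp
      also have "\<dots> = exp e / (norm (f \<eta>) + 1)" using pos by (simp add: exp_diff u_def)
      finally have "norm (w y) \<le> (norm (f \<eta>) + 1) * (exp e / (norm (f \<eta>) + 1))"
        unfolding w_def norm_mult using fy pos by (intro mult_mono) auto
      then show ?thesis using pos[of \<eta>] by simp
    qed
    have sub: "cball 0 r \<subseteq> ball (0::complex) 1" using r by (auto simp: subset_iff)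
    show ?thesis
    proof (rule maximum_modulus_frontier[of w "ball 0 r"])
      show "w holomorphic_on interior (ball 0 r)"
        by (rule holomorphic_on_subset[OF hw]) (use r in auto)
      show "continuous_on (closure (ball 0 r)) w"
        by (rule continuous_on_subset[OF holomorphic_on_imp_continuous_on[OF hw]]) (use r sub in auto)
    qed (use circ r in auto)
  qed
  have "((\<lambda>e::real. exp e) \<longlongrightarrow> exp 0) (at_right 0)" by (intro tendsto_intros)
  moreover have "\<forall>\<^sub>F e in at_right 0. norm (w z) \<le> exp e"
    using eventually_at_right_real[of 0 "1::real"] by (auto elim!: eventually_mono intro!: bound)
  ultimately have "norm (w z) \<le> exp 0" by (intro tendsto_lowerbound) auto
  then have "norm (f z) * exp (- Re (herglotz u z)) \<le> 1" by (simp add: w_def norm_mult)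
  then have "norm (f z) \<le> exp (Re (herglotz u z))" by (simp add: exp_minus field_simps)
  then show ?thesis by (simp add: u_def[abs_def])
qed

text \<open>The bound K is a parameter rather than existentially quantified because it must be
  common to a whole sequence and survive its limit.\<close>

definition H2_bounded :: "real \<Rightarrow> (complex \<Rightarrow> complex) \<Rightarrow> bool" where
  "H2_bounded K a \<longleftrightarrow> a holomorphic_on ball 0 1 \<and>
     (\<forall>r. 0 \<le> r \<longrightarrow> r < 1 \<longrightarrow> (\<integral>x. (norm (a (of_real r * x)))\<^sup>2 \<partial>\<sigma>) \<le> K)"

lemma radial_continuous:
  fixes a :: "complex \<Rightarrow> 'b::topological_space"
  assumes a: "continuous_on (ball 0 1) a" and r: "0 \<le> r" "r < 1"
  shows "continuous_on (cball 0 1) (\<lambda>x. a (of_real r * x))" "continuous_on (sphere 0 1) (\<lambda>x. a (of_real r * x))"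
proof -
  have n: "norm (of_real r * x) < 1" if "norm x \<le> 1" for x :: complex
  proof -
    have "norm (of_real r * x) \<le> r * 1" unfolding norm_mult using r that by (intro mult_mono) auto
    then show ?thesis using r by simp
  qed
  show "continuous_on (cball 0 1) (\<lambda>x. a (of_real r * x))"
    by (rule continuous_on_compose2[OF a]) (use n in \<open>auto intro!: continuous_intros\<close>)
  then show "continuous_on (sphere 0 1) (\<lambda>x. a (of_real r * x))" by (rule continuous_on_subset) auto
qed

lemma dilation_holomorphic:
  assumes a: "a holomorphic_on ball 0 1" and r: "0 \<le> r" "r < 1"
  shows "(\<lambda>x. a (of_real r * x)) holomorphic_on ball 0 1"
proof -
  have n: "norm (of_real r * x) < 1" if "norm x < 1" for x :: complex
  proof -
    have "norm (of_real r * x) \<le> 1 * norm x" unfolding norm_mult using r that by (intro mult_mono) auto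
    then show ?thesis using that by simp
  qed
  have "(\<lambda>x. of_real r * x) ` ball 0 1 \<subseteq> ball (0::complex) 1" using n by (auto simp: image_subset_iff)
  moreover have "(\<lambda>x. of_real r * x) holomorphic_on ball 0 1" by (intro holomorphic_intros)
  ultimately show ?thesis
    using holomorphic_on_compose_gen[OF _ a] by (fastforce simp: o_def)
qed

text \<open>b^2 is the outer majorant of f. By Jensen |b|^2 is at most the Poisson integral of |f| +
  1, whose circular means are the integral of |f| plus 1; and |f| \<le> |b|^2 gives |a| \<le> |b|.
  The last pointwise bound is what later makes the factors a normal family.\<close>

lemma H2_factor_smooth:
  assumes f: "continuous_on (cball 0 1) f" "f holomorphic_on ball 0 1"
  obtains a b where "H2_bounded ((\<integral>x. norm (f x) \<partial>\<sigma>) + 1) a" "H2_bounded ((\<integral>x. norm (f x) \<partial>\<sigma>) + 1) b"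
    "\<And>z. norm z < 1 \<Longrightarrow> f z = a z * b z"
    "\<And>z. norm z < 1 \<Longrightarrow> norm (a z) \<le> norm (b z)"
    "\<And>z. norm z < 1 \<Longrightarrow> (norm (b z))\<^sup>2 \<le> 2 / (1 - norm z) * ((\<integral>x. norm (f x) \<partial>\<sigma>) + 1)"
proof -
  define v where "v x = norm (f x) + 1" for x
  have pos: "v x > 0" for x unfolding v_def by (rule add_nonneg_pos) auto
  have cf: "continuous_on (sphere 0 1) f" by (rule continuous_on_subset[OF f(1)]) auto
  have cv: "continuous_on (sphere 0 1) v" unfolding v_def by (intro continuous_intros cf)
  have cu: "continuous_on (sphere 0 1) (\<lambda>x. ln (v x))"
    using pos by (intro continuous_intros cv ballI) (simp add: less_imp_neq[symmetric])
  have iu: "integrable \<sigma> (\<lambda>x. ln (v x))" by (rule circle_integrable_continuous[OF cu])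
  have iv: "integrable \<sigma> v" by (rule circle_integrable_continuous[OF cv])
  have Iv: "(\<integral>x. v x \<partial>\<sigma>) = (\<integral>x. norm (f x) \<partial>\<sigma>) + 1"
    unfolding v_def using circle_integrable_continuous[OF cf] by simp
  define h where "h z = herglotz (\<lambda>x. ln (v x)) z" for z
  have hh: "h holomorphic_on ball 0 1" unfolding h_def[abs_def] by (rule herglotz_holomorphic[OF cu])
  define b where "b z = exp (h z / 2)" for z
  define a where "a z = f z / b z" for z
  have b0: "b z \<noteq> 0" for z by (simp add: b_def)
  have hb: "b holomorphic_on ball 0 1" unfolding b_def by (intro holomorphic_intros hh) auto
  have ha: "a holomorphic_on ball 0 1" unfolding a_def by (intro holomorphic_intros hb f b0)
  have b2: "(norm (b z))\<^sup>2 = exp (\<integral>x. poisson z x * ln (v x) \<partial>\<sigma>)" if z: "norm z < 1" for z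
  proof -
    have "(b z)\<^sup>2 = exp (h z)" by (simp add: b_def power2_eq_square flip: exp_add)
    then have "(norm (b z))\<^sup>2 = norm (exp (h z))" by (metis norm_power)
    then show ?thesis using norm_exp_herglotz[OF iu z] by (simp add: h_def)
  qed
  have ab: "norm (a z) \<le> norm (b z)" if z: "norm z < 1" for z
  proof -
    have "(b z)\<^sup>2 = exp (h z)" by (simp add: b_def power2_eq_square flip: exp_add)
    then have "norm (f z) \<le> norm ((b z)\<^sup>2)"
      using outer_majorant[OF f z] unfolding h_def v_def by simp
    then have "norm (f z) \<le> norm (b z) * norm (b z)" by (simp add: power2_eq_square norm_mult)
    then show ?thesis using b0[of z] unfolding a_def norm_divide by (simp add: divide_le_eq)
  qed
  have le: "(norm (b z))\<^sup>2 \<le> (\<integral>x. poisson z x * v x \<partial>\<sigma>)" if z: "norm z < 1" for z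
    unfolding b2[OF z] by (rule exp_poisson_le[OF cv pos z])
  have mean: "(\<integral>x. (norm (b (of_real r * x)))\<^sup>2 \<partial>\<sigma>) \<le> (\<integral>x. norm (f x) \<partial>\<sigma>) + 1" if r: "0 \<le> r" "r < 1" for r
  proof -
    have "(\<integral>x. (norm (b (of_real r * x)))\<^sup>2 \<partial>\<sigma>) \<le> (\<integral>y. (\<integral>x. poisson (of_real r * y) x * v x \<partial>\<sigma>) \<partial>\<sigma>)"
    proof (rule integral_mono[OF _ poisson_integral_mean(2)[OF cv r]])
      show "integrable \<sigma> (\<lambda>x. (norm (b (of_real r * x)))\<^sup>2)"
        by (intro circle_integrable_continuous continuous_intros
            radial_continuous(2)[OF holomorphic_on_imp_continuous_on[OF hb] r])
    qed (use r le in \<open>simp add: norm_mult\<close>)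
    then show ?thesis unfolding poisson_integral_mean(1)[OF cv r] Iv .
  qed
  have meana: "(\<integral>x. (norm (a (of_real r * x)))\<^sup>2 \<partial>\<sigma>) \<le> (\<integral>x. norm (f x) \<partial>\<sigma>) + 1" if r: "0 \<le> r" "r < 1" for r
  proof (rule order_trans[OF integral_mono mean[OF r]])
    show "integrable \<sigma> (\<lambda>x. (norm (a (of_real r * x)))\<^sup>2)" "integrable \<sigma> (\<lambda>x. (norm (b (of_real r * x)))\<^sup>2)"
      by (intro circle_integrable_continuous continuous_intros
            radial_continuous(2)[OF holomorphic_on_imp_continuous_on[OF ha] r]
            radial_continuous(2)[OF holomorphic_on_imp_continuous_on[OF hb] r])+
  qed (use r in \<open>auto simp: norm_mult intro!: power_mono ab\<close>)
  show thesis
  proof (rule that[of a b])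
    show "H2_bounded ((\<integral>x. norm (f x) \<partial>\<sigma>) + 1) a" "H2_bounded ((\<integral>x. norm (f x) \<partial>\<sigma>) + 1) b"
      unfolding H2_bounded_def using ha hb mean meana by simp_all
    show "f z = a z * b z" for z using b0 by (simp add: a_def)
    show "norm (a z) \<le> norm (b z)" if "norm z < 1" for z by (rule ab[OF that])
    show "(norm (b z))\<^sup>2 \<le> 2 / (1 - norm z) * ((\<integral>x. norm (f x) \<partial>\<sigma>) + 1)" if z: "norm z < 1" for z
    proof -
      have "(\<integral>x. poisson z x * v x \<partial>\<sigma>) \<le> (\<integral>x. 2 / (1 - norm z) * v x \<partial>\<sigma>)"
      proof (rule integral_mono)
        show "integrable \<sigma> (\<lambda>x. poisson z x * v x)" using poisson_mult_integrable[OF iv z] by simp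
        show "poisson z x * v x \<le> 2 / (1 - norm z) * v x" if "x \<in> space \<sigma>" for x
          using that poisson_le[OF z, of x] pos[of x] by (intro mult_right_mono) auto
      qed (intro integrable_mult_right iv)
      then show ?thesis using le[OF z] by (simp add: Iv)
    qed
  qed
qed

lemma H2_bounded_limit:
  assumes a: "\<And>n::nat. H2_bounded K (a n)" and hol: "g holomorphic_on ball 0 1"
    and lim: "\<And>C. compact C \<Longrightarrow> C \<subseteq> ball 0 1 \<Longrightarrow> uniform_limit C a g sequentially"
  shows "H2_bounded K g"
  unfolding H2_bounded_def
proof (intro conjI hol allI impI)
  fix r :: real assume r: "0 \<le> r" "r < 1"
  have sub: "cball 0 r \<subseteq> ball (0::complex) 1" using r by (auto simp: subset_iff)
  have u: "uniform_limit (cball 0 r) a g sequentially" by (rule lim[OF compact_cball sub])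
  have cg: "continuous_on (sphere 0 1) (\<lambda>x. g (of_real r * x))"
    by (rule radial_continuous(2)[OF holomorphic_on_imp_continuous_on[OF hol] r])
  have ca: "continuous_on (sphere 0 1) (\<lambda>x. a n (of_real r * x))" for n
    using a[of n] unfolding H2_bounded_def
    by (intro radial_continuous(2)[OF holomorphic_on_imp_continuous_on r]) auto
  have "bounded ((\<lambda>x. g (of_real r * x)) ` sphere 0 1)"
    by (intro compact_imp_bounded compact_continuous_image cg) auto
  then obtain B where B: "\<forall>x\<in>sphere 0 1. norm (g (of_real r * x)) \<le> B" unfolding bounded_iff by auto
  obtain N where "\<forall>n\<ge>N. \<forall>x\<in>cball 0 r. norm (a n x - g x) < 1"
    using uniform_limitD[OF u, of 1] unfolding eventually_sequentially dist_norm by auto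
  then have N: "norm (a n x - g x) < 1" if "N \<le> n" "norm x \<le> r" for n x using that by simp
  have "(\<lambda>n. \<integral>x. (norm (a (n + N) (of_real r * x)))\<^sup>2 \<partial>\<sigma>) \<longlonglongrightarrow> (\<integral>x. (norm (g (of_real r * x)))\<^sup>2 \<partial>\<sigma>)"
  proof (rule integral_dominated_convergence[where w = "\<lambda>_. (B + 1)\<^sup>2"])
    show "(\<lambda>x. (norm (g (of_real r * x)))\<^sup>2) \<in> borel_measurable \<sigma>"
      by (intro circle_measurable_continuous continuous_intros cg)
    show "(\<lambda>x. (norm (a (n + N) (of_real r * x)))\<^sup>2) \<in> borel_measurable \<sigma>" for n
      by (intro circle_measurable_continuous continuous_intros ca)
    show "AE x in \<sigma>. (\<lambda>n. (norm (a (n + N) (of_real r * x)))\<^sup>2) \<longlonglongrightarrow> (norm (g (of_real r * x)))\<^sup>2"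
    proof (rule AE_I2)
      fix x assume "x \<in> space \<sigma>"
      then have "of_real r * x \<in> cball 0 r" using r by (simp add: norm_mult)
      then have "(\<lambda>n. a n (of_real r * x)) \<longlonglongrightarrow> g (of_real r * x)" by (rule tendsto_uniform_limitI[OF u])
      then have "(\<lambda>n. a (n + N) (of_real r * x)) \<longlonglongrightarrow> g (of_real r * x)" by (rule LIMSEQ_ignore_initial_segment)
      then show "(\<lambda>n. (norm (a (n + N) (of_real r * x)))\<^sup>2) \<longlonglongrightarrow> (norm (g (of_real r * x)))\<^sup>2"
        by (intro tendsto_intros)
    qed
    show "AE x in \<sigma>. norm ((norm (a (n + N) (of_real r * x)))\<^sup>2) \<le> (B + 1)\<^sup>2" for n
    proof (rule AE_I2)
      fix x assume "x \<in> space \<sigma>"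
      then have x: "norm x = 1" by simp
      have "norm (a (n + N) (of_real r * x) - g (of_real r * x)) < 1" using x r by (intro N) (auto simp: norm_mult)
      moreover have "norm (g (of_real r * x)) \<le> B" using B x by simp
      ultimately have "norm (a (n + N) (of_real r * x)) \<le> B + 1"
        using norm_triangle_ineq2[of "a (n + N) (of_real r * x)" "g (of_real r * x)"] by linarith
      then show "norm ((norm (a (n + N) (of_real r * x)))\<^sup>2) \<le> (B + 1)\<^sup>2" by (simp add: power_mono)
    qed
  qed simp
  then show "(\<integral>x. (norm (g (of_real r * x)))\<^sup>2 \<partial>\<sigma>) \<le> K"
    by (rule LIMSEQ_le_const2) (use a r in \<open>auto simp: H2_bounded_def\<close>)
qed

text \<open>The pointwise bound is uniform in n and degenerates only at the circle, hence Montel's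
  theorem applies; the square means pass to the limit because convergence is uniform on smaller
  discs.\<close>

lemma H2_normal_family:
  assumes a: "\<And>n::nat. H2_bounded K (a n)"
    and bd: "\<And>n z. norm z < 1 \<Longrightarrow> (norm (a n z))\<^sup>2 \<le> L / (1 - norm z)" and L: "0 \<le> L"
  obtains g s where "H2_bounded K g" "strict_mono (s :: nat \<Rightarrow> nat)"
    "\<And>z. norm z < 1 \<Longrightarrow> (\<lambda>n. a (s n) z) \<longlonglongrightarrow> g z"
proof -
  have locally_bd: "\<exists>B. \<forall>h\<in>range a. \<forall>z\<in>C. norm (h z) \<le> B" if C: "compact C" "C \<subseteq> ball 0 1" for C
  proof (cases "C = {}")
    case False
    have "continuous_on C (\<lambda>z. sqrt (L / (1 - norm z)))"
      using C by (intro continuous_intros) auto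
    then have "bounded ((\<lambda>z. sqrt (L / (1 - norm z))) ` C)"
      by (intro compact_imp_bounded compact_continuous_image C)
    then obtain B where B: "\<forall>z\<in>C. \<bar>sqrt (L / (1 - norm z))\<bar> \<le> B" unfolding bounded_iff by auto
    have "norm (a n z) \<le> B" if z: "z \<in> C" for n z
    proof -
      have "norm z < 1" using z C by auto
      from real_le_rsqrt[OF bd[OF this]] have "norm (a n z) \<le> sqrt (L / (1 - norm z))" .
      also have "\<dots> \<le> B" using B z by fastforce
      finally show ?thesis .
    qed
    then show ?thesis by blast
  qed simp
  have hol: "h holomorphic_on ball 0 1" if "h \<in> range a" for h
    using that a unfolding H2_bounded_def by auto
  obtain g s where g: "g holomorphic_on ball 0 1" "strict_mono (s :: nat \<Rightarrow> nat)"
    "\<And>z. z \<in> ball 0 1 \<Longrightarrow> (\<lambda>n. a (s n) z) \<longlonglongrightarrow> g z"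
    "\<And>C. compact C \<Longrightarrow> C \<subseteq> ball 0 1 \<Longrightarrow> uniform_limit C (a \<circ> s) g sequentially"
    by (rule Montel[OF open_ball hol locally_bd order_refl]) (assumption | rule that)+
  have "H2_bounded K g"
    by (rule H2_bounded_limit[of K "a \<circ> s", OF _ g(1) g(4)]) (use a in auto)
  then show thesis using g by (intro that[of g s]) auto
qed

text \<open>A function of H^1 need not extend continuously to the circle. Its dilations do, and they
  are factored with the bound C + 1 independent of the dilation, so the factors can be passed to a
  limit.\<close>

theorem hardy1_factor:
  assumes f: "f \<in> hardy1"
  obtains K a b where "H2_bounded K a" "H2_bounded K b" "\<And>z. norm z < 1 \<Longrightarrow> f z = a z * b z"
proof -
  obtain C where hol: "f holomorphic_on ball 0 1"
    and C': "\<forall>r. 0 \<le> r \<and> r < 1 \<longrightarrow> (\<integral>x. norm (f (of_real r * x)) \<partial>\<sigma>) \<le> C"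
    using f unfolding hardy1_def by blast
  have C: "(\<integral>x. norm (f (of_real r * x)) \<partial>\<sigma>) \<le> C" if "0 \<le> r" "r < 1" for r
    using C' that by blast
  have cont: "continuous_on (ball 0 1) f" by (rule holomorphic_on_imp_continuous_on[OF hol])
  define r where "r n = 1 - 1 / real (n + 2)" for n
  have r: "0 \<le> r n" "r n < 1" for n by (auto simp: r_def field_simps)
  define I where "I n = (\<integral>x. norm (f (of_real (r n) * x)) \<partial>\<sigma>)" for n
  have I: "0 \<le> I n" "I n \<le> C" for n
    unfolding I_def by (intro Bochner_Integration.integral_nonneg norm_ge_zero) (rule C[OF r])
  define Q where "Q n p \<longleftrightarrow> H2_bounded (C + 1) (fst p) \<and> H2_bounded (C + 1) (snd p) \<and>
    (\<forall>z. norm z < 1 \<longrightarrow> f (of_real (r n) * z) = fst p z * snd p z \<and> norm (fst p z) \<le> norm (snd p z) \<and>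
      (norm (snd p z))\<^sup>2 \<le> (2 * (C + 1)) / (1 - norm z))" for n p
  have "\<exists>p. Q n p" for n
  proof -
    obtain a b where ab: "H2_bounded (I n + 1) a" "H2_bounded (I n + 1) b"
      "\<And>z. norm z < 1 \<Longrightarrow> f (of_real (r n) * z) = a z * b z"
      "\<And>z. norm z < 1 \<Longrightarrow> norm (a z) \<le> norm (b z)"
      "\<And>z. norm z < 1 \<Longrightarrow> (norm (b z))\<^sup>2 \<le> 2 / (1 - norm z) * (I n + 1)"
      by (rule H2_factor_smooth[OF radial_continuous(1)[OF cont r] dilation_holomorphic[OF hol r], folded I_def]) (rule that)
    have mono: "H2_bounded (C + 1) c" if c: "H2_bounded (I n + 1) c" for c
      unfolding H2_bounded_def
    proof (intro conjI allI impI)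
      show "c holomorphic_on ball 0 1" using c by (simp add: H2_bounded_def)
      fix r :: real assume r: "0 \<le> r" "r < 1"
      have "(\<integral>x. (norm (c (of_real r * x)))\<^sup>2 \<partial>\<sigma>) \<le> I n + 1" using c r by (simp add: H2_bounded_def)
      also have "\<dots> \<le> C + 1" using I(2)[of n] by simp
      finally show "(\<integral>x. (norm (c (of_real r * x)))\<^sup>2 \<partial>\<sigma>) \<le> C + 1" .
    qed
    have "(norm (b z))\<^sup>2 \<le> (2 * (C + 1)) / (1 - norm z)" if z: "norm z < 1" for z
    proof -
      have "2 / (1 - norm z) * (I n + 1) \<le> 2 / (1 - norm z) * (C + 1)"
        using z I[of n] by (intro mult_left_mono) auto
      then show ?thesis using ab(5)[OF z] by simp
    qed
    then have "Q n (a, b)" using ab(3,4) mono[OF ab(1)] mono[OF ab(2)] by (simp add: Q_def)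
    then show ?thesis by blast
  qed
  then obtain p where p: "\<And>n. Q n (p n)" using choice[of Q] by blast
  have "0 \<le> C" using I[of 0] by (rule order_trans)
  then have L: "0 \<le> 2 * (C + 1)" by simp
  have bdb: "(norm (snd (p n) z))\<^sup>2 \<le> (2 * (C + 1)) / (1 - norm z)" if "norm z < 1" for n z
    using p[of n] that by (simp add: Q_def)
  have bda: "(norm (fst (p n) z))\<^sup>2 \<le> (2 * (C + 1)) / (1 - norm z)" if z: "norm z < 1" for n z
  proof -
    have "norm (fst (p n) z) \<le> norm (snd (p n) z)" using p[of n] z by (simp add: Q_def)
    then have "(norm (fst (p n) z))\<^sup>2 \<le> (norm (snd (p n) z))\<^sup>2" by (intro power_mono) auto
    then show ?thesis using bdb[OF z, of n] by linarith
  qed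
  have pa: "H2_bounded (C + 1) (fst (p n))" and pb: "H2_bounded (C + 1) (snd (p n))" for n
    using p[of n] by (simp_all add: Q_def)
  obtain a s where a: "H2_bounded (C + 1) a" "strict_mono (s :: nat \<Rightarrow> nat)"
    "\<And>z. norm z < 1 \<Longrightarrow> (\<lambda>n. fst (p (s n)) z) \<longlonglongrightarrow> a z"
    by (rule H2_normal_family[of "C + 1" "\<lambda>n. fst (p n)", OF pa bda L]) (assumption | rule that)+
  \<comment> \<open>The second subsequence is chosen along the first, so that both factors converge
    along \<open>s \<circ> t\<close>.\<close>
  obtain b t where b: "H2_bounded (C + 1) b" "strict_mono (t :: nat \<Rightarrow> nat)"
    "\<And>z. norm z < 1 \<Longrightarrow> (\<lambda>n. snd (p (s (t n))) z) \<longlonglongrightarrow> b z"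
    by (rule H2_normal_family[of "C + 1" "\<lambda>n. snd (p (s n))", OF pb bdb L]) (assumption | rule that)+
  have "f z = a z * b z" if z: "norm z < 1" for z
  proof -
    have st: "strict_mono (s \<circ> t)" using a(2) b(2) by (rule strict_mono_o)
    have "(\<lambda>n. fst (p (s (t n))) z) \<longlonglongrightarrow> a z"
      using LIMSEQ_subseq_LIMSEQ[OF a(3)[OF z] b(2)] by (simp add: o_def)
    then have 1: "(\<lambda>n. fst (p (s (t n))) z * snd (p (s (t n))) z) \<longlonglongrightarrow> a z * b z"
      by (intro tendsto_mult b(3)[OF z])
    have eq: "fst (p m) z * snd (p m) z = f (of_real (r m) * z)" for m
      using p[of m] z unfolding Q_def by simp
    have "(\<lambda>n. 1 - 1 / real (n + 2)) \<longlonglongrightarrow> 1 - 0"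
      by (intro tendsto_diff tendsto_const LIMSEQ_ignore_initial_segment[OF lim_1_over_n])
    then have "r \<longlonglongrightarrow> 1" by (simp add: r_def[abs_def])
    from LIMSEQ_subseq_LIMSEQ[OF this st] have "(\<lambda>n. r (s (t n))) \<longlonglongrightarrow> 1" by (simp only: o_def)
    then have rz: "(\<lambda>n. of_real (r (s (t n))) * z) \<longlonglongrightarrow> of_real 1 * z" by (intro tendsto_intros)
    have "isCont f z" using cont z by (simp add: continuous_on_eq_continuous_at)
    then have "(\<lambda>n. f (of_real (r (s (t n))) * z)) \<longlonglongrightarrow> f z"
      by (rule isCont_tendsto_compose) (use rz in simp)
    then show ?thesis by (rule LIMSEQ_unique) (use 1 in \<open>simp only: eq\<close>)
  qed
  then show thesis by (rule that[OF a(1) b(1)])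
qed

section \<open>Poisson representation and boundary values of \<open>H\<^sup>1\<close>\<close>

definition taylor_coeff :: "(complex \<Rightarrow> complex) \<Rightarrow> nat \<Rightarrow> complex" where
  "taylor_coeff a n = (deriv ^^ n) a 0 / fact n"

lemma taylor_sums:
  assumes a: "a holomorphic_on ball 0 1" and z: "norm z < 1"
  shows "(\<lambda>n. taylor_coeff a n * z ^ n) sums a z"
  using holomorphic_power_series[OF a, of z] z by (simp add: taylor_coeff_def)

lemma taylor_summable_norm:
  assumes a: "a holomorphic_on ball 0 1" and z: "norm z < 1"
  shows "summable (\<lambda>n. norm (taylor_coeff a n * z ^ n))"
proof -
  define t where "t = (norm z + 1) / 2"
  have t: "norm z < t" "t < 1" using z by (auto simp: t_def)
  have "0 \<le> t" using norm_ge_zero[of z] t(1) by (rule order_trans[OF _ less_imp_le])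
  then have nt: "norm (complex_of_real t) = t" by simp
  have "summable (\<lambda>n. taylor_coeff a n * of_real t ^ n)"
    by (rule sums_summable[OF taylor_sums[OF a]]) (use nt t in simp)
  then show ?thesis by (rule powser_insidea) (use nt t in simp)
qed

lemma taylor_integral_sums:
  assumes a: "a holomorphic_on ball 0 1" and r: "0 \<le> r" "r < 1" and g: "continuous_on (sphere 0 1) g"
  shows "(\<lambda>n. taylor_coeff a n * of_real r ^ n * (\<integral>x. x ^ n * g x \<partial>\<sigma>)) sums (\<integral>x. a (of_real r * x) * g x \<partial>\<sigma>)"
proof -
  let ?f = "\<lambda>n x. taylor_coeff a n * of_real r ^ n * (x ^ n * g x)"
  have "bounded (g ` sphere 0 1)" by (intro compact_imp_bounded compact_continuous_image g) auto
  then obtain B where B: "\<forall>x\<in>sphere 0 1. norm (g x) \<le> B" unfolding bounded_iff by auto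
  have rn: "norm (complex_of_real r) < 1" using r by simp
  have sm: "summable (\<lambda>n. norm (taylor_coeff a n * of_real r ^ n) * B)"
    by (rule summable_mult2[OF taylor_summable_norm[OF a rn]])
  have le: "norm (?f n x) \<le> norm (taylor_coeff a n * of_real r ^ n) * B" if "norm x = 1" for n x
  proof -
    have "norm (?f n x) = norm (taylor_coeff a n * of_real r ^ n) * norm (g x)"
      using that by (simp add: norm_mult norm_power)
    also have "\<dots> \<le> norm (taylor_coeff a n * of_real r ^ n) * B"
      by (rule mult_left_mono) (use B that in auto)
    finally show ?thesis .
  qed
  have cf: "continuous_on (sphere 0 1) (?f n)" for n by (intro continuous_intros g)
  have int: "integrable \<sigma> (?f n)" for n by (rule circle_integrable_continuous[OF cf])
  have sx: "(\<lambda>n. ?f n x) sums (a (of_real r * x) * g x)" if "norm x = 1" for x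
  proof -
    have "norm (of_real r * x) < 1" using r that by (simp add: norm_mult)
    from sums_mult2[OF taylor_sums[OF a this], of "g x"] show ?thesis
      by (simp add: power_mult_distrib mult.assoc)
  qed
  have "(\<lambda>n. \<integral>x. ?f n x \<partial>\<sigma>) sums (\<integral>x. (\<Sum>n. ?f n x) \<partial>\<sigma>)"
  proof (rule sums_integral[OF int])
    show "AE x in \<sigma>. summable (\<lambda>n. norm (?f n x))"
    proof (rule AE_I2)
      fix x assume "x \<in> space \<sigma>"
      then show "summable (\<lambda>n. norm (?f n x))"
        by (intro summable_comparison_test'[OF sm]) (use le in auto)
    qed
    show "summable (\<lambda>n. \<integral>x. norm (?f n x) \<partial>\<sigma>)"
    proof (rule summable_comparison_test'[OF sm])
      fix n :: nat
      have "(\<integral>x. norm (?f n x) \<partial>\<sigma>) \<le> (\<integral>x. norm (taylor_coeff a n * of_real r ^ n) * B \<partial>\<sigma>)"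
        by (rule integral_mono) (use le in \<open>auto intro!: integrable_norm int\<close>)
      then show "norm (\<integral>x. norm (?f n x) \<partial>\<sigma>) \<le> norm (taylor_coeff a n * of_real r ^ n) * B" by simp
    qed
  qed
  moreover have "(\<integral>x. (\<Sum>n. ?f n x) \<partial>\<sigma>) = (\<integral>x. a (of_real r * x) * g x \<partial>\<sigma>)"
    by (rule Bochner_Integration.integral_cong[OF refl]) (use sums_unique[OF sx] in simp)
  moreover have "(\<integral>x. ?f n x \<partial>\<sigma>) = taylor_coeff a n * of_real r ^ n * (\<integral>x. x ^ n * g x \<partial>\<sigma>)" for n
    by (rule integral_mult_right_zero)
  ultimately show ?thesis by simp
qed

lemma circle_power_integral: "(\<integral>x. x ^ m * cnj x ^ n \<partial>\<sigma>) = (if m = n then 1 else 0)"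
proof -
  have *: "(\<integral>x. x ^ m * cnj x ^ n \<partial>\<sigma>) = (if m = n then 1 else 0)" if "n \<le> m" for m n :: nat
  proof -
    have "(\<integral>x. x ^ m * cnj x ^ n \<partial>\<sigma>) = (\<integral>x. x ^ (m - n) \<partial>\<sigma>)"
    proof (rule Bochner_Integration.integral_cong[OF refl])
      fix x assume "x \<in> space \<sigma>"
      then have "x * cnj x = 1" by (simp add: complex_norm_square[symmetric])
      then have "x ^ n * cnj x ^ n = 1" by (metis power_mult_distrib power_one)
      moreover have "x ^ m = x ^ (m - n) * x ^ n" using that by (simp flip: power_add)
      ultimately show "x ^ m * cnj x ^ n = x ^ (m - n)" by (simp add: mult.assoc)
    qed
    also have "\<dots> = 0 ^ (m - n)"
      by (rule mean_value_circle) (auto intro!: continuous_intros holomorphic_intros)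
    finally show ?thesis using that by auto
  qed
  show ?thesis
  proof (cases "n \<le> m")
    case False
    have "(\<integral>x. x ^ m * cnj x ^ n \<partial>\<sigma>) = (\<integral>x. cnj (x ^ n * cnj x ^ m) \<partial>\<sigma>)" by (simp add: mult.commute)
    also have "\<dots> = cnj (\<integral>x. x ^ n * cnj x ^ m \<partial>\<sigma>)" by (rule Bochner_Integration.integral_cnj)
    finally show ?thesis using *[of m n] False by simp
  qed (rule *)
qed

lemma taylor_coeff_integral:
  assumes a: "a holomorphic_on ball 0 1" and r: "0 \<le> r" "r < 1"
  shows "(\<integral>x. x ^ n * cnj (a (of_real r * x)) \<partial>\<sigma>) = cnj (taylor_coeff a n) * of_real r ^ n"
proof -
  have "(\<lambda>m. taylor_coeff a m * of_real r ^ m * (\<integral>x. x ^ m * cnj x ^ n \<partial>\<sigma>)) sums (\<integral>x. a (of_real r * x) * cnj x ^ n \<partial>\<sigma>)"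
    by (rule taylor_integral_sums[OF a r]) (intro continuous_intros)
  moreover have "(\<lambda>m. taylor_coeff a m * of_real r ^ m * (\<integral>x. x ^ m * cnj x ^ n \<partial>\<sigma>)) sums (taylor_coeff a n * of_real r ^ n)"
    unfolding circle_power_integral
    using sums_single[of n "\<lambda>m. taylor_coeff a m * of_real r ^ m"] by (simp add: if_distrib cong: if_cong)
  ultimately have eq: "(\<integral>x. a (of_real r * x) * cnj x ^ n \<partial>\<sigma>) = taylor_coeff a n * of_real r ^ n"
    by (rule sums_unique2)
  have "(\<integral>x. x ^ n * cnj (a (of_real r * x)) \<partial>\<sigma>) = (\<integral>x. cnj (a (of_real r * x) * cnj x ^ n) \<partial>\<sigma>)"
    by (simp add: mult.commute)
  also have "\<dots> = cnj (\<integral>x. a (of_real r * x) * cnj x ^ n \<partial>\<sigma>)" by (rule Bochner_Integration.integral_cnj)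
  finally show ?thesis by (simp add: eq)
qed

text \<open>At \<open>t = r * s\<close> this is the inner product of the dilations of a by r and by
  s. Its coefficients are nonnegative, so it increases with t.\<close>

definition coeff_sum :: "(complex \<Rightarrow> complex) \<Rightarrow> real \<Rightarrow> real" where
  "coeff_sum a t = (\<Sum>n. (norm (taylor_coeff a n))\<^sup>2 * t ^ n)"

lemma parseval:
  assumes a: "a holomorphic_on ball 0 1" and r: "0 \<le> r" "r < 1" and s: "0 \<le> s" "s < 1"
  shows "(\<lambda>n. (norm (taylor_coeff a n))\<^sup>2 * (r * s) ^ n) sums coeff_sum a (r * s)"
    and "(\<integral>x. a (of_real r * x) * cnj (a (of_real s * x)) \<partial>\<sigma>) = of_real (coeff_sum a (r * s))"
proof -
  have ca: "continuous_on (sphere 0 1) (\<lambda>x. a (of_real s * x))"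
    by (rule radial_continuous(2)[OF holomorphic_on_imp_continuous_on[OF a] s])
  have "(\<lambda>n. taylor_coeff a n * of_real r ^ n * (\<integral>x. x ^ n * cnj (a (of_real s * x)) \<partial>\<sigma>)) sums (\<integral>x. a (of_real r * x) * cnj (a (of_real s * x)) \<partial>\<sigma>)"
    by (rule taylor_integral_sums[OF a r]) (intro continuous_intros ca)
  moreover have "taylor_coeff a n * of_real r ^ n * (\<integral>x. x ^ n * cnj (a (of_real s * x)) \<partial>\<sigma>)
      = complex_of_real ((norm (taylor_coeff a n))\<^sup>2 * (r * s) ^ n)" for n
    unfolding taylor_coeff_integral[OF a s]
    unfolding of_real_mult complex_norm_square by (simp add: power_mult_distrib mult_ac)
  ultimately have *: "(\<lambda>n. complex_of_real ((norm (taylor_coeff a n))\<^sup>2 * (r * s) ^ n)) sums (\<integral>x. a (of_real r * x) * cnj (a (of_real s * x)) \<partial>\<sigma>)"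
    by simp
  from sums_Re[OF this] have 1: "(\<lambda>n. (norm (taylor_coeff a n))\<^sup>2 * (r * s) ^ n) sums Re (\<integral>x. a (of_real r * x) * cnj (a (of_real s * x)) \<partial>\<sigma>)"
    by simp
  then have e: "coeff_sum a (r * s) = Re (\<integral>x. a (of_real r * x) * cnj (a (of_real s * x)) \<partial>\<sigma>)"
    unfolding coeff_sum_def by (rule sums_unique[symmetric])
  show "(\<lambda>n. (norm (taylor_coeff a n))\<^sup>2 * (r * s) ^ n) sums coeff_sum a (r * s)" using 1 e by simp
  from sums_of_real[OF this, where 'a = complex] *
  show "(\<integral>x. a (of_real r * x) * cnj (a (of_real s * x)) \<partial>\<sigma>) = of_real (coeff_sum a (r * s))"
    by (rule sums_unique2[symmetric])
qed

lemma coeff_sum_mono: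
  assumes a: "a holomorphic_on ball 0 1" and t: "0 \<le> t" "t \<le> u" "u < 1"
  shows "coeff_sum a t \<le> coeff_sum a u"
proof (rule sums_le)
  have sq: "(\<lambda>n. (norm (taylor_coeff a n))\<^sup>2 * v ^ n) sums coeff_sum a v" if "0 \<le> v" "v < 1" for v
  proof -
    \<comment> \<open>Splitting v as a product of two equal radii lets Parseval supply the
      convergence of the series at v.\<close>
    have "sqrt v * sqrt v = v" "0 \<le> sqrt v" "sqrt v < 1" using that by auto
    then show ?thesis using parseval(1)[OF a, of "sqrt v" "sqrt v"] by simp
  qed
  show "(\<lambda>n. (norm (taylor_coeff a n))\<^sup>2 * t ^ n) sums coeff_sum a t" by (rule sq) (use t in auto)
  show "(\<lambda>n. (norm (taylor_coeff a n))\<^sup>2 * u ^ n) sums coeff_sum a u" by (rule sq) (use t in auto)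
  show "(norm (taylor_coeff a n))\<^sup>2 * t ^ n \<le> (norm (taylor_coeff a n))\<^sup>2 * u ^ n" for n
    using t by (intro mult_left_mono power_mono) auto
qed

lemma H2_coeff_sum:
  assumes a: "a holomorphic_on ball 0 1" and r: "0 \<le> r" "r < 1"
  shows "(\<integral>x. (norm (a (of_real r * x)))\<^sup>2 \<partial>\<sigma>) = coeff_sum a (r * r)"
proof -
  have "complex_of_real (\<integral>x. (norm (a (of_real r * x)))\<^sup>2 \<partial>\<sigma>) = (\<integral>x. a (of_real r * x) * cnj (a (of_real r * x)) \<partial>\<sigma>)"
    by (simp only: complex_norm_square[symmetric] integral_complex_of_real)
  then show ?thesis unfolding parseval(2)[OF a r r] by (simp only: of_real_eq_iff)
qed

text \<open>Expanding the square gives the values of \<open>coeff_sum a\<close> at r^2 and s^2 minus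
  twice the value at r s, and the value at r s is at least that at r^2.\<close>

lemma H2_distance:
  assumes a: "a holomorphic_on ball 0 1" and r: "0 \<le> r" "r \<le> s" and s: "s < 1"
  shows "(\<integral>x. (norm (a (of_real r * x) - a (of_real s * x)))\<^sup>2 \<partial>\<sigma>) \<le> coeff_sum a (s * s) - coeff_sum a (r * r)"
proof -
  let ?r = "\<lambda>x. a (of_real r * x)" and ?s = "\<lambda>x. a (of_real s * x)"
  have r1: "r < 1" and s0: "0 \<le> s" using r s by auto
  have c: "continuous_on (sphere 0 1) ?r" "continuous_on (sphere 0 1) ?s"
    using radial_continuous(2)[OF holomorphic_on_imp_continuous_on[OF a]] r r1 s s0 by auto
  have i: "integrable \<sigma> (\<lambda>x. ?r x * cnj (?r x))" "integrable \<sigma> (\<lambda>x. ?s x * cnj (?s x))"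
    "integrable \<sigma> (\<lambda>x. ?r x * cnj (?s x))" "integrable \<sigma> (\<lambda>x. ?s x * cnj (?r x))"
    by (intro circle_integrable_continuous continuous_intros c)+
  have "complex_of_real (\<integral>x. (norm (?r x - ?s x))\<^sup>2 \<partial>\<sigma>) = (\<integral>x. (?r x - ?s x) * cnj (?r x - ?s x) \<partial>\<sigma>)"
    by (simp only: complex_norm_square[symmetric] integral_complex_of_real)
  also have "\<dots> = (\<integral>x. (?r x * cnj (?r x) + ?s x * cnj (?s x)) - (?r x * cnj (?s x) + ?s x * cnj (?r x)) \<partial>\<sigma>)"
    by (rule Bochner_Integration.integral_cong[OF refl]) (simp add: algebra_simps)
  also have "\<dots> = ((\<integral>x. ?r x * cnj (?r x) \<partial>\<sigma>) + (\<integral>x. ?s x * cnj (?s x) \<partial>\<sigma>)) - ((\<integral>x. ?r x * cnj (?s x) \<partial>\<sigma>) + (\<integral>x. ?s x * cnj (?r x) \<partial>\<sigma>))"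
    using i by (simp only: Bochner_Integration.integral_diff Bochner_Integration.integral_add Bochner_Integration.integrable_add)
  also have "\<dots> = of_real (coeff_sum a (r * r) + coeff_sum a (s * s) - (coeff_sum a (r * s) + coeff_sum a (s * r)))"
    using parseval(2)[OF a] r r1 s s0 by simp
  finally have "(\<integral>x. (norm (?r x - ?s x))\<^sup>2 \<partial>\<sigma>) = coeff_sum a (r * r) + coeff_sum a (s * s) - (coeff_sum a (r * s) + coeff_sum a (s * r))"
    by (simp only: of_real_eq_iff)
  moreover have "coeff_sum a (r * r) \<le> coeff_sum a (r * s)"
  proof (rule coeff_sum_mono[OF a])
    show "r * r \<le> r * s" using r by (intro mult_left_mono) auto
    have "r * s \<le> 1 * s" using r1 s0 by (intro mult_right_mono) auto
    then show "r * s < 1" using s by simp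
  qed (use r in auto)
  moreover have "s * r = r * s" by (rule mult.commute)
  ultimately show ?thesis by simp
qed

text \<open>The square means increase with the radius and are bounded by K, so they converge to
  their supremum; by \<open>H2_distance\<close> the distance of two dilations is at most the
  difference of their square means.\<close>

lemma H2_Cauchy:
  assumes a: "H2_bounded K a" and e: "0 < e"
  obtains R where "0 \<le> R" "R < 1"
    "\<And>r s. R \<le> r \<Longrightarrow> r < 1 \<Longrightarrow> R \<le> s \<Longrightarrow> s < 1 \<Longrightarrow>
      (\<integral>x. (norm (a (of_real r * x) - a (of_real s * x)))\<^sup>2 \<partial>\<sigma>) < e"
proof -
  have hol: "a holomorphic_on ball 0 1" using a by (simp add: H2_bounded_def)
  define m where "m r = coeff_sum a (r * r)" for r
  have mono: "m r \<le> m s" if "0 \<le> r" "r \<le> s" "s < 1" for r s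
    unfolding m_def
  proof (rule coeff_sum_mono[OF hol])
    show "r * r \<le> s * s" using that by (intro mult_mono) auto
    have "s * s \<le> 1 * s" using that by (intro mult_right_mono) auto
    then show "s * s < 1" using that by simp
  qed (use that in auto)
  have "m r \<le> K" if "0 \<le> r" "r < 1" for r
    unfolding m_def H2_coeff_sum[OF hol that, symmetric] using a that by (simp add: H2_bounded_def)
  then have bdd: "bdd_above (m ` {0..<1})" by (intro bdd_aboveI2[of _ _ K]) auto
  define S where "S = (SUP r\<in>{0..<1}. m r)"
  have "S - e < S" using e by simp
  then obtain R where R: "R \<in> {0..<1}" "S - e < m R"
    unfolding S_def using less_cSUP_iff[OF _ bdd] by auto
  have up: "m r \<le> S" if "0 \<le> r" "r < 1" for r
    unfolding S_def by (rule cSUP_upper[OF _ bdd]) (use that in auto)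
  have main: "(\<integral>x. (norm (a (of_real r * x) - a (of_real s * x)))\<^sup>2 \<partial>\<sigma>) < e" if "R \<le> r" "r \<le> s" "s < 1" for r s
  proof -
    have "(\<integral>x. (norm (a (of_real r * x) - a (of_real s * x)))\<^sup>2 \<partial>\<sigma>) \<le> m s - m r"
      unfolding m_def by (rule H2_distance[OF hol]) (use that R in auto)
    moreover have "m R \<le> m r" by (rule mono) (use that R in auto)
    moreover have "m s \<le> S" by (rule up) (use that R in auto)
    ultimately show ?thesis using R(2) by linarith
  qed
  show thesis
  proof (rule that[of R])
    fix r s assume rs: "R \<le> r" "r < 1" "R \<le> s" "s < 1"
    show "(\<integral>x. (norm (a (of_real r * x) - a (of_real s * x)))\<^sup>2 \<partial>\<sigma>) < e"
    proof (cases "r \<le> s")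
      case True
      then show ?thesis using main rs by simp
    next
      case False
      then have "(\<integral>x. (norm (a (of_real s * x) - a (of_real r * x)))\<^sup>2 \<partial>\<sigma>) < e" using main rs by simp
      then show ?thesis by (simp only: norm_minus_commute)
    qed
  qed (use R in auto)
qed

section \<open>Convergence of dilations in L^1 and the Poisson representation\<close>

lemma H2_boundedD:
  "H2_bounded K a \<Longrightarrow> 0 \<le> r \<Longrightarrow> r < 1 \<Longrightarrow> (\<integral>x. (norm (a (of_real r * x)))\<^sup>2 \<partial>\<sigma>) \<le> K"
  unfolding H2_bounded_def by blast

text \<open>With f = a b, write a_r b_r - a_s b_s = (a_r - a_s) b_r + (b_r - b_s) a_s. A weighted
  inequality between arithmetic and geometric mean takes the place of Cauchy-Schwarz.\<close>

lemma hardy1_L1_Cauchy: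
  assumes f: "f \<in> hardy1" and e: "0 < e"
  shows "\<exists>R. 0 \<le> R \<and> R < 1 \<and> (\<forall>r s. R \<le> r \<longrightarrow> r < 1 \<longrightarrow> R \<le> s \<longrightarrow> s < 1 \<longrightarrow>
      (\<integral>x. norm (f (of_real r * x) - f (of_real s * x)) \<partial>\<sigma>) < e)"
proof -
  obtain K a b where a: "H2_bounded K a" and b: "H2_bounded K b" and ab: "\<And>z. norm z < 1 \<Longrightarrow> f z = a z * b z"
    by (rule hardy1_factor[OF f]) (rule that)
  have hol: "a holomorphic_on ball 0 1" "b holomorphic_on ball 0 1" using a b by (auto simp: H2_bounded_def)
  note cont = holomorphic_on_imp_continuous_on[OF hol(1)] holomorphic_on_imp_continuous_on[OF hol(2)]
  have "0 \<le> (\<integral>x. (norm (a (of_real 0 * x)))\<^sup>2 \<partial>\<sigma>)" by (rule Bochner_Integration.integral_nonneg) simp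
  also have "\<dots> \<le> K" by (rule H2_boundedD[OF a]) auto
  finally have K: "0 \<le> K" .
  \<comment> \<open>The total bound will be t d + (K + 1) / t; the weight t makes the second term
    e/2, and d then makes the first one e/2.\<close>
  define t where "t = 2 * (K + 1) / e"
  have t: "0 < t" using K e by (simp add: t_def)
  define d where "d = e / (2 * t)"
  have d: "0 < d" using e t by (simp add: d_def)
  obtain R1 where R1: "0 \<le> R1" "R1 < 1" "\<And>r s. R1 \<le> r \<Longrightarrow> r < 1 \<Longrightarrow> R1 \<le> s \<Longrightarrow> s < 1 \<Longrightarrow>
      (\<integral>x. (norm (a (of_real r * x) - a (of_real s * x)))\<^sup>2 \<partial>\<sigma>) < d"
    by (rule H2_Cauchy[OF a d]) (rule that)
  obtain R2 where R2: "0 \<le> R2" "R2 < 1" "\<And>r s. R2 \<le> r \<Longrightarrow> r < 1 \<Longrightarrow> R2 \<le> s \<Longrightarrow> s < 1 \<Longrightarrow>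
      (\<integral>x. (norm (b (of_real r * x) - b (of_real s * x)))\<^sup>2 \<partial>\<sigma>) < d"
    by (rule H2_Cauchy[OF b d]) (rule that)
  have main: "(\<integral>x. norm (f (of_real r * x) - f (of_real s * x)) \<partial>\<sigma>) < e"
    if r: "R1 \<le> r" "R2 \<le> r" "r < 1" and s: "R1 \<le> s" "R2 \<le> s" "s < 1" for r s
  proof -
    have r0: "0 \<le> r" and s0: "0 \<le> s" using r s R1 by auto
    let ?ar = "\<lambda>x. a (of_real r * x)" and ?as = "\<lambda>x. a (of_real s * x)"
    let ?br = "\<lambda>x. b (of_real r * x)" and ?bs = "\<lambda>x. b (of_real s * x)"
    note c = radial_continuous(2)[OF cont(1) r0 r(3)] radial_continuous(2)[OF cont(1) s0 s(3)]
      radial_continuous(2)[OF cont(2) r0 r(3)] radial_continuous(2)[OF cont(2) s0 s(3)]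
    let ?G = "\<lambda>x. (t/2) * (norm (?ar x - ?as x))\<^sup>2 + (1/(2*t)) * (norm (?br x))\<^sup>2
        + ((t/2) * (norm (?br x - ?bs x))\<^sup>2 + (1/(2*t)) * (norm (?as x))\<^sup>2)"
    have amgm: "u * v \<le> (t/2) * u\<^sup>2 + (1/(2*t)) * v\<^sup>2" for u v :: real
    proof -
      have "0 \<le> (t * u - v)\<^sup>2 / (2 * t)" using t by simp
      also have "\<dots> = (t/2) * u\<^sup>2 + (1/(2*t)) * v\<^sup>2 - u * v"
        using t by (simp add: power2_eq_square field_simps)
      finally show ?thesis by simp
    qed
    have pt: "norm (f (of_real r * x) - f (of_real s * x)) \<le> ?G x" if x: "norm x = 1" for x
    proof -
      have n: "norm (of_real r * x) < 1" "norm (of_real s * x) < 1" using x r r0 s s0 by (simp_all add: norm_mult)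
      have "f (of_real r * x) - f (of_real s * x) = (?ar x - ?as x) * ?br x + (?br x - ?bs x) * ?as x"
        unfolding ab[OF n(1)] ab[OF n(2)] by (simp add: algebra_simps)
      also have "norm \<dots> \<le> norm (?ar x - ?as x) * norm (?br x) + norm (?br x - ?bs x) * norm (?as x)"
        by (rule order_trans[OF norm_triangle_ineq]) (simp only: norm_mult order_refl)
      also have "\<dots> \<le> ?G x" by (intro add_mono amgm)
      finally show ?thesis .
    qed
    have cf: "continuous_on (sphere 0 1) (\<lambda>x. f (of_real q * x))" if "0 \<le> q" "q < 1" for q
      using f by (intro radial_continuous(2)[OF holomorphic_on_imp_continuous_on that]) (simp add: hardy1_def)
    have i: "integrable \<sigma> (\<lambda>x. (norm (?ar x - ?as x))\<^sup>2)" "integrable \<sigma> (\<lambda>x. (norm (?br x))\<^sup>2)"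
      "integrable \<sigma> (\<lambda>x. (norm (?br x - ?bs x))\<^sup>2)" "integrable \<sigma> (\<lambda>x. (norm (?as x))\<^sup>2)"
      by (intro circle_integrable_continuous continuous_intros c)+
    have "(\<integral>x. norm (f (of_real r * x) - f (of_real s * x)) \<partial>\<sigma>) \<le> (\<integral>x. ?G x \<partial>\<sigma>)"
    proof (rule integral_mono)
      show "integrable \<sigma> (\<lambda>x. norm (f (of_real r * x) - f (of_real s * x)))"
        by (intro circle_integrable_continuous continuous_intros cf r0 s0 r s)
      show "integrable \<sigma> ?G" by (intro Bochner_Integration.integrable_add integrable_mult_right i)
    qed (use pt in simp)
    also have "\<dots> = (t/2) * (\<integral>x. (norm (?ar x - ?as x))\<^sup>2 \<partial>\<sigma>) + (1/(2*t)) * (\<integral>x. (norm (?br x))\<^sup>2 \<partial>\<sigma>)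
        + ((t/2) * (\<integral>x. (norm (?br x - ?bs x))\<^sup>2 \<partial>\<sigma>) + (1/(2*t)) * (\<integral>x. (norm (?as x))\<^sup>2 \<partial>\<sigma>))"
      using i by (simp only: Bochner_Integration.integral_add Bochner_Integration.integrable_add integrable_mult_right integral_mult_right_zero)
    also have "\<dots> < (t/2) * d + (1/(2*t)) * (K + 1) + ((t/2) * d + (1/(2*t)) * (K + 1))"
    proof -
      have "(\<integral>x. (norm (?br x))\<^sup>2 \<partial>\<sigma>) < K + 1" "(\<integral>x. (norm (?as x))\<^sup>2 \<partial>\<sigma>) < K + 1"
        using H2_boundedD[OF b r0 r(3)] H2_boundedD[OF a s0 s(3)] by linarith+
      then show ?thesis using t R1(3)[of r s] R2(3)[of r s] r s by (intro add_strict_mono mult_strict_left_mono) auto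
    qed
    also have "\<dots> = t * d + (K + 1) / t" using t by (simp add: field_simps)
    also have "\<dots> = e" using t K e by (simp add: d_def) (simp add: t_def field_simps)
    finally show ?thesis .
  qed
  show ?thesis
    by (rule exI[of _ "max R1 R2"]) (use R1(1,2) R2(1,2) main in auto)
qed

lemma L1_series:
  fixes D :: "nat \<Rightarrow> complex \<Rightarrow> complex"
  assumes int: "\<And>k. integrable \<sigma> (D k)" and sm: "summable (\<lambda>k. \<integral>x. norm (D k x) \<partial>\<sigma>)"
  shows "AE x in \<sigma>. summable (\<lambda>k. norm (D k x))"
proof -
  have [measurable]: "D k \<in> borel_measurable \<sigma>" for k using int by simp
  have "(\<integral>\<^sup>+x. (\<Sum>k. ennreal (norm (D k x))) \<partial>\<sigma>) = (\<Sum>k. \<integral>\<^sup>+x. ennreal (norm (D k x)) \<partial>\<sigma>)"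
    by (rule nn_integral_suminf) measurable
  also have "\<dots> = (\<Sum>k. ennreal (\<integral>x. norm (D k x) \<partial>\<sigma>))"
    using int by (subst nn_integral_eq_integral) auto
  also have "\<dots> = ennreal (\<Sum>k. \<integral>x. norm (D k x) \<partial>\<sigma>)"
    by (rule suminf_ennreal2[OF _ sm]) simp
  finally have "(\<integral>\<^sup>+x. (\<Sum>k. ennreal (norm (D k x))) \<partial>\<sigma>) \<noteq> \<infinity>" by simp
  then have "AE x in \<sigma>. (\<Sum>k. ennreal (norm (D k x))) \<noteq> \<infinity>"
    by (intro nn_integral_PInf_AE) measurable
  then show ?thesis
    by eventually_elim (rule summable_suminf_not_top, auto)
qed

text \<open>The L^1 limit of the dilations is built by hand as a telescoping series whose terms have
  L^1 norm at most 2^-k, so that it converges absolutely almost everywhere. The Poisson formula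
  holds for each dilation and passes through the series.\<close>

theorem hardy1_poisson:
  assumes f: "f \<in> hardy1"
  obtains g where "integrable \<sigma> g" "\<And>z. norm z < 1 \<Longrightarrow> f z = (\<integral>x. poisson z x *\<^sub>R g x \<partial>\<sigma>)"
proof -
  have hol: "f holomorphic_on ball 0 1" using f by (simp add: hardy1_def)
  note cont = holomorphic_on_imp_continuous_on[OF hol]
  define Q where "Q k R \<longleftrightarrow> 0 \<le> R \<and> R < 1 \<and> (\<forall>r s. R \<le> r \<longrightarrow> r < 1 \<longrightarrow> R \<le> s \<longrightarrow> s < 1 \<longrightarrow>
      (\<integral>x. norm (f (of_real r * x) - f (of_real s * x)) \<partial>\<sigma>) < (1/2)^k)" for k :: nat and R :: real
  have "\<exists>R. Q k R" for k unfolding Q_def by (rule hardy1_L1_Cauchy[OF f]) simp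
  then obtain R where R: "\<And>k. Q k (R k)" using choice[of Q] by blast
  \<comment> \<open>Taking the maximum over all earlier thresholds makes both radii
    \<open>\<rho> k\<close> and \<open>\<rho> (Suc k)\<close> admissible for R k; the inserted value
    forces \<open>\<rho>\<close> to tend to 1.\<close>
  define \<rho> where "\<rho> k = Max (insert (1 - 1 / real (k + 2)) (R ` {..k}))" for k
  have \<rho>_ge: "R j \<le> \<rho> k" if "j \<le> k" for j k unfolding \<rho>_def using that by (intro Max_ge) auto
  have \<rho>_ge': "1 - 1 / real (k + 2) \<le> \<rho> k" for k unfolding \<rho>_def by (intro Max_ge) auto
  have R01: "0 \<le> R k" "R k < 1" for k using R[of k] by (simp_all add: Q_def)
  have \<rho>1: "\<rho> k < 1" for k
    unfolding \<rho>_def by (subst Max_less_iff) (use R01 in auto)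
  have \<rho>0: "0 \<le> \<rho> k" for k by (rule order_trans[OF R01(1) \<rho>_ge[OF order_refl]])
  have \<rho>_lim: "\<rho> \<longlonglongrightarrow> 1"
  proof (rule tendsto_sandwich[of "\<lambda>k. 1 - 1 / real (k + 2)" _ _ "\<lambda>_. 1"])
    have "(\<lambda>n. 1 - 1 / real (n + 2)) \<longlonglongrightarrow> 1 - 0"
      by (intro tendsto_diff tendsto_const LIMSEQ_ignore_initial_segment[OF lim_1_over_n])
    then show "(\<lambda>n. 1 - 1 / real (n + 2)) \<longlonglongrightarrow> 1" by simp
  qed (use \<rho>_ge' \<rho>1 in \<open>auto intro!: always_eventually less_imp_le\<close>)
  define F where "F k x = f (of_real (\<rho> k) * x)" for k x
  define D where "D k x = F (Suc k) x - F k x" for k x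
  have cF: "continuous_on (sphere 0 1) (F k)" for k
    unfolding F_def[abs_def] by (rule radial_continuous(2)[OF cont \<rho>0 \<rho>1])
  have iF: "integrable \<sigma> (F k)" for k by (rule circle_integrable_continuous[OF cF])
  have iD: "integrable \<sigma> (D k)" for k unfolding D_def[abs_def] by (intro Bochner_Integration.integrable_diff iF)
  have Dm [measurable]: "D k \<in> borel_measurable \<sigma>" for k using iD by simp
  have ID: "(\<integral>x. norm (D k x) \<partial>\<sigma>) \<le> (1/2)^k" for k
    using R[of k] \<rho>_ge[of k "Suc k"] \<rho>_ge[of k k] \<rho>1 unfolding Q_def D_def F_def by (simp add: less_imp_le)
  have sm: "summable (\<lambda>k. \<integral>x. norm (D k x) \<partial>\<sigma>)"
    by (rule summable_comparison_test'[of "\<lambda>k. (1/2)^k" 0]) (use ID in \<open>auto intro: summable_geometric\<close>)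
  have ae: "AE x in \<sigma>. summable (\<lambda>k. norm (D k x))" by (rule L1_series[OF iD sm])
  define S where "S x = (\<Sum>k. D k x)" for x
  have iS: "integrable \<sigma> S" unfolding S_def[abs_def] by (rule integrable_suminf[OF iD ae sm])
  show thesis
  proof (rule that[of "\<lambda>x. F 0 x + S x"])
    show "integrable \<sigma> (\<lambda>x. F 0 x + S x)" by (intro Bochner_Integration.integrable_add iF iS)
    fix z :: complex assume z: "norm z < 1"
    have PF: "(\<integral>x. poisson z x *\<^sub>R F k x \<partial>\<sigma>) = f (of_real (\<rho> k) * z)" for k
      using poisson_integral_holomorphic[OF radial_continuous(1)[OF cont \<rho>0 \<rho>1] dilation_holomorphic[OF hol \<rho>0 \<rho>1] z]
      by (simp add: F_def scaleR_conv_of_real)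
    have iPD: "integrable \<sigma> (\<lambda>x. poisson z x *\<^sub>R D k x)" for k by (rule poisson_mult_integrable[OF iD z])
    have "(\<lambda>k. \<integral>x. poisson z x *\<^sub>R D k x \<partial>\<sigma>) sums (\<integral>x. (\<Sum>k. poisson z x *\<^sub>R D k x) \<partial>\<sigma>)"
    proof (rule sums_integral[OF iPD])
      show "AE x in \<sigma>. summable (\<lambda>k. norm (poisson z x *\<^sub>R D k x))"
        using ae by eventually_elim (simp add: summable_mult)
      show "summable (\<lambda>k. \<integral>x. norm (poisson z x *\<^sub>R D k x) \<partial>\<sigma>)"
      proof (rule summable_comparison_test'[OF summable_mult[OF sm, of "2 / (1 - norm z)"]])
        fix k :: nat
        have "(\<integral>x. norm (poisson z x *\<^sub>R D k x) \<partial>\<sigma>) \<le> (\<integral>x. 2 / (1 - norm z) * norm (D k x) \<partial>\<sigma>)"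
        proof (rule integral_mono)
          fix x assume "x \<in> space \<sigma>"
          then show "norm (poisson z x *\<^sub>R D k x) \<le> 2 / (1 - norm z) * norm (D k x)"
            using mult_right_mono[OF poisson_le[OF z, of x] norm_ge_zero[of "D k x"]] poisson_nonneg[OF z, of x] by simp
        qed (intro integrable_norm integrable_mult_right iPD iD)+
        then show "norm (\<integral>x. norm (poisson z x *\<^sub>R D k x) \<partial>\<sigma>) \<le> 2 / (1 - norm z) * (\<integral>x. norm (D k x) \<partial>\<sigma>)"
          by simp
      qed
    qed
    moreover have "(\<integral>x. (\<Sum>k. poisson z x *\<^sub>R D k x) \<partial>\<sigma>) = (\<integral>x. poisson z x *\<^sub>R S x \<partial>\<sigma>)"
    proof (rule integral_cong_AE)
      show "(\<lambda>x. \<Sum>k. poisson z x *\<^sub>R D k x) \<in> borel_measurable \<sigma>" by measurable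
      show "(\<lambda>x. poisson z x *\<^sub>R S x) \<in> borel_measurable \<sigma>" unfolding S_def by measurable
      show "AE x in \<sigma>. (\<Sum>k. poisson z x *\<^sub>R D k x) = poisson z x *\<^sub>R S x"
        using ae by eventually_elim (simp add: S_def suminf_scaleR_right summable_norm_cancel)
    qed
    moreover have "(\<integral>x. poisson z x *\<^sub>R D k x \<partial>\<sigma>) = f (of_real (\<rho> (Suc k)) * z) - f (of_real (\<rho> k) * z)" for k
      unfolding D_def poisson_integral_diff[OF iF iF z] PF ..
    ultimately have "(\<lambda>k. f (of_real (\<rho> (Suc k)) * z) - f (of_real (\<rho> k) * z)) sums (\<integral>x. poisson z x *\<^sub>R S x \<partial>\<sigma>)"
      by simp
    moreover have "(\<lambda>k. f (of_real (\<rho> (Suc k)) * z) - f (of_real (\<rho> k) * z)) sums (f z - f (of_real (\<rho> 0) * z))"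
    proof (rule telescope_sums)
      have "(\<lambda>k. of_real (\<rho> k) * z) \<longlonglongrightarrow> of_real 1 * z" by (intro tendsto_intros \<rho>_lim)
      then have l: "(\<lambda>k. of_real (\<rho> k) * z) \<longlonglongrightarrow> z" by simp
      have "isCont f z" using cont z by (simp add: continuous_on_eq_continuous_at)
      then show "(\<lambda>k. f (of_real (\<rho> k) * z)) \<longlonglongrightarrow> f z" by (rule isCont_tendsto_compose[OF _ l])
    qed
    ultimately have "(\<integral>x. poisson z x *\<^sub>R S x \<partial>\<sigma>) = f z - f (of_real (\<rho> 0) * z)" by (rule sums_unique2)
    then show "f z = (\<integral>x. poisson z x *\<^sub>R (F 0 x + S x) \<partial>\<sigma>)"
      unfolding poisson_integral_add[OF iF iS z] PF by simp
  qed
qed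

section \<open>Radial limits of H^1 functions\<close>

lemma inverse_Suc_radius: "0 \<le> 1 - 1 / real (m + 2)" "1 - 1 / real (m + 2) < 1"
  by (auto simp: field_simps)

text \<open>\<open>Lim\<close> is a definite description, so the set A of points where the radial
  limit exists has to be shown Borel first. By the Cauchy criterion it is a countable intersection
  of countable unions of closed sets; on A the limit may be taken along a sequence of radii.\<close>

lemma boundary_value_measurable [measurable]:
  assumes f: "continuous_on (ball 0 1) f"
  shows "boundary_value f \<in> borel_measurable \<sigma>"
proof -
  \<comment> \<open>Points where f oscillates by at most 1 / (k + 1) over all radii from 1 - 1 / (m
    + 2) on. The radii range over a continuum, but each condition is closed, so no countability is
    required here.\<close>
  define C where "C k m = sphere 0 1 \<inter> (\<Inter>p\<in>{1 - 1 / real (m + 2)..<1}. \<Inter>q\<in>{1 - 1 / real (m + 2)..<1}.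
      {x\<in>sphere 0 1. norm (f (of_real p * x) - f (of_real q * x)) \<le> 1 / real (Suc k)})" for k m
  have rad: "0 \<le> p" if "p \<in> {1 - 1 / real (m + 2)..<1}" for p :: real and m
    using that by (intro order_trans[OF inverse_Suc_radius(1)[of m]]) (simp only: atLeastLessThan_iff)
  have closed: "closed (C k m)" for k m
    unfolding C_def
  proof (intro closed_Int closed_INT ballI closed_sphere)
    fix p q assume pq: "p \<in> {1 - 1 / real (m + 2)..<1}" "q \<in> {1 - 1 / real (m + 2)..<1}"
    have "continuous_on (sphere 0 1) (\<lambda>x. norm (f (of_real p * x) - f (of_real q * x)))"
      by (intro continuous_intros radial_continuous(2)[OF f] rad[OF pq(1)] rad[OF pq(2)]) (use pq in auto)
    then show "closed {x \<in> sphere 0 1. norm (f (of_real p * x) - f (of_real q * x)) \<le> 1 / real (Suc k)}"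
      using continuous_closed_preimage[of "sphere 0 1" "\<lambda>x. norm (f (of_real p * x) - f (of_real q * x))" "{..1 / real (Suc k)}"]
      by (simp add: vimage_def Int_def)
  qed
  have CD: "norm (f (of_real p * x) - f (of_real q * x)) \<le> 1 / real (Suc k)"
    if "x \<in> C k m" "1 - 1 / real (m + 2) \<le> p" "p < 1" "1 - 1 / real (m + 2) \<le> q" "q < 1" for x k m p q
    using that unfolding C_def by auto
  define A where "A = (\<Inter>k. \<Union>m. C k m)"
  have A_sets: "A \<in> sets \<sigma>"
  proof -
    have "C k m \<in> sets \<sigma>" for k m
      using circle_borel_sets[OF borel_closed[OF closed], of k m] by (simp add: C_def Int_commute Int_left_commute)
    then show ?thesis unfolding A_def by auto
  qed
  define u where "u n x = f (of_real (1 - 1 / real (n + 2)) * x)" for n x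
  have conv_iff: "x \<in> A \<longleftrightarrow> (\<exists>l. ((\<lambda>r. f (of_real r * x)) \<longlongrightarrow> l) (at_left 1))" if x: "norm x = 1" for x
  proof
    assume xA: "x \<in> A"
    have ex: "\<exists>m. x \<in> C k m" for k using xA unfolding A_def by auto
    have mono: "1 - 1 / real (m + 2) \<le> 1 - 1 / real (n + 2)" if "m \<le> n" for m n :: nat
      using that by (simp add: frac_le)
    have "Cauchy (\<lambda>n. u n x)"
    proof (rule CauchyI)
      fix e :: real assume "0 < e"
      then obtain k where k: "1 / real (Suc k) < e" by (rule nat_approx_posE)
      obtain m where m: "x \<in> C k m" using ex by blast
      show "\<exists>M. \<forall>i\<ge>M. \<forall>j\<ge>M. norm (u i x - u j x) < e"
      proof (intro exI[of _ m] allI impI)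
        fix i j assume "m \<le> i" "m \<le> j"
        then have "norm (u i x - u j x) \<le> 1 / real (Suc k)"
          unfolding u_def by (intro CD[OF m] mono inverse_Suc_radius)
        then show "norm (u i x - u j x) < e" using k by (rule le_less_trans)
      qed
    qed
    then obtain l where l: "(\<lambda>n. u n x) \<longlonglongrightarrow> l" using Cauchy_convergent convergent_def by blast
    have "((\<lambda>r. f (of_real r * x)) \<longlongrightarrow> l) (at_left 1)"
    proof (rule tendstoI)
      fix e :: real assume "0 < e"
      then obtain k where k: "1 / real (Suc k) < e" by (rule nat_approx_posE)
      obtain m where m: "x \<in> C k m" using ex by blast
      from eventually_radius[OF inverse_Suc_radius, of m]
      show "\<forall>\<^sub>F r in at_left 1. dist (f (of_real r * x)) l < e"
      proof eventually_elim
        case (elim r)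
        have "norm (f (of_real r * x) - l) \<le> 1 / real (Suc k)"
        proof (rule LIMSEQ_le_const2)
          show "(\<lambda>n. norm (f (of_real r * x) - u n x)) \<longlonglongrightarrow> norm (f (of_real r * x) - l)"
            by (intro tendsto_intros l)
          show "\<exists>N. \<forall>n\<ge>N. norm (f (of_real r * x) - u n x) \<le> 1 / real (Suc k)"
            unfolding u_def
            by (rule exI[of _ m], intro allI impI CD[OF m] mono inverse_Suc_radius) (use elim in auto)
        qed
        then show ?case using k unfolding dist_norm by (rule le_less_trans)
      qed
    qed
    then show "\<exists>l. ((\<lambda>r. f (of_real r * x)) \<longlongrightarrow> l) (at_left 1)" by blast
  next
    assume "\<exists>l. ((\<lambda>r. f (of_real r * x)) \<longlongrightarrow> l) (at_left 1)"
    then obtain l where l: "((\<lambda>r. f (of_real r * x)) \<longlongrightarrow> l) (at_left 1)" by blast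
    have "\<exists>m. x \<in> C k m" for k
    proof -
      have "0 < 1 / real (Suc k) / 2" by simp
      from tendstoD[OF l this] obtain b where b: "b < 1"
        "\<And>r. b < r \<Longrightarrow> r < 1 \<Longrightarrow> dist (f (of_real r * x)) l < 1 / real (Suc k) / 2"
        unfolding eventually_at_left_field by blast
      obtain m where "1 / real (Suc m) < 1 - b" using b(1) nat_approx_posE[of "1 - b"] by auto
      moreover have "1 / real (m + 2) \<le> 1 / real (Suc m)" by (simp add: frac_le)
      ultimately have m: "b < 1 - 1 / real (m + 2)" by linarith
      have "norm (f (of_real p * x) - f (of_real q * x)) \<le> 1 / real (Suc k)"
        if "p \<in> {1 - 1 / real (m + 2)..<1}" "q \<in> {1 - 1 / real (m + 2)..<1}" for p q
      proof -
        have pq: "b < p" "p < 1" "b < q" "q < 1"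
          using that m unfolding atLeastLessThan_iff by linarith+
        have "dist (f (of_real p * x)) l < 1 / real (Suc k) / 2" "dist (f (of_real q * x)) l < 1 / real (Suc k) / 2"
          by (rule b(2)[OF pq(1,2)], rule b(2)[OF pq(3,4)])
        then have "dist (f (of_real p * x)) (f (of_real q * x)) < 1 / real (Suc k)" by (rule dist_triangle_half_l)
        then show ?thesis by (simp add: dist_norm)
      qed
      then have "x \<in> C k m" unfolding C_def using x by simp
      then show ?thesis by blast
    qed
    then show "x \<in> A" unfolding A_def by blast
  qed
  have um: "u n \<in> borel_measurable \<sigma>" for n
    unfolding u_def by (intro circle_measurable_continuous radial_continuous(2)[OF f] inverse_Suc_radius)
  have rlim: "filterlim (\<lambda>n. 1 - 1 / real (n + 2)) (at_left 1) sequentially"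
    by real_asymp
  \<comment> \<open>Off A no l satisfies the defining predicate of \<open>Lim\<close>, so it returns
    one and the same unspecified value \<open>THE l. False\<close>.\<close>
  have eq: "boundary_value f x = (if x \<in> A then lim (\<lambda>n. u n x) else (THE l. False))" if xs: "x \<in> space \<sigma>" for x
  proof (cases "x \<in> A")
    case True
    then obtain l where l: "((\<lambda>r. f (of_real r * x)) \<longlongrightarrow> l) (at_left 1)" using conv_iff[of x] xs by auto
    have "(\<lambda>n. u n x) \<longlonglongrightarrow> l" unfolding u_def by (rule filterlim_compose[OF l rlim])
    then have "lim (\<lambda>n. u n x) = l" by (rule limI)
    moreover have "boundary_value f x = l" unfolding boundary_value_def by (rule tendsto_Lim[OF _ l]) simp
    ultimately show ?thesis using True by simp
  next
    case False
    then have "((\<lambda>r. f (of_real r * x)) \<longlongrightarrow> l) (at_left 1) \<longleftrightarrow> False" for l using conv_iff[of x] xs by auto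
    then have "boundary_value f x = (THE l. False)" unfolding boundary_value_def Topological_Spaces.Lim_def by simp
    then show ?thesis using False by simp
  qed
  have m: "(\<lambda>x. if x \<in> A then lim (\<lambda>n. u n x) else (THE l. False)) \<in> borel_measurable \<sigma>"
  proof (rule measurable_If_set)
    show "(\<lambda>x. lim (\<lambda>n. u n x)) \<in> borel_measurable \<sigma>" by (rule borel_measurable_lim_metric[OF um])
    show "A \<inter> space \<sigma> \<in> sets \<sigma>" by (rule sets.Int[OF A_sets sets.top])
  qed simp
  show ?thesis by (rule measurable_cong[THEN iffD2, OF _ m]) (rule eq)
qed

lemma boundary_valueI:
  "((\<lambda>r. f (of_real r * x)) \<longlongrightarrow> l) (at_left 1) \<Longrightarrow> boundary_value f x = l"
  unfolding boundary_value_def by (rule tendsto_Lim) simp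

lemma hardy1_holomorphic: "f \<in> hardy1 \<Longrightarrow> f holomorphic_on ball 0 1"
  by (simp add: hardy1_def)

lemma hardy1_continuous: "f \<in> hardy1 \<Longrightarrow> continuous_on (ball 0 1) f"
  by (intro holomorphic_on_imp_continuous_on hardy1_holomorphic)

text \<open>Fatou's theorem identifies the density obtained in \<open>hardy1_poisson\<close> almost
  everywhere with the radial limits, so the representation holds with
  \<open>boundary_value f\<close> itself.\<close>

lemma hardy1_boundary:
  assumes f: "f \<in> hardy1"
  shows hardy1_radial_limit: "AE x in \<sigma>. ((\<lambda>r. f (of_real r * x)) \<longlongrightarrow> boundary_value f x) (at_left 1)"
    and hardy1_boundary_integrable: "integrable \<sigma> (boundary_value f)"
    and hardy1_poisson_boundary: "norm z < 1 \<Longrightarrow> f z = (\<integral>x. poisson z x *\<^sub>R boundary_value f x \<partial>\<sigma>)"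
proof -
  obtain g where g: "integrable \<sigma> g" "\<And>z. norm z < 1 \<Longrightarrow> f z = (\<integral>x. poisson z x *\<^sub>R g x \<partial>\<sigma>)"
    by (rule hardy1_poisson[OF f]) (rule that)
  have [measurable]: "boundary_value f \<in> borel_measurable \<sigma>" "g \<in> borel_measurable \<sigma>"
    using boundary_value_measurable[OF hardy1_continuous[OF f]] g(1) by auto
  have lim: "AE x in \<sigma>. ((\<lambda>r. f (of_real r * x)) \<longlongrightarrow> g x) (at_left 1)"
    using poisson_radial_limit[OF g(1)] AE_space
  proof eventually_elim
    case (elim x)
    show ?case
    proof (rule Lim_transform_eventually[OF elim(1)])
      show "\<forall>\<^sub>F r in at_left 1. (\<integral>y. poisson (of_real r * x) y *\<^sub>R g y \<partial>\<sigma>) = f (of_real r * x)"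
        using eventually_radius[of 0, simplified]
      proof eventually_elim
        case (elim r)
        then have "norm (of_real r * x) < 1" using \<open>x \<in> space \<sigma>\<close> by (simp add: norm_mult)
        then show ?case by (rule g(2)[symmetric])
      qed
    qed
  qed
  then have eq: "AE x in \<sigma>. g x = boundary_value f x"
    by eventually_elim (rule boundary_valueI[symmetric])
  show "AE x in \<sigma>. ((\<lambda>r. f (of_real r * x)) \<longlongrightarrow> boundary_value f x) (at_left 1)"
    using lim eq by eventually_elim simp
  show "integrable \<sigma> (boundary_value f)"
    by (rule integrable_cong_AE_imp[OF g(1) _ eq]) measurable
  show "f z = (\<integral>x. poisson z x *\<^sub>R boundary_value f x \<partial>\<sigma>)" if z: "norm z < 1"
    unfolding g(2)[OF z]
  proof (rule integral_cong_AE)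
    show "AE x in \<sigma>. poisson z x *\<^sub>R g x = poisson z x *\<^sub>R boundary_value f x"
      using eq by eventually_elim simp
  qed measurable
qed

lemma hardy1_norm_eqI:
  assumes f: "f \<in> hardy1" and v: "v \<in> borel_measurable \<sigma>" "AE x in \<sigma>. boundary_value f x = v x"
  shows "hardy1_norm f = (\<integral>x. norm (v x) \<partial>\<sigma>)"
  unfolding hardy1_norm_def
proof (rule integral_cong_AE)
  have [measurable]: "boundary_value f \<in> borel_measurable \<sigma>" using hardy1_boundary_integrable[OF f] by simp
  show "(\<lambda>x. norm (boundary_value f x)) \<in> borel_measurable \<sigma>" by measurable
  show "(\<lambda>x. norm (v x)) \<in> borel_measurable \<sigma>" using v(1) by measurable
  show "AE x in \<sigma>. norm (boundary_value f x) = norm (v x)" using v(2) by eventually_elim simp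
qed

lemma hardy1_eqI:
  assumes "f \<in> hardy1" "g \<in> hardy1" "AE x in \<sigma>. boundary_value f x = boundary_value g x" "norm z < 1"
  shows "f z = g z"
  unfolding hardy1_poisson_boundary[OF assms(1,4)] hardy1_poisson_boundary[OF assms(2,4)]
proof (rule integral_cong_AE)
  have [measurable]: "boundary_value f \<in> borel_measurable \<sigma>" "boundary_value g \<in> borel_measurable \<sigma>"
    using assms(1,2) hardy1_boundary_integrable by auto
  show "(\<lambda>x. poisson z x *\<^sub>R boundary_value f x) \<in> borel_measurable \<sigma>" by measurable
  show "(\<lambda>x. poisson z x *\<^sub>R boundary_value g x) \<in> borel_measurable \<sigma>" by measurable
  show "AE x in \<sigma>. poisson z x *\<^sub>R boundary_value f x = poisson z x *\<^sub>R boundary_value g x"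
    using assms(3) by eventually_elim simp
qed

lemma hardy1_norm_le_poisson:
  assumes f: "f \<in> hardy1" and v: "integrable \<sigma> v" "AE x in \<sigma>. norm (boundary_value f x) \<le> v x" and z: "norm z < 1"
  shows "norm (f z) \<le> (\<integral>x. poisson z x * v x \<partial>\<sigma>)"
proof -
  have "norm (f z) \<le> (\<integral>x. norm (poisson z x *\<^sub>R boundary_value f x) \<partial>\<sigma>)"
    unfolding hardy1_poisson_boundary[OF f z] by (rule integral_norm_bound)
  also have "\<dots> \<le> (\<integral>x. poisson z x * v x \<partial>\<sigma>)"
  proof (rule integral_mono_AE)
    show "integrable \<sigma> (\<lambda>x. norm (poisson z x *\<^sub>R boundary_value f x))"
      by (intro integrable_norm poisson_mult_integrable hardy1_boundary_integrable f z)
    show "integrable \<sigma> (\<lambda>x. poisson z x * v x)" using poisson_mult_integrable[OF v(1) z] by simp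
    show "AE x in \<sigma>. norm (poisson z x *\<^sub>R boundary_value f x) \<le> poisson z x * v x"
      using v(2) by eventually_elim (simp add: poisson_nonneg[OF z] mult_left_mono)
  qed
  finally show ?thesis .
qed

section \<open>Sums, multiples and norms in H^1\<close>

lemma hardy1_radial_integrable:
  assumes "continuous_on (ball 0 1) f" "0 \<le> r" "r < 1"
  shows "integrable \<sigma> (\<lambda>x. norm (f (of_real r * x)))"
  by (intro circle_integrable_continuous continuous_intros radial_continuous(2) assms)

lemma hardy1_add:
  assumes f: "f \<in> hardy1" and g: "g \<in> hardy1"
  shows "(\<lambda>z. f z + g z) \<in> hardy1"
    and "AE x in \<sigma>. boundary_value (\<lambda>z. f z + g z) x = boundary_value f x + boundary_value g x"
proof -
  obtain B where B: "\<forall>r. 0 \<le> r \<and> r < 1 \<longrightarrow> (\<integral>x. norm (f (of_real r * x)) \<partial>\<sigma>) \<le> B"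
    using f unfolding hardy1_def by blast
  obtain C where C: "\<forall>r. 0 \<le> r \<and> r < 1 \<longrightarrow> (\<integral>x. norm (g (of_real r * x)) \<partial>\<sigma>) \<le> C"
    using g unfolding hardy1_def by blast
  have "(\<integral>x. norm (f (of_real r * x) + g (of_real r * x)) \<partial>\<sigma>) \<le> B + C" if r: "0 \<le> r" "r < 1" for r
  proof -
    note c = hardy1_continuous[OF f] hardy1_continuous[OF g]
    have "(\<integral>x. norm (f (of_real r * x) + g (of_real r * x)) \<partial>\<sigma>) \<le> (\<integral>x. norm (f (of_real r * x)) + norm (g (of_real r * x)) \<partial>\<sigma>)"
      by (rule integral_mono)
        (intro hardy1_radial_integrable[OF continuous_on_add[OF c] r] Bochner_Integration.integrable_add
          hardy1_radial_integrable[OF c(1) r] hardy1_radial_integrable[OF c(2) r] norm_triangle_ineq)+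
    also have "\<dots> = (\<integral>x. norm (f (of_real r * x)) \<partial>\<sigma>) + (\<integral>x. norm (g (of_real r * x)) \<partial>\<sigma>)"
      by (rule Bochner_Integration.integral_add[OF hardy1_radial_integrable[OF c(1) r] hardy1_radial_integrable[OF c(2) r]])
    also have "\<dots> \<le> B + C" using B C r by (intro add_mono) blast+
    finally show ?thesis .
  qed
  moreover have "(\<lambda>z. f z + g z) holomorphic_on ball 0 1" by (intro holomorphic_intros hardy1_holomorphic f g)
  ultimately show "(\<lambda>z. f z + g z) \<in> hardy1" unfolding hardy1_def by blast
  show "AE x in \<sigma>. boundary_value (\<lambda>z. f z + g z) x = boundary_value f x + boundary_value g x"
    using hardy1_radial_limit[OF f] hardy1_radial_limit[OF g]
    by eventually_elim (intro boundary_valueI tendsto_add)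
qed

lemma hardy1_mult_bounded:
  assumes f: "f \<in> hardy1" and h: "h holomorphic_on ball 0 1" "\<And>z. norm z < 1 \<Longrightarrow> norm (h z) \<le> B"
  shows "(\<lambda>z. f z * h z) \<in> hardy1"
proof -
  obtain C where C: "\<forall>r. 0 \<le> r \<and> r < 1 \<longrightarrow> (\<integral>x. norm (f (of_real r * x)) \<partial>\<sigma>) \<le> C"
    using f unfolding hardy1_def by blast
  have "norm (h 0) \<le> B" using h(2)[of 0] by simp
  then have B: "0 \<le> B" using norm_ge_zero[of "h 0"] by (rule order_trans[rotated])
  have hol: "(\<lambda>z. f z * h z) holomorphic_on ball 0 1" by (intro holomorphic_intros hardy1_holomorphic f h)
  have "(\<integral>x. norm (f (of_real r * x) * h (of_real r * x)) \<partial>\<sigma>) \<le> B * C" if r: "0 \<le> r" "r < 1" for r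
  proof -
    have "(\<integral>x. norm (f (of_real r * x) * h (of_real r * x)) \<partial>\<sigma>) \<le> (\<integral>x. B * norm (f (of_real r * x)) \<partial>\<sigma>)"
    proof (rule integral_mono)
      show "integrable \<sigma> (\<lambda>x. norm (f (of_real r * x) * h (of_real r * x)))"
        by (rule hardy1_radial_integrable[OF holomorphic_on_imp_continuous_on[OF hol] r])
      show "integrable \<sigma> (\<lambda>x. B * norm (f (of_real r * x)))"
        by (intro integrable_mult_right hardy1_radial_integrable hardy1_continuous f r)
      fix x assume "x \<in> space \<sigma>"
      then have "norm (of_real r * x) < 1" using r by (simp add: norm_mult)
      from mult_left_mono[OF h(2)[OF this] norm_ge_zero[of "f (of_real r * x)"]]
      show "norm (f (of_real r * x) * h (of_real r * x)) \<le> B * norm (f (of_real r * x))"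
        by (simp add: norm_mult mult.commute)
    qed
    also have "\<dots> = B * (\<integral>x. norm (f (of_real r * x)) \<partial>\<sigma>)" by (rule integral_mult_right_zero)
    also have "\<dots> \<le> B * C" using B C r by (intro mult_left_mono) blast+
    finally show ?thesis .
  qed
  then show ?thesis using hol unfolding hardy1_def by blast
qed

lemma hardy1_const: "(\<lambda>_. c) \<in> hardy1"
  unfolding hardy1_def by (auto intro!: exI[of _ "norm c"])

lemma hardy1_boundedI:
  assumes h: "h holomorphic_on ball 0 1" "\<And>z. norm z < 1 \<Longrightarrow> norm (h z) \<le> B"
  shows "h \<in> hardy1"
  using hardy1_mult_bounded[OF hardy1_const[of 1] h] by simp

lemma boundary_value_continuous:
  fixes h :: "complex \<Rightarrow> complex"
  assumes h: "continuous_on (cball 0 1) h" and x: "norm x = 1"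
  shows "((\<lambda>r. h (of_real r * x)) \<longlongrightarrow> h x) (at_left 1)"
proof -
  have "continuous (at x within cball 0 1) h" using h x by (simp add: continuous_on_eq_continuous_within)
  then have "(h \<longlongrightarrow> h x) (at x within cball 0 1)" by (simp add: continuous_within)
  moreover have "filterlim (\<lambda>r. of_real r * x) (at x within cball 0 1) (at_left 1)"
    unfolding filterlim_at
  proof
    show "\<forall>\<^sub>F r in at_left 1. of_real r * x \<in> cball 0 1 \<and> of_real r * x \<noteq> x"
      using eventually_radius[of 0, simplified]
    proof eventually_elim
      case (elim r)
      then have "norm (of_real r * x) < 1" using x by (simp add: norm_mult)
      then show ?case using x by auto
    qed
    have "((\<lambda>r. of_real r * x) \<longlongrightarrow> of_real 1 * x) (at_left 1)" by (intro tendsto_intros)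
    then show "((\<lambda>r. of_real r * x) \<longlongrightarrow> x) (at_left 1)" by simp
  qed
  ultimately show ?thesis by (rule filterlim_compose)
qed

lemma hardy1_mult_continuous:
  assumes f: "f \<in> hardy1" and h: "h holomorphic_on ball 0 1" "continuous_on (cball 0 1) h"
  shows "(\<lambda>z. f z * h z) \<in> hardy1"
    and "AE x in \<sigma>. boundary_value (\<lambda>z. f z * h z) x = boundary_value f x * h x"
proof -
  have "bounded (h ` cball 0 1)" by (intro compact_imp_bounded compact_continuous_image h) auto
  then obtain B where B: "\<forall>x\<in>cball 0 1. norm (h x) \<le> B" unfolding bounded_iff by auto
  show "(\<lambda>z. f z * h z) \<in> hardy1" by (rule hardy1_mult_bounded[OF f h(1), of B]) (use B in auto)
  show "AE x in \<sigma>. boundary_value (\<lambda>z. f z * h z) x = boundary_value f x * h x"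
    using hardy1_radial_limit[OF f] AE_space
    by eventually_elim (intro boundary_valueI tendsto_mult boundary_value_continuous h, auto)
qed

lemma hardy1_cmult:
  assumes f: "f \<in> hardy1"
  shows "(\<lambda>z. c * f z) \<in> hardy1" "AE x in \<sigma>. boundary_value (\<lambda>z. c * f z) x = c * boundary_value f x"
    "hardy1_norm (\<lambda>z. c * f z) = norm c * hardy1_norm f"
proof -
  show 1: "(\<lambda>z. c * f z) \<in> hardy1" and 2: "AE x in \<sigma>. boundary_value (\<lambda>z. c * f z) x = c * boundary_value f x"
    using hardy1_mult_continuous[OF f, of "\<lambda>_. c"] by (simp_all add: mult.commute)
  have [measurable]: "boundary_value f \<in> borel_measurable \<sigma>" using hardy1_boundary_integrable[OF f] by simp
  show "hardy1_norm (\<lambda>z. c * f z) = norm c * hardy1_norm f"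
    unfolding hardy1_norm_eqI[OF 1 _ 2, simplified] hardy1_norm_def by (simp add: norm_mult)
qed

lemma hardy1_norm_add:
  assumes f: "f \<in> hardy1" and g: "g \<in> hardy1"
  shows "hardy1_norm (\<lambda>z. f z + g z) = (\<integral>x. norm (boundary_value f x + boundary_value g x) \<partial>\<sigma>)"
    and "hardy1_norm (\<lambda>z. f z + g z) \<le> hardy1_norm f + hardy1_norm g"
proof -
  note i = hardy1_boundary_integrable[OF f] hardy1_boundary_integrable[OF g]
  have [measurable]: "boundary_value f \<in> borel_measurable \<sigma>" "boundary_value g \<in> borel_measurable \<sigma>" using i by auto
  show 1: "hardy1_norm (\<lambda>z. f z + g z) = (\<integral>x. norm (boundary_value f x + boundary_value g x) \<partial>\<sigma>)"
    by (rule hardy1_norm_eqI[OF hardy1_add(1)[OF f g] _ hardy1_add(2)[OF f g]]) measurable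
  have "(\<integral>x. norm (boundary_value f x + boundary_value g x) \<partial>\<sigma>) \<le> (\<integral>x. norm (boundary_value f x) + norm (boundary_value g x) \<partial>\<sigma>)"
    using i by (intro integral_mono integrable_norm Bochner_Integration.integrable_add norm_triangle_ineq)
  also have "\<dots> = hardy1_norm f + hardy1_norm g"
    unfolding hardy1_norm_def using i by (intro Bochner_Integration.integral_add integrable_norm)
  finally show "hardy1_norm (\<lambda>z. f z + g z) \<le> hardy1_norm f + hardy1_norm g" by (simp only: 1)
qed

lemma hardy1_norm_nonneg: "0 \<le> hardy1_norm f"
  unfolding hardy1_norm_def by (rule Bochner_Integration.integral_nonneg) simp

section \<open>Outer functions\<close>

text \<open>\<open>outer_function\<close> with the boundary modulus exposed, so that it can be
  followed through products and inverses.\<close>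

definition outer_modulus :: "(complex \<Rightarrow> complex) \<Rightarrow> (complex \<Rightarrow> real) \<Rightarrow> bool" where
  "outer_modulus F \<phi> \<longleftrightarrow> \<phi> \<in> borel_measurable \<sigma> \<and> (\<forall>x. norm x = 1 \<longrightarrow> 0 < \<phi> x) \<and>
     integrable \<sigma> (\<lambda>x. ln (\<phi> x)) \<and>
     (\<exists>c. norm c = 1 \<and> (\<forall>z. norm z < 1 \<longrightarrow> F z = c * exp (herglotz (\<lambda>x. ln (\<phi> x)) z)))"

lemma outer_function_iff: "outer_function F \<longleftrightarrow> (\<exists>\<phi>. outer_modulus F \<phi>)"
  unfolding outer_function_def outer_modulus_def herglotz_def by (simp add: Ball_def) blast

lemma herglotz_add:
  assumes "integrable \<sigma> u" "integrable \<sigma> v" "norm z < 1"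
  shows "herglotz (\<lambda>x. u x + v x) z = herglotz u z + herglotz v z"
  unfolding herglotz_def
  by (simp only: of_real_add distrib_left
      Bochner_Integration.integral_add[OF herglotz_integrable herglotz_integrable, OF assms(1,3,2,3)])

lemma herglotz_cong:
  assumes "\<And>x. norm x = 1 \<Longrightarrow> u x = v x"
  shows "herglotz u z = herglotz v z"
  unfolding herglotz_def by (rule Bochner_Integration.integral_cong) (use assms in auto)

lemma herglotz_uminus: "herglotz (\<lambda>x. - u x) z = - herglotz u z"
  unfolding herglotz_def by simp

lemma outer_mult:
  assumes "outer_modulus F \<phi>" "outer_modulus G \<psi>"
  shows "outer_modulus (\<lambda>z. F z * G z) (\<lambda>x. \<phi> x * \<psi> x)"
proof -
  obtain c d where c: "norm c = 1" "\<forall>z. norm z < 1 \<longrightarrow> F z = c * exp (herglotz (\<lambda>x. ln (\<phi> x)) z)"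
    and d: "norm d = 1" "\<forall>z. norm z < 1 \<longrightarrow> G z = d * exp (herglotz (\<lambda>x. ln (\<psi> x)) z)"
    using assms unfolding outer_modulus_def by blast
  have m [measurable]: "\<phi> \<in> borel_measurable \<sigma>" "\<psi> \<in> borel_measurable \<sigma>"
    and pos: "\<forall>x. norm x = 1 \<longrightarrow> 0 < \<phi> x" "\<forall>x. norm x = 1 \<longrightarrow> 0 < \<psi> x"
    and i: "integrable \<sigma> (\<lambda>x. ln (\<phi> x))" "integrable \<sigma> (\<lambda>x. ln (\<psi> x))"
    using assms unfolding outer_modulus_def by blast+
  have ln: "ln (\<phi> x * \<psi> x) = ln (\<phi> x) + ln (\<psi> x)" if "norm x = 1" for x
  proof -
    have "0 < \<phi> x" "0 < \<psi> x" using pos that by simp_all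
    then show ?thesis by (simp add: ln_mult)
  qed
  have int: "integrable \<sigma> (\<lambda>x. ln (\<phi> x * \<psi> x))"
  proof -
    have "integrable \<sigma> (\<lambda>x. ln (\<phi> x) + ln (\<psi> x))" using i by simp
    moreover have "integrable \<sigma> (\<lambda>x. ln (\<phi> x * \<psi> x)) \<longleftrightarrow> integrable \<sigma> (\<lambda>x. ln (\<phi> x) + ln (\<psi> x))"
      by (rule Bochner_Integration.integrable_cong[OF refl]) (simp add: ln)
    ultimately show ?thesis by simp
  qed
  have "F z * G z = (c * d) * exp (herglotz (\<lambda>x. ln (\<phi> x * \<psi> x)) z)" if z: "norm z < 1" for z
  proof -
    have "herglotz (\<lambda>x. ln (\<phi> x * \<psi> x)) z = herglotz (\<lambda>x. ln (\<phi> x) + ln (\<psi> x)) z"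
      by (rule herglotz_cong) (rule ln)
    also have "\<dots> = herglotz (\<lambda>x. ln (\<phi> x)) z + herglotz (\<lambda>x. ln (\<psi> x)) z" by (rule herglotz_add[OF i z])
    finally show ?thesis using c d z by (simp add: exp_add)
  qed
  moreover have "norm (c * d) = 1" using c d by (simp add: norm_mult)
  ultimately show ?thesis unfolding outer_modulus_def using pos int m by (auto intro!: exI[of _ "c * d"])
qed

lemma outer_inverse:
  assumes "outer_modulus F \<phi>"
  shows "outer_modulus (\<lambda>z. inverse (F z)) (\<lambda>x. inverse (\<phi> x))"
proof -
  obtain c where c: "norm c = 1" "\<forall>z. norm z < 1 \<longrightarrow> F z = c * exp (herglotz (\<lambda>x. ln (\<phi> x)) z)"
    using assms unfolding outer_modulus_def by blast
  have m [measurable]: "\<phi> \<in> borel_measurable \<sigma>" and pos: "\<forall>x. norm x = 1 \<longrightarrow> 0 < \<phi> x"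
    and i: "integrable \<sigma> (\<lambda>x. ln (\<phi> x))"
    using assms unfolding outer_modulus_def by blast+
  have ln: "ln (inverse (\<phi> x)) = - ln (\<phi> x)" if "norm x = 1" for x using pos that by (simp add: ln_inverse)
  have int: "integrable \<sigma> (\<lambda>x. ln (inverse (\<phi> x)))"
  proof -
    have "integrable \<sigma> (\<lambda>x. - ln (\<phi> x))" using i by simp
    moreover have "integrable \<sigma> (\<lambda>x. ln (inverse (\<phi> x))) \<longleftrightarrow> integrable \<sigma> (\<lambda>x. - ln (\<phi> x))"
      by (rule Bochner_Integration.integrable_cong[OF refl]) (simp only: ln space_circle mem_sphere_0)
    ultimately show ?thesis by simp
  qed
  have "inverse (F z) = inverse c * exp (herglotz (\<lambda>x. ln (inverse (\<phi> x))) z)" if z: "norm z < 1" for z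
  proof -
    have "herglotz (\<lambda>x. ln (inverse (\<phi> x))) z = herglotz (\<lambda>x. - ln (\<phi> x)) z"
      by (rule herglotz_cong) (rule ln)
    then show ?thesis using c z by (simp add: herglotz_uminus exp_minus)
  qed
  moreover have "norm (inverse c) = 1" using c by (simp add: norm_inverse)
  ultimately show ?thesis unfolding outer_modulus_def using pos int m by (auto intro!: exI[of _ "inverse c"])
qed

text \<open>Re f is the mean of f and cnj f. The part with f is Cauchy's formula and gives 2 f z - f
  0. On the circle the conjugate of the kernel is holomorphic in x, so the part with cnj f is the
  conjugate of a mean value at 0.\<close>

lemma schwarz_formula:
  assumes f: "continuous_on (cball 0 1) f" "f holomorphic_on ball 0 1" and z: "norm z < 1"
  shows "herglotz (\<lambda>x. Re (f x)) z = f z - \<i> * Im (f 0)"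
proof -
  have cf: "continuous_on (sphere 0 1) f" by (rule continuous_on_subset[OF f(1)]) auto
  have ne: "x - z \<noteq> 0" "1 - cnj z * x \<noteq> 0" "x \<noteq> 0" if "norm x = 1" for x
    using that z one_minus_cnj_ne[OF z, of x] by auto
  have c1: "continuous_on (sphere 0 1) (\<lambda>x. (x + z) / (x - z) * f x)"
    and c2: "continuous_on (sphere 0 1) (\<lambda>x. (x + z) / (x - z) * cnj (f x))"
    and c3: "continuous_on (sphere 0 1) (\<lambda>x. x / (x - z) * f x)"
    using ne by (auto intro!: continuous_intros cf)
  have "(\<integral>x. (x + z) / (x - z) * f x \<partial>\<sigma>) = (\<integral>x. 2 * (x / (x - z) * f x) - f x \<partial>\<sigma>)"
  proof (rule Bochner_Integration.integral_cong[OF refl])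
    fix x assume "x \<in> space \<sigma>"
    then have "x - z \<noteq> 0" using ne by simp
    then show "(x + z) / (x - z) * f x = 2 * (x / (x - z) * f x) - f x"
      by (simp add: divide_simps) (simp add: algebra_simps)
  qed
  also have "\<dots> = 2 * (\<integral>x. x / (x - z) * f x \<partial>\<sigma>) - (\<integral>x. f x \<partial>\<sigma>)"
    using circle_integrable_continuous[OF c3] circle_integrable_continuous[OF cf]
    by (simp only: Bochner_Integration.integral_diff integrable_mult_right integral_mult_right_zero)
  also have "(\<integral>x. x / (x - z) * f x \<partial>\<sigma>) = f z" by (rule cauchy_circle[OF f]) (use z in simp)
  also have "(\<integral>x. f x \<partial>\<sigma>) = f 0" by (rule mean_value_circle[OF f])
  finally have 1: "(\<integral>x. (x + z) / (x - z) * f x \<partial>\<sigma>) = 2 * f z - f 0" .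
  have "(\<integral>x. (x + z) / (x - z) * cnj (f x) \<partial>\<sigma>) = (\<integral>x. cnj ((1 + cnj z * x) / (1 - cnj z * x) * f x) \<partial>\<sigma>)"
  proof (rule Bochner_Integration.integral_cong[OF refl])
    fix x assume "x \<in> space \<sigma>"
    then have x: "norm x = 1" by simp
    have "cnj ((1 + cnj z * x) / (1 - cnj z * x)) = (x + z) / (x - z)"
      using ne[OF x] by (simp add: cnj_eq_inverse[OF x] divide_simps)
    then show "(x + z) / (x - z) * cnj (f x) = cnj ((1 + cnj z * x) / (1 - cnj z * x) * f x)"
      by (simp only: complex_cnj_mult)
  qed
  also have "\<dots> = cnj (\<integral>x. (1 + cnj z * x) / (1 - cnj z * x) * f x \<partial>\<sigma>)" by (rule Bochner_Integration.integral_cnj)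
  also have "(\<integral>x. (1 + cnj z * x) / (1 - cnj z * x) * f x \<partial>\<sigma>) = (1 + cnj z * 0) / (1 - cnj z * 0) * f 0"
  proof (rule mean_value_circle)
    show "continuous_on (cball 0 1) (\<lambda>x. (1 + cnj z * x) / (1 - cnj z * x) * f x)"
      using one_minus_cnj_ne[OF z] by (intro continuous_intros f) auto
    show "(\<lambda>x. (1 + cnj z * x) / (1 - cnj z * x) * f x) holomorphic_on ball 0 1"
      using one_minus_cnj_ne[OF z] by (intro holomorphic_intros f) auto
  qed
  finally have 2: "(\<integral>x. (x + z) / (x - z) * cnj (f x) \<partial>\<sigma>) = cnj (f 0)" by simp
  have "herglotz (\<lambda>x. Re (f x)) z = (\<integral>x. ((x + z) / (x - z) * f x + (x + z) / (x - z) * cnj (f x)) / 2 \<partial>\<sigma>)"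
    unfolding herglotz_def
  proof (rule Bochner_Integration.integral_cong[OF refl])
    fix x
    have "complex_of_real (Re (f x)) = (f x + cnj (f x)) / 2" by (simp add: complex_add_cnj)
    then show "(x + z) / (x - z) * of_real (Re (f x)) = ((x + z) / (x - z) * f x + (x + z) / (x - z) * cnj (f x)) / 2"
      by (simp only: distrib_left times_divide_eq_right add_divide_distrib)
  qed
  also have "\<dots> = ((\<integral>x. (x + z) / (x - z) * f x \<partial>\<sigma>) + (\<integral>x. (x + z) / (x - z) * cnj (f x) \<partial>\<sigma>)) / 2"
    by (simp only: integral_divide_zero Bochner_Integration.integral_add[OF circle_integrable_continuous[OF c1] circle_integrable_continuous[OF c2]])
  also have "\<dots> = f z - (f 0 - cnj (f 0)) / 2" unfolding 1 2 by (simp add: field_simps)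
  also have "f 0 - cnj (f 0) = 2 * (\<i> * Im (f 0))" by (simp add: complex_diff_cnj)
  finally show ?thesis by simp
qed

lemma outer_const:
  assumes "c \<noteq> 0"
  shows "outer_modulus (\<lambda>_. c) (\<lambda>_. norm c)"
proof -
  have "herglotz (\<lambda>x. Re (of_real (ln (norm c)))) z = of_real (ln (norm c))" if "norm z < 1" for z
    using schwarz_formula[of "\<lambda>_. of_real (ln (norm c))" z] that by simp
  then have "c = c / of_real (norm c) * exp (herglotz (\<lambda>x. ln (norm c)) z)" if "norm z < 1" for z
    using assms that by (simp add: exp_of_real)
  moreover have "norm (c / of_real (norm c)) = 1" using assms by (simp add: norm_divide)
  ultimately have "\<exists>d. norm d = 1 \<and> (\<forall>z. norm z < 1 \<longrightarrow> c = d * exp (herglotz (\<lambda>x. ln (norm c)) z))" by blast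
  then show ?thesis unfolding outer_modulus_def using assms by simp
qed

lemma circle_singleton_null: "AE x in \<sigma>. x \<noteq> a"
proof (cases "norm a = 1")
  case True
  have s: "{a} \<in> sets \<sigma>" using circle_borel_sets[of "{a}"] True by (simp add: Int_absorb2)
  have "measure \<sigma> {a} \<le> 0 + e" if "e > 0" for e
  proof -
    have "measure \<sigma> {a} \<le> measure \<sigma> (ball a (e/2) \<inter> sphere 0 1)"
      by (rule circle.finite_measure_mono) (use True that in \<open>auto intro!: circle_borel_sets\<close>)
    also have "\<dots> \<le> 2 * (e/2)" by (rule measure_circle_ball) (use True that in auto)
    finally show ?thesis by simp
  qed
  then have "measure \<sigma> {a} \<le> 0" by (rule field_le_epsilon)
  then have "emeasure \<sigma> {a} = 0" by (simp add: circle.emeasure_eq_measure measure_le_0_iff)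
  then have "{a} \<in> null_sets \<sigma>" using s by (simp add: null_sets_def)
  from AE_not_in[OF this] show ?thesis by simp
qed (auto intro!: AE_I2)

lemma AE_linear_factor_nonzero: "AE x in \<sigma>. 1 - w * x \<noteq> 0"
  using circle_singleton_null[of "1 / w"]
proof eventually_elim
  case (elim x)
  show ?case
  proof
    assume "1 - w * x = 0"
    then have "w * x = 1" by simp
    then have "x = 1 / w" by (metis mult_zero_left nonzero_mult_div_cancel_left zero_neq_one)
    then show False using elim by simp
  qed
qed

text \<open>
  For \<open>\<bar>w\<bar> = 1\<close> the function \<open>ln \<bar>1 - w x\<bar>\<close> has a singularity on the circle. The formula is obtained
  as the limit \<open>s \<rightarrow> 1\<close> of the Schwarz formula for \<open>Ln (1 - s w z)\<close>; Fatou's lemma at \<open>z = 0\<close> gives the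
  integrable majorant.
\<close>

lemma outer_linear_factor:
  fixes w :: complex
  assumes w: "norm w \<le> 1"
  defines "\<phi> \<equiv> (\<lambda>x. if 1 - w * x = 0 then 1 else norm (1 - w * x))"
  shows "outer_modulus (\<lambda>z. 1 - w * z) \<phi>"
proof -
  define s where "s n = 1 - 1 / real (n + 2)" for n
  have s: "0 \<le> s n" "s n < 1" for n unfolding s_def by (rule inverse_Suc_radius)+
  have s_lim: "s \<longlonglongrightarrow> 1"
  proof -
    have "(\<lambda>n. 1 - 1 / real (n + 2)) \<longlonglongrightarrow> 1 - 0"
      by (intro tendsto_diff tendsto_const LIMSEQ_ignore_initial_segment[OF lim_1_over_n])
    then show ?thesis by (simp add: s_def[abs_def])
  qed
  define p where "p n x = norm (1 - of_real (s n) * w * x)" for n x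
  have [measurable]: "\<phi> \<in> borel_measurable \<sigma>" "p n \<in> borel_measurable \<sigma>" for n
    unfolding \<phi>_def p_def by measurable
  \<comment> \<open>The value 1 at a zero of 1 - w x keeps \<open>\<phi>\<close> positive on the
    whole circle, as \<open>outer_modulus\<close> demands; such a zero is at most one point and
    hence null.\<close>
  have \<phi>_pos: "\<phi> x > 0" for x by (simp add: \<phi>_def)
  have small: "norm (of_real (s n) * w * x) \<le> s n" if "norm x \<le> 1" for n x
  proof -
    have "norm (of_real (s n) * w * x) = s n * (norm w * norm x)" using s[of n] by (simp add: norm_mult)
    also have "\<dots> \<le> s n * (1 * 1)" using w that s[of n] by (intro mult_left_mono mult_mono) auto
    finally show ?thesis by simp
  qed
  have p_lower: "1 - s n \<le> p n x" if "norm x \<le> 1" for n x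
    using norm_triangle_ineq2[of 1 "of_real (s n) * w * x"] small[OF that, of n] by (simp add: p_def)
  have p_pos: "0 < p n x" if "norm x \<le> 1" for n x using p_lower[OF that, of n] s[of n] by linarith
  have p_le: "p n x \<le> 2" if "norm x \<le> 1" for n x
    using norm_triangle_ineq4[of 1 "of_real (s n) * w * x"] small[OF that, of n] s[of n] by (simp add: p_def)
  \<comment> \<open>The factor 2 is independent of n: passing from w to s w moves the value by at
    most 1 - s, which is itself at most p. Together with p \<le> 2 this bounds |ln p| by ln 2 + |ln
    \<phi>|, the majorant for the limit.\<close>
  have p_ge: "norm (1 - w * x) \<le> 2 * p n x" if x: "norm x \<le> 1" for n x
  proof -
    have "1 - w * x = (1 - of_real (s n) * w * x) - of_real (1 - s n) * (w * x)" by (simp add: algebra_simps)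
    also have "norm \<dots> \<le> p n x + norm (of_real (1 - s n) * (w * x))"
      unfolding p_def by (rule norm_triangle_ineq4)
    also have "norm (of_real (1 - s n) * (w * x)) = (1 - s n) * (norm w * norm x)"
      using s[of n] by (simp add: norm_mult del: of_real_diff)
    also have "\<dots> \<le> (1 - s n) * (1 * 1)" using w x s[of n] by (intro mult_left_mono mult_mono) auto
    finally show ?thesis using p_lower[OF x, of n] by simp
  qed
  have formula: "herglotz (\<lambda>x. ln (p n x)) z = Ln (1 - of_real (s n) * w * z)" if z: "norm z < 1" for n z
  proof -
    have nonpos: "1 - of_real (s n) * w * x \<notin> \<real>\<^sub>\<le>\<^sub>0" if "norm x \<le> 1" for x
    proof -
      have "Re (of_real (s n) * w * x) \<le> s n" using complex_Re_le_cmod small[OF that] by (rule order_trans)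
      then have "0 < Re (1 - of_real (s n) * w * x)" using s[of n] by simp
      then show ?thesis by (auto simp: complex_nonpos_Reals_iff)
    qed
    have "herglotz (\<lambda>x. Re (Ln (1 - of_real (s n) * w * x))) z
        = Ln (1 - of_real (s n) * w * z) - \<i> * Im (Ln (1 - of_real (s n) * w * 0))"
    proof (rule schwarz_formula[OF _ _ z])
      show "continuous_on (cball 0 1) (\<lambda>x. Ln (1 - of_real (s n) * w * x))"
        using nonpos by (intro continuous_intros) auto
      show "(\<lambda>x. Ln (1 - of_real (s n) * w * x)) holomorphic_on ball 0 1"
        using nonpos by (intro holomorphic_intros) auto
    qed
    moreover have "herglotz (\<lambda>x. Re (Ln (1 - of_real (s n) * w * x))) z = herglotz (\<lambda>x. ln (p n x)) z"
    proof (rule herglotz_cong)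
      fix x :: complex assume "norm x = 1"
      then have "1 - of_real (s n) * w * x \<noteq> 0" using nonpos[of x] by force
      then show "Re (Ln (1 - of_real (s n) * w * x)) = ln (p n x)" by (simp add: p_def)
    qed
    ultimately show ?thesis by simp
  qed
  have p_int: "integrable \<sigma> (\<lambda>x. ln (p n x))" for n
  proof (rule circle_integrable_continuous)
    show "continuous_on (sphere 0 1) (\<lambda>x. ln (p n x))"
      using p_pos[of _ n] unfolding p_def by (intro continuous_intros ballI less_imp_neq[symmetric]) auto
  qed
  have p_mean: "(\<integral>x. ln (p n x) \<partial>\<sigma>) = 0" for n
  proof -
    have "(\<integral>x. ln (p n x) \<partial>\<sigma>) = (\<integral>x. poisson 0 x * ln (p n x) \<partial>\<sigma>)"
      by (rule Bochner_Integration.integral_cong[OF refl]) (simp add: poisson_def)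
    also have "\<dots> = Re (herglotz (\<lambda>x. ln (p n x)) 0)" by (rule Re_herglotz[OF p_int, symmetric]) simp
    finally show ?thesis using formula[of 0 n] by simp
  qed
  have p_tendsto: "(\<lambda>n. ln (p n x)) \<longlonglongrightarrow> ln (\<phi> x)" if "1 - w * x \<noteq> 0" for x
  proof -
    have "(\<lambda>n. p n x) \<longlonglongrightarrow> norm (1 - of_real 1 * w * x)" unfolding p_def by (intro tendsto_intros s_lim)
    then show ?thesis using that by (intro tendsto_ln) (auto simp: \<phi>_def)
  qed
  have lb: "ln (\<phi> x) \<le> ln 2 + ln (p n x)" if "norm x = 1" "1 - w * x \<noteq> 0" for n x
  proof -
    have "\<phi> x \<le> 2 * p n x" using that p_ge[of x n] by (simp add: \<phi>_def)
    then have "ln (\<phi> x) \<le> ln (2 * p n x)" using \<phi>_pos[of x] by simp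
    also have "\<dots> = ln 2 + ln (p n x)" using p_pos[of x n] that by (simp add: ln_mult)
    finally show ?thesis .
  qed
  have ub: "ln (p n x) \<le> ln 2" if "norm x = 1" for n x using p_le[of x n] p_pos[of x n] that by simp
  have \<phi>_ub: "ln (\<phi> x) \<le> ln 2" if x: "norm x = 1" for x
  proof -
    have "norm w * norm x \<le> 1" using w x by simp
    then have "norm (1 - w * x) \<le> 2" using norm_triangle_ineq4[of 1 "w * x"] by (simp add: norm_mult)
    then have "\<phi> x \<le> 2" by (simp add: \<phi>_def)
    then show ?thesis using \<phi>_pos[of x] by simp
  qed
  have nonzero: "AE x in \<sigma>. 1 - w * x \<noteq> 0" by (rule AE_linear_factor_nonzero)
  have int: "integrable \<sigma> (\<lambda>x. ln 2 - ln (\<phi> x))"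
  proof (rule integrableI_nonneg)
    show "AE x in \<sigma>. 0 \<le> ln 2 - ln (\<phi> x)" by (rule AE_I2) (use \<phi>_ub in simp)
    have "(\<integral>\<^sup>+x. ennreal (ln 2 - ln (\<phi> x)) \<partial>\<sigma>) = (\<integral>\<^sup>+x. liminf (\<lambda>n. ennreal (ln 2 - ln (p n x))) \<partial>\<sigma>)"
    proof (rule nn_integral_cong_AE)
      show "AE x in \<sigma>. ennreal (ln 2 - ln (\<phi> x)) = liminf (\<lambda>n. ennreal (ln 2 - ln (p n x)))"
        using nonzero
      proof eventually_elim
        case (elim x)
        have "(\<lambda>n. ennreal (ln 2 - ln (p n x))) \<longlonglongrightarrow> ennreal (ln 2 - ln (\<phi> x))"
          by (intro tendsto_ennrealI tendsto_diff tendsto_const p_tendsto elim)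
        then show ?case by (intro lim_imp_Liminf[symmetric]) auto
      qed
    qed
    also have "\<dots> \<le> liminf (\<lambda>n. \<integral>\<^sup>+x. ennreal (ln 2 - ln (p n x)) \<partial>\<sigma>)"
      by (rule nn_integral_liminf) measurable
    also have "(\<lambda>n. \<integral>\<^sup>+x. ennreal (ln 2 - ln (p n x)) \<partial>\<sigma>) = (\<lambda>n. ennreal (ln 2))"
    proof
      fix n
      have "(\<integral>\<^sup>+x. ennreal (ln 2 - ln (p n x)) \<partial>\<sigma>) = ennreal (\<integral>x. ln 2 - ln (p n x) \<partial>\<sigma>)"
        by (rule nn_integral_eq_integral) (use p_int ub in \<open>auto intro!: AE_I2\<close>)
      then show "(\<integral>\<^sup>+x. ennreal (ln 2 - ln (p n x)) \<partial>\<sigma>) = ennreal (ln 2)" using p_int p_mean by simp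
    qed
    also have "liminf (\<lambda>n::nat. ennreal (ln 2)) = ennreal (ln 2)" by (simp add: Liminf_const)
    finally show "(\<integral>\<^sup>+x. ennreal (ln 2 - ln (\<phi> x)) \<partial>\<sigma>) < \<infinity>" by (simp add: le_less_trans)
  qed measurable
  have int\<phi>: "integrable \<sigma> (\<lambda>x. ln (\<phi> x))"
    using Bochner_Integration.integrable_diff[OF _ int, of "\<lambda>_. ln 2"] by simp
  have "1 - w * z = 1 * exp (herglotz (\<lambda>x. ln (\<phi> x)) z)" if z: "norm z < 1" for z
  proof -
    have wz: "1 - w * z \<noteq> 0"
    proof
      assume "1 - w * z = 0"
      then have "norm (w * z) = 1" by (metis eq_iff_diff_eq_0 norm_one)
      moreover have "norm (w * z) \<le> 1 * norm z" unfolding norm_mult using w by (intro mult_right_mono) auto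
      ultimately show False using z by simp
    qed
    let ?B = "2 / (1 - norm z)"
    have "(\<lambda>n. herglotz (\<lambda>x. ln (p n x)) z) \<longlonglongrightarrow> herglotz (\<lambda>x. ln (\<phi> x)) z"
      unfolding herglotz_def
    proof (rule integral_dominated_convergence[where w = "\<lambda>x. ?B * (ln 2 + \<bar>ln (\<phi> x)\<bar>)"])
      show "(\<lambda>x. (x + z) / (x - z) * complex_of_real (ln (\<phi> x))) \<in> borel_measurable \<sigma>" by measurable
      show "(\<lambda>x. (x + z) / (x - z) * complex_of_real (ln (p n x))) \<in> borel_measurable \<sigma>" for n by measurable
      show "integrable \<sigma> (\<lambda>x. ?B * (ln 2 + \<bar>ln (\<phi> x)\<bar>))" using int\<phi> by (intro integrable_mult_right) simp
      show "AE x in \<sigma>. (\<lambda>n. (x + z) / (x - z) * complex_of_real (ln (p n x))) \<longlonglongrightarrow> (x + z) / (x - z) * complex_of_real (ln (\<phi> x))"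
        using nonzero by eventually_elim (intro tendsto_mult tendsto_const tendsto_of_real p_tendsto)
      show "AE x in \<sigma>. norm ((x + z) / (x - z) * complex_of_real (ln (p n x))) \<le> ?B * (ln 2 + \<bar>ln (\<phi> x)\<bar>)" for n
        using nonzero AE_space
      proof eventually_elim
        case (elim x)
        then have x: "norm x = 1" by simp
        have "\<bar>ln (p n x)\<bar> \<le> ln 2 + \<bar>ln (\<phi> x)\<bar>"
          using lb[OF x elim(1), of n] ub[OF x, of n] by linarith
        then show ?case unfolding norm_mult
          using herglotz_kernel_le[OF x z] z by (intro mult_mono) auto
      qed
    qed
    moreover have "(\<lambda>n. 1 - of_real (s n) * w * z) \<longlonglongrightarrow> 1 - of_real 1 * w * z" by (intro tendsto_intros s_lim)
    moreover have "exp (herglotz (\<lambda>x. ln (p n x)) z) = 1 - of_real (s n) * w * z" for n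
    proof -
      have "1 - of_real (s n) * w * z \<noteq> 0" using p_pos[of z n] z by (auto simp: p_def)
      then show ?thesis unfolding formula[OF z] by (rule exp_Ln)
    qed
    ultimately have "(\<lambda>n. 1 - of_real (s n) * w * z) \<longlonglongrightarrow> exp (herglotz (\<lambda>x. ln (\<phi> x)) z)"
      "(\<lambda>n. 1 - of_real (s n) * w * z) \<longlonglongrightarrow> 1 - w * z"
      using tendsto_exp by fastforce+
    then show ?thesis using LIMSEQ_unique by fastforce
  qed
  then show ?thesis unfolding outer_modulus_def using \<phi>_pos int\<phi> by (auto intro!: exI[of _ 1])
qed

lemma outer_modulus_cong:
  assumes "outer_modulus F \<phi>" "\<And>z. norm z < 1 \<Longrightarrow> F z = G z"
  shows "outer_modulus G \<phi>"
  using assms unfolding outer_modulus_def by simp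

lemma outer_prod:
  assumes "finite I" "\<And>i. i \<in> I \<Longrightarrow> \<exists>\<phi>. outer_modulus (F i) \<phi>"
  shows "\<exists>\<phi>. outer_modulus (\<lambda>z. \<Prod>i\<in>I. F i z) \<phi>"
  using assms
proof (induction I)
  case empty
  then show ?case using outer_const[of 1] by auto
next
  case (insert i I)
  then obtain \<phi> \<psi> where "outer_modulus (F i) \<phi>" "outer_modulus (\<lambda>z. \<Prod>i\<in>I. F i z) \<psi>" by blast
  from outer_mult[OF this] insert(1,2) show ?case by auto
qed

text \<open>In the disc |F| is the exponential of the Poisson integral of ln \<phi>, and Fatou's
  theorem gives its radial limits.\<close>

lemma outer_boundary:
  assumes F: "outer_modulus F \<phi>" and h: "F \<in> hardy1"
  shows "AE x in \<sigma>. norm (boundary_value F x) = \<phi> x"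
proof -
  obtain c where c: "norm c = 1" "\<forall>z. norm z < 1 \<longrightarrow> F z = c * exp (herglotz (\<lambda>x. ln (\<phi> x)) z)"
    using F unfolding outer_modulus_def by blast
  have pos: "\<forall>x. norm x = 1 \<longrightarrow> 0 < \<phi> x" and i: "integrable \<sigma> (\<lambda>x. ln (\<phi> x))"
    using F unfolding outer_modulus_def by blast+
  from hardy1_radial_limit[OF h] poisson_radial_limit[OF i] AE_space show ?thesis
  proof eventually_elim
    case (elim x)
    then have x: "norm x = 1" by simp
    have "((\<lambda>r. exp (\<integral>y. poisson (of_real r * x) y *\<^sub>R ln (\<phi> y) \<partial>\<sigma>)) \<longlongrightarrow> exp (ln (\<phi> x))) (at_left 1)"
      by (intro tendsto_intros elim(2))
    then have "((\<lambda>r. norm (F (of_real r * x))) \<longlongrightarrow> exp (ln (\<phi> x))) (at_left 1)"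
    proof (rule Lim_transform_eventually)
      show "\<forall>\<^sub>F r in at_left 1. exp (\<integral>y. poisson (of_real r * x) y *\<^sub>R ln (\<phi> y) \<partial>\<sigma>) = norm (F (of_real r * x))"
        using eventually_radius[of 0, simplified]
      proof eventually_elim
        case (elim r)
        then have n: "norm (of_real r * x) < 1" using x by (simp add: norm_mult)
        have "norm (F (of_real r * x)) = norm (exp (herglotz (\<lambda>x. ln (\<phi> x)) (of_real r * x)))"
          using c n by (simp add: norm_mult)
        then show ?case unfolding norm_exp_herglotz[OF i n] by simp
      qed
    qed
    moreover have "((\<lambda>r. norm (F (of_real r * x))) \<longlongrightarrow> norm (boundary_value F x)) (at_left 1)"
      by (intro tendsto_intros elim(1))
    ultimately have "norm (boundary_value F x) = exp (ln (\<phi> x))"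
      by (intro tendsto_unique[OF trivial_limit_at_left_real])
    then show ?case using pos x by simp
  qed
qed

lemma outer_unique:
  assumes F: "outer_modulus F \<phi>" and G: "outer_modulus G \<psi>" and eq: "AE x in \<sigma>. \<phi> x = \<psi> x"
  shows "\<exists>c. norm c = 1 \<and> (\<forall>z. norm z < 1 \<longrightarrow> F z = c * G z)"
proof -
  obtain c d where c: "norm c = 1" "\<forall>z. norm z < 1 \<longrightarrow> F z = c * exp (herglotz (\<lambda>x. ln (\<phi> x)) z)"
    and d: "norm d = 1" "\<forall>z. norm z < 1 \<longrightarrow> G z = d * exp (herglotz (\<lambda>x. ln (\<psi> x)) z)"
    using F G unfolding outer_modulus_def by blast
  have [measurable]: "\<phi> \<in> borel_measurable \<sigma>" "\<psi> \<in> borel_measurable \<sigma>"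
    using F G unfolding outer_modulus_def by blast+
  have "herglotz (\<lambda>x. ln (\<phi> x)) z = herglotz (\<lambda>x. ln (\<psi> x)) z" for z
    unfolding herglotz_def
  proof (rule integral_cong_AE)
    show "(\<lambda>x. (x + z) / (x - z) * of_real (ln (\<phi> x))) \<in> borel_measurable \<sigma>" by measurable
    show "(\<lambda>x. (x + z) / (x - z) * of_real (ln (\<psi> x))) \<in> borel_measurable \<sigma>" by measurable
    show "AE x in \<sigma>. (x + z) / (x - z) * complex_of_real (ln (\<phi> x)) = (x + z) / (x - z) * of_real (ln (\<psi> x))"
      using eq by eventually_elim simp
  qed
  moreover have "d \<noteq> 0" using d(1) by auto
  ultimately have "F z = (c / d) * G z" if "norm z < 1" for z using c d that by simp
  moreover have "norm (c / d) = 1" using c d by (simp add: norm_divide)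
  ultimately show ?thesis by blast
qed

section \<open>Polynomials without zeros in the open disc\<close>

lemma zero_free_poly_factor:
  fixes q :: "complex poly"
  assumes q: "\<And>z. norm z < 1 \<Longrightarrow> poly q z \<noteq> 0" and d: "degree q \<noteq> 0"
  obtains a r where "q = [:- a, 1:] * r" "1 \<le> norm a" "degree q = Suc (degree r)" "\<And>z. norm z < 1 \<Longrightarrow> poly r z \<noteq> 0"
proof -
  obtain a where a: "poly q a = 0"
    using fundamental_theorem_of_algebra[of q] d constant_degree[of q] by auto
  then obtain r where r: "q = [:- a, 1:] * r" by (auto simp: poly_eq_0_iff_dvd)
  have "q \<noteq> 0" using d by auto
  then have "r \<noteq> 0" using r by auto
  then have "degree q = Suc (degree r)" unfolding r by (subst degree_mult_eq) auto
  moreover have "1 \<le> norm a" using q[of a] a by (rule_tac ccontr) simp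
  moreover have "poly r z \<noteq> 0" if "norm z < 1" for z using q[OF that] r by auto
  ultimately show thesis using r that by blast
qed

text \<open>Each root a has |a| \<ge> 1, and z - a = - a (1 - z / a) is a constant times a linear
  factor covered by \<open>outer_linear_factor\<close>, including roots on the circle.\<close>

lemma outer_poly:
  fixes q :: "complex poly"
  assumes "\<And>z. norm z < 1 \<Longrightarrow> poly q z \<noteq> 0"
  shows "\<exists>\<phi>. outer_modulus (poly q) \<phi>"
  using assms
proof (induction "degree q" arbitrary: q rule: less_induct)
  case less
  show ?case
  proof (cases "degree q = 0")
    case True
    then obtain c where c: "q = [:c:]" by (rule degree_eq_zeroE)
    then have "c \<noteq> 0" using less.prems[of 0] by simp
    from outer_const[OF this] have "outer_modulus (poly q) (\<lambda>_. norm c)"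
      by (rule outer_modulus_cong) (simp add: c)
    then show ?thesis by blast
  next
    case False
    obtain a r where r: "q = [:- a, 1:] * r" "1 \<le> norm a" "degree q = Suc (degree r)"
      "\<And>z. norm z < 1 \<Longrightarrow> poly r z \<noteq> 0"
      by (rule zero_free_poly_factor[OF less.prems False]) (assumption | rule that)+
    have a0: "a \<noteq> 0" using r(2) by auto
    obtain \<phi> where \<phi>: "outer_modulus (poly r) \<phi>" using less.hyps[of r] r(3,4) by auto
    have "norm (1 / a) \<le> 1" using r(2) a0 by (simp add: norm_divide divide_le_eq)
    from outer_mult[OF outer_mult[OF outer_const[of "- a"] outer_linear_factor[OF this]] \<phi>] a0
    obtain \<psi> where "outer_modulus (\<lambda>z. - a * (1 - 1 / a * z) * poly r z) \<psi>" by auto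
    then have "outer_modulus (poly q) \<psi>"
      by (rule outer_modulus_cong) (use a0 in \<open>simp add: r(1) field_simps\<close>)
    then show ?thesis by blast
  qed
qed

text \<open>Each root costs a factor 2: moving x to s x changes x - a by 1 - s, and a point of
  modulus s is at least 1 - s away from a root with |a| \<ge> 1.\<close>

lemma zero_free_poly_dilation:
  fixes q :: "complex poly"
  assumes "\<And>z. norm z < 1 \<Longrightarrow> poly q z \<noteq> 0" and x: "norm x = 1" and s: "0 \<le> s" "s \<le> 1"
  shows "norm (poly q x) \<le> 2 ^ degree q * norm (poly q (of_real s * x))"
  using assms(1)
proof (induction "degree q" arbitrary: q rule: less_induct)
  case less
  show ?case
  proof (cases "degree q = 0")
    case True
    then obtain c where c: "q = [:c:]" by (rule degree_eq_zeroE)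
    then show ?thesis by simp
  next
    case False
    obtain a r where r: "q = [:- a, 1:] * r" "1 \<le> norm a" "degree q = Suc (degree r)"
      "\<And>z. norm z < 1 \<Longrightarrow> poly r z \<noteq> 0"
      by (rule zero_free_poly_factor[OF less.prems False]) (assumption | rule that)+
    have IH: "norm (poly r x) \<le> 2 ^ degree r * norm (poly r (of_real s * x))"
      using less.hyps[of r] r(3,4) by auto
    have "norm (x - a) \<le> norm (of_real s * x - a) + norm (x - of_real s * x)"
      using norm_triangle_ineq[of "of_real s * x - a" "x - of_real s * x"] by simp
    also have "x - of_real s * x = of_real (1 - s) * x" by (simp add: algebra_simps)
    also have "norm \<dots> = 1 - s" using x s by (simp add: norm_mult del: of_real_diff)
    also have "1 - s \<le> norm (of_real s * x - a)"
      using norm_triangle_ineq2[of a "of_real s * x"] r(2) x s by (simp add: norm_mult norm_minus_commute)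
    finally have "norm (x - a) \<le> 2 * norm (of_real s * x - a)" by simp
    from mult_mono[OF this IH]
    have "norm (x - a) * norm (poly r x) \<le> 2 * norm (of_real s * x - a) * (2 ^ degree r * norm (poly r (of_real s * x)))"
      by simp
    moreover have "poly q y = (y - a) * poly r y" for y unfolding r(1) by (simp add: algebra_simps)
    ultimately show ?thesis unfolding r(3) by (simp only: norm_mult power_Suc mult_ac)
  qed
qed

section \<open>The Fejer-Riesz theorem\<close>

lemma poly_eq_on_circle:
  fixes p q :: "complex poly"
  assumes "\<And>x. norm x = 1 \<Longrightarrow> poly p x = poly q x"
  shows "p = q"
proof (rule ccontr)
  assume "p \<noteq> q"
  then have "finite {x. poly (p - q) x = 0}" by (intro poly_roots_finite) simp
  moreover have "sphere 0 1 \<subseteq> {x. poly (p - q) x = 0}" using assms by auto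
  ultimately have "finite (sphere (0::complex) 1)" by (rule finite_subset[rotated])
  then have "finite (cis ` {0..1::real})" by (rule finite_subset[rotated]) auto
  moreover have "inj_on cis {0..1::real}"
  proof (rule inj_onI)
    fix a b :: real assume ab: "a \<in> {0..1}" "b \<in> {0..1}" "cis a = cis b"
    then have "sin a = sin b" by (metis cis.sel(2))
    moreover have "-(pi/2) \<le> a" "a \<le> pi/2" "-(pi/2) \<le> b" "b \<le> pi/2" using ab pi_gt3 by auto
    ultimately show "a = b" using sin_inj_pi by blast
  qed
  ultimately have "finite {0..1::real}" by (rule finite_imageD)
  then show False by (simp add: infinite_Icc)
qed

text \<open>The reversed polynomial with conjugated coefficients. The formal degree m replaces
  \<open>degree p\<close> so that a drop of the degree appears as a zero of the reflection at
  0.\<close>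

definition conj_reflect :: "nat \<Rightarrow> complex poly \<Rightarrow> complex poly" where
  "conj_reflect m p = (\<Sum>i\<le>m. monom (cnj (coeff p i)) (m - i))"

lemma poly_conj_reflect:
  assumes "degree p \<le> m" "z \<noteq> 0"
  shows "poly (conj_reflect m p) z = z ^ m * cnj (poly p (1 / cnj z))"
proof -
  have "poly p (1 / cnj z) = (\<Sum>i\<le>m. coeff p i * (1 / cnj z) ^ i)"
    unfolding poly_altdef using assms(1) by (intro sum.mono_neutral_left) (auto simp: coeff_eq_0)
  then have "z ^ m * cnj (poly p (1 / cnj z)) = (\<Sum>i\<le>m. z ^ m * (cnj (coeff p i) * (1 / z) ^ i))"
    by (simp add: sum_distrib_left)
  also have "\<dots> = (\<Sum>i\<le>m. cnj (coeff p i) * z ^ (m - i))"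
  proof (rule sum.cong)
    fix i assume "i \<in> {..m}"
    then have "z ^ m = z ^ (m - i) * z ^ i" by (simp flip: power_add)
    then show "z ^ m * (cnj (coeff p i) * (1 / z) ^ i) = cnj (coeff p i) * z ^ (m - i)"
      using assms(2) by (simp add: power_divide)
  qed simp
  finally show ?thesis by (simp add: conj_reflect_def poly_sum poly_monom)
qed

lemma coeff_conj_reflect_0: "coeff (conj_reflect m p) m = cnj (coeff p 0)"
proof -
  have "coeff (conj_reflect m p) m = (\<Sum>i\<le>m. if i = 0 then cnj (coeff p 0) else 0)"
    unfolding conj_reflect_def coeff_sum coeff_monom by (rule sum.cong) auto
  then show ?thesis by simp
qed

text \<open>\<open>p x = x\<^sup>N t\<close> with \<open>t \<ge> 0\<close> on the circle, that is, \<open>x\<^sup>-\<^sup>N p x\<close> is a nonnegative trigonometric polynomial.\<close>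

definition circle_nonneg :: "nat \<Rightarrow> complex poly \<Rightarrow> bool" where
  "circle_nonneg N p \<longleftrightarrow> degree p \<le> 2 * N \<and> (\<forall>x. norm x = 1 \<longrightarrow> poly p x * cnj x ^ N \<in> \<real>\<^sub>\<ge>\<^sub>0)"

lemma circle_mult_cnj: "norm x = 1 \<Longrightarrow> x * cnj x = 1"
  by (simp add: complex_norm_square[symmetric])

lemma circle_power_mult_cnj: "norm x = 1 \<Longrightarrow> x ^ n * cnj x ^ n = 1"
  by (simp add: circle_mult_cnj flip: power_mult_distrib)

lemma circle_nonnegD:
  assumes "circle_nonneg N p" "norm x = 1"
  obtains t where "0 \<le> t" "poly p x * cnj x ^ N = of_real t" "poly p x = x ^ N * of_real t"
proof -
  obtain t where t: "0 \<le> t" "poly p x * cnj x ^ N = of_real t"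
    using assms unfolding circle_nonneg_def nonneg_Reals_def by blast
  have "poly p x = x ^ N * (poly p x * cnj x ^ N)"
    using circle_power_mult_cnj[OF assms(2), of N] by (simp add: mult.left_commute)
  then show thesis using t that by simp
qed

text \<open>Because t is real, p agrees with its reflection on the circle. Consequently roots other
  than 0 occur in pairs a and 1 / cnj a, and the extreme coefficients are conjugate to each
  other.\<close>

lemma circle_nonneg_reflect:
  assumes "circle_nonneg N p"
  shows "conj_reflect (2 * N) p = p"
proof (rule poly_eq_on_circle)
  fix x :: complex assume x: "norm x = 1"
  then have x0: "x \<noteq> 0" by auto
  have c: "1 / cnj x = x" using cnj_eq_inverse[OF x] x0 by simp
  obtain t where t: "poly p x = x ^ N * of_real t" by (rule circle_nonnegD[OF assms x])
  have "poly (conj_reflect (2 * N) p) x = x ^ (2 * N) * cnj (poly p x)"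
    using poly_conj_reflect[OF _ x0, of p "2 * N"] assms unfolding circle_nonneg_def c by simp
  also have "\<dots> = x ^ N * (x ^ N * cnj x ^ N) * of_real t" by (simp add: t mult_2 power_add)
  finally show "poly (conj_reflect (2 * N) p) x = poly p x"
    by (simp add: circle_power_mult_cnj[OF x] t)
qed

text \<open>Along the circle p x / x^N is a real nonnegative function of the angle, so a zero is a
  minimum and its derivative vanishes there; the chain rule transfers this to p.\<close>

lemma circle_nonneg_double_root:
  assumes p: "circle_nonneg N p" and a: "norm a = 1" "poly p a = 0"
  shows "poly (pderiv p) a = 0"
proof -
  have a0: "a \<noteq> 0" using a by auto
  define H where "H z = poly p z / z ^ N" for z
  define G where "G = H \<circ> (\<lambda>t. a * cis t)"
  have "(H has_field_derivative (poly (pderiv p) a * a ^ N - poly p a * (of_nat N * a ^ (N - 1) * 1)) / (a ^ N * a ^ N)) (at a)"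
    unfolding H_def using a0 by (intro DERIV_divide poly_DERIV DERIV_power[THEN DERIV_cong] DERIV_ident) auto
  then have "(H has_field_derivative poly (pderiv p) a / a ^ N) (at (a * cis 0))" using a a0 by simp
  moreover have "((\<lambda>t. a * cis t) has_vector_derivative a * (\<i> * cis 0)) (at 0)"
  proof -
    have "((\<lambda>z. a * exp (\<i> * z)) has_field_derivative a * (exp (\<i> * of_real 0) * \<i>)) (at (of_real 0))"
      by (auto intro!: derivative_eq_intros)
    from has_vector_derivative_real_field[OF this] show ?thesis by (simp add: cis_conv_exp)
  qed
  ultimately have "(G has_vector_derivative (a * (\<i> * cis 0)) * (poly (pderiv p) a / a ^ N)) (at 0)"
    unfolding G_def by (intro field_vector_diff_chain_at)
  then have G: "(G has_vector_derivative (a * \<i> * (poly (pderiv p) a / a ^ N))) (at 0)" (is "(_ has_vector_derivative ?D) _")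
    by simp
  have Gt: "\<exists>t\<ge>0. G \<theta> = of_real t" for \<theta>
  proof -
    have n: "norm (a * cis \<theta>) = 1" using a by (simp add: norm_mult)
    obtain t where t: "0 \<le> t" "poly p (a * cis \<theta>) = (a * cis \<theta>) ^ N * of_real t" by (rule circle_nonnegD[OF p n])
    then show ?thesis using a0 by (auto simp: G_def H_def)
  qed
  have G0: "G 0 = 0" using a by (simp add: G_def H_def)
  have d: "(Re \<circ> G has_real_derivative Re ?D) (at 0)" "(Im \<circ> G has_real_derivative Im ?D) (at 0)"
    unfolding has_real_derivative_iff_has_vector_derivative o_def
    by (rule bounded_linear.has_vector_derivative[OF bounded_linear_Re G]
          bounded_linear.has_vector_derivative[OF bounded_linear_Im G])+
  \<comment> \<open>The imaginary part vanishes identically along the circle, so 0 is trivially a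
    minimum of it too, and both parts are treated alike.\<close>
  have min: "(Re \<circ> G) 0 \<le> (Re \<circ> G) y" "(Im \<circ> G) 0 \<le> (Im \<circ> G) y" for y
    using Gt[of y] G0 by auto
  have "Re ?D = 0" by (rule DERIV_local_min[OF d(1) zero_less_one]) (use min in blast)
  moreover have "Im ?D = 0" by (rule DERIV_local_min[OF d(2) zero_less_one]) (use min in blast)
  ultimately have "?D = 0" by (simp only: complex_eq_iff zero_complex.sel)
  then show ?thesis using a0 by simp
qed

lemma circle_islimpt:
  assumes a: "norm a = 1"
  shows "a islimpt (sphere 0 1 :: complex set)"
proof (rule connected_imp_perfect)
  show "connected (sphere (0::complex) 1)" by (rule connected_sphere) simp
  show "a \<in> sphere 0 1" using a by simp
  show "sphere 0 1 \<noteq> {x}" for x :: complex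
  proof
    assume "sphere 0 1 = {x}"
    moreover have "1 \<in> sphere (0::complex) 1" "- 1 \<in> sphere (0::complex) 1" by auto
    ultimately have "1 = x" "- 1 = x" by auto
    then show False by simp
  qed
qed

text \<open>A root a in the closed disc is split off together with its mirror image 1 / cnj a. The
  factor \<open>[:1, - cnj a:]\<close> is used instead of a monic one because it still makes sense
  for a = 0, whose mirror image is at infinity.\<close>

lemma circle_nonneg_factor:
  assumes p: "circle_nonneg (Suc N) p" and p0: "p \<noteq> 0"
  obtains a r where "norm a \<le> 1" "p = [:- a, 1:] * [:1, - cnj a:] * r" "r \<noteq> 0" "circle_nonneg N r"
proof -
  have deg: "degree p \<le> 2 * Suc N" using p by (simp add: circle_nonneg_def)
  note refl = circle_nonneg_reflect[OF p]
  have lead: "coeff p (2 * Suc N) = cnj (coeff p 0)" using coeff_conj_reflect_0[of "2 * Suc N" p] unfolding refl .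
  have "\<not> constant (poly p)"
  proof
    assume "constant (poly p)"
    then have d: "degree p = 0" by (simp add: constant_degree)
    then have "coeff p (2 * Suc N) = 0" by (simp add: coeff_eq_0)
    then have "coeff p 0 = 0" using lead by simp
    then show False using d p0 by (metis degree_0_id lead_coeff_of_int leading_coeff_0_iff)
  qed
  then obtain b where b: "poly p b = 0" using fundamental_theorem_of_algebra by blast
  \<comment> \<open>A root outside the closed disc is reflected into it.\<close>
  have "\<exists>a. norm a \<le> 1 \<and> poly p a = 0"
  proof (cases "norm b \<le> 1")
    case False
    then have b0: "b \<noteq> 0" by auto
    have "poly p (1 / cnj b) = poly (conj_reflect (2 * Suc N) p) (1 / cnj b)" by (simp only: refl)
    also have "\<dots> = 0" using b0 b by (subst poly_conj_reflect[OF deg]) auto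
    finally have "poly p (1 / cnj b) = 0" .
    moreover have "norm (1 / cnj b) \<le> 1" using False b0 by (simp add: norm_divide divide_le_eq)
    ultimately show ?thesis by blast
  qed (use b in blast)
  then obtain a where a: "norm a \<le> 1" "poly p a = 0" by blast
  then obtain r where r: "p = [:- a, 1:] * r" by (auto simp: poly_eq_0_iff_dvd)
  have r0: "r \<noteq> 0" using r p0 by auto
  have dr: "degree p = Suc (degree r)" unfolding r using r0 by (subst degree_mult_eq) auto
  \<comment> \<open>For a = 0 the second factor is 1, and the degree drops by two because the
    coefficient at 2 (N + 1) is conjugate to the vanishing constant one. Otherwise the mirror root b
    has to be found in r.\<close>
  have "\<exists>r'. r = [:1, - cnj a:] * r' \<and> degree r' \<le> 2 * N"
  proof (cases "a = 0")
    case True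
    then have "coeff p 0 = 0" using a by (simp add: poly_0_coeff_0)
    then have "coeff p (2 * Suc N) = 0" using lead by simp
    then have "degree p \<noteq> 2 * Suc N" using p0 leading_coeff_0_iff by metis
    then have "degree r \<le> 2 * N" using deg dr by simp
    then show ?thesis using True by (intro exI[of _ r]) simp
  next
    case False
    define b where "b = 1 / cnj a"
    have b0: "b \<noteq> 0" "cnj a \<noteq> 0" using False by (auto simp: b_def)
    \<comment> \<open>A root on the circle is its own mirror image, and then b is found as a double
      root; otherwise b differs from a and is a root of p by reflection.\<close>
    have "poly r b = 0"
    proof (cases "norm a = 1")
      case True
      then have ba: "b = a" using cnj_eq_inverse[of a] False by (simp add: b_def)
      have "poly (pderiv p) a = poly r a" unfolding r pderiv_mult by (simp add: pderiv_pCons)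
      then show ?thesis using circle_nonneg_double_root[OF p True a(2)] ba by simp
    next
      case na: False
      have "poly p b = poly (conj_reflect (2 * Suc N) p) b" by (simp only: refl)
      also have "\<dots> = 0" using b0 a(2) by (subst poly_conj_reflect[OF deg]) (auto simp: b_def)
      finally have "(b - a) * poly r b = 0" unfolding r by auto
      moreover have "b \<noteq> a"
      proof -
        have "norm b > 1" using na a(1) False by (simp add: b_def norm_divide)
        then show ?thesis using a(1) by auto
      qed
      ultimately show ?thesis by simp
    qed
    then obtain r2 where r2: "r = [:- b, 1:] * r2" by (auto simp: poly_eq_0_iff_dvd)
    have "r2 \<noteq> 0" using r2 r0 by auto
    then have "degree r = Suc (degree r2)" unfolding r2 by (subst degree_mult_eq) auto
    then have "degree r2 \<le> 2 * N" using deg dr by simp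
    moreover have "r = [:1, - cnj a:] * smult (- b) r2"
    proof -
      have "[:1, - cnj a:] * smult (- b) r2 = smult (- b) [:1, - cnj a:] * r2" by (simp only: mult_smult_left mult_smult_right)
      also have "smult (- b) [:1, - cnj a:] = [:- b, 1:]" using b0 by (simp add: b_def)
      finally show ?thesis using r2 by simp
    qed
    moreover have "degree (smult (- b) r2) \<le> degree r2" by (rule degree_smult_le)
    ultimately show ?thesis by (intro exI[of _ "smult (- b) r2"]) auto
  qed
  then obtain r' where r': "r = [:1, - cnj a:] * r'" "degree r' \<le> 2 * N" by blast
  have pr': "p = [:- a, 1:] * [:1, - cnj a:] * r'" unfolding r r'(1) by (simp only: mult.assoc)
  \<comment> \<open>On the circle (x - a) (1 - cnj a x) = x |x - a|^2, so dividing keeps the sign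
    wherever x differs from a; the point a itself is reached by continuity.\<close>
  have off: "poly r' x * cnj x ^ N \<in> \<real>\<^sub>\<ge>\<^sub>0" if x: "norm x = 1" "x \<noteq> a" for x
  proof -
    obtain t where t: "0 \<le> t" "poly p x * cnj x ^ Suc N = of_real t" by (rule circle_nonnegD[OF p x(1)])
    have f: "1 - cnj a * x = x * cnj (x - a)" using circle_mult_cnj[OF x(1)] by (simp add: algebra_simps)
    have "poly p x * cnj x ^ Suc N = (x - a) * (1 - cnj a * x) * poly r' x * (cnj x * cnj x ^ N)"
      unfolding pr' by (simp add: algebra_simps)
    also have "\<dots> = (x * cnj x) * ((x - a) * cnj (x - a)) * (poly r' x * cnj x ^ N)" unfolding f by (simp only: mult_ac)
    also have "\<dots> = of_real ((norm (x - a))\<^sup>2) * (poly r' x * cnj x ^ N)"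
      unfolding circle_mult_cnj[OF x(1)] complex_norm_square by simp
    finally have "of_real t = of_real ((norm (x - a))\<^sup>2) * (poly r' x * cnj x ^ N)" unfolding t(2) .
    moreover have "(norm (x - a))\<^sup>2 > 0" using x by simp
    ultimately have "poly r' x * cnj x ^ N = of_real (t / (norm (x - a))\<^sup>2)" by (simp add: field_simps)
    then show ?thesis using t(1) by (simp only: nonneg_Reals_of_real_iff) simp
  qed
  have "poly r' x * cnj x ^ N \<in> \<real>\<^sub>\<ge>\<^sub>0" if x: "norm x = 1" for x
  proof (cases "x = a")
    case True
    let ?f = "\<lambda>x. poly r' x * cnj x ^ N"
    have "(?f \<longlongrightarrow> ?f x) (at x within sphere 0 1)" by (intro tendsto_intros)
    moreover have "\<forall>\<^sub>F y in at x within sphere 0 1. ?f y \<in> \<real>\<^sub>\<ge>\<^sub>0"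
      unfolding eventually_at_filter by (rule always_eventually) (use off True in auto)
    moreover have "at x within sphere 0 1 \<noteq> bot" using circle_islimpt[OF x] trivial_limit_within by blast
    ultimately show ?thesis by (intro Lim_in_closed_set[OF closed_nonneg_Reals_complex, where f = ?f])
  qed (use off x in blast)
  then have "circle_nonneg N r'" using r'(2) by (simp add: circle_nonneg_def)
  moreover have "r' \<noteq> 0" using r'(1) r0 by auto
  ultimately show thesis using a(1) pr' that by blast
qed

text \<open>Of each pair only the factor 1 - cnj a z with |a| \<le> 1 is kept, which has no zero in
  the open disc; on the circle it has the same modulus as x - a.\<close>

theorem fejer_riesz:
  assumes "circle_nonneg N p" "p \<noteq> 0"
  shows "\<exists>q. degree q \<le> N \<and> (\<forall>z. norm z < 1 \<longrightarrow> poly q z \<noteq> 0) \<and>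
    (\<forall>x. norm x = 1 \<longrightarrow> poly p x = x ^ N * of_real ((norm (poly q x))\<^sup>2))"
  using assms
proof (induction N arbitrary: p)
  case 0
  then have "degree p = 0" by (simp add: circle_nonneg_def)
  then obtain c where c: "p = [:c:]" by (rule degree_eq_zeroE)
  obtain t where t: "0 \<le> t" "poly p 1 = 1 ^ 0 * of_real t" by (rule circle_nonnegD[OF 0(1)]) auto
  then have "c = of_real t" using c by simp
  then have "degree [:of_real (sqrt t):] \<le> 0 \<and> (\<forall>z. norm z < 1 \<longrightarrow> poly [:complex_of_real (sqrt t):] z \<noteq> 0) \<and>
    (\<forall>x. norm x = 1 \<longrightarrow> poly p x = x ^ 0 * of_real ((norm (poly [:of_real (sqrt t):] x))\<^sup>2))"
    using c t 0(2) by simp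
  then show ?case by blast
next
  case (Suc N)
  obtain a r where a: "norm a \<le> 1" "p = [:- a, 1:] * [:1, - cnj a:] * r" "r \<noteq> 0" "circle_nonneg N r"
    by (rule circle_nonneg_factor[OF Suc.prems]) (assumption | rule that)+
  obtain q where q: "degree q \<le> N" "\<forall>z. norm z < 1 \<longrightarrow> poly q z \<noteq> 0"
    "\<forall>x. norm x = 1 \<longrightarrow> poly r x = x ^ N * of_real ((norm (poly q x))\<^sup>2)"
    using Suc.IH[OF a(4,3)] by blast
  define q' where "q' = [:1, - cnj a:] * q"
  have "degree q' \<le> degree [:1, - cnj a:] + degree q" unfolding q'_def by (rule degree_mult_le)
  also have "\<dots> \<le> Suc N" using q(1) degree_pCons_le[of 1 "[:- cnj a:]"] by simp
  finally have d: "degree q' \<le> Suc N" .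
  have nz: "poly q' z \<noteq> 0" if z: "norm z < 1" for z
  proof -
    have "norm (cnj a * z) < 1"
    proof -
      have "norm (cnj a * z) \<le> 1 * norm z" unfolding norm_mult using a(1) by (intro mult_right_mono) auto
      then show ?thesis using z by simp
    qed
    then have "1 - cnj a * z \<noteq> 0" by (metis eq_iff_diff_eq_0 less_irrefl norm_one)
    then show ?thesis using q(2) z by (simp add: q'_def mult.commute)
  qed
  have eq: "poly p x = x ^ Suc N * of_real ((norm (poly q' x))\<^sup>2)" if x: "norm x = 1" for x
  proof -
    have f: "1 - cnj a * x = x * cnj (x - a)" using circle_mult_cnj[OF x] by (simp add: algebra_simps)
    then have n: "norm (1 - cnj a * x) = norm (x - a)" using x by (simp add: norm_mult del: complex_cnj_diff)
    have "poly p x = (x - a) * (1 - cnj a * x) * poly r x" unfolding a(2) by (simp add: algebra_simps)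
    also have "\<dots> = x * ((x - a) * cnj (x - a)) * (x ^ N * of_real ((norm (poly q x))\<^sup>2))"
      unfolding f using q(3) x by (simp add: mult_ac)
    also have "\<dots> = x ^ Suc N * of_real ((norm (x - a))\<^sup>2 * (norm (poly q x))\<^sup>2)"
      unfolding complex_norm_square[symmetric] by simp
    also have "(norm (x - a))\<^sup>2 * (norm (poly q x))\<^sup>2 = (norm (poly q' x))\<^sup>2"
    proof -
      have "poly q' x = (1 - cnj a * x) * poly q x" by (simp add: q'_def algebra_simps)
      then show ?thesis by (simp add: norm_mult n power_mult_distrib)
    qed
    finally show ?thesis .
  qed
  show ?case using d nz eq by blast
qed

text \<open>The top coefficient is conjugate to the constant one and vanishes with it, so division
  by x lowers the degree bound by two.\<close>

lemma circle_nonneg_shift: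
  assumes p: "circle_nonneg (Suc N) p" and c: "coeff p 0 = 0"
  obtains r where "p = [:0, 1:] * r" "circle_nonneg N r"
proof -
  obtain r where r: "p = [:0, 1:] * r"
    using c poly_eq_0_iff_dvd[of p 0] by (auto simp: poly_0_coeff_0)
  have "coeff p (2 * Suc N) = cnj (coeff p 0)"
    using coeff_conj_reflect_0[of "2 * Suc N" p] unfolding circle_nonneg_reflect[OF p] .
  then have z: "coeff p (2 * Suc N) = 0" using c by simp
  have "degree r \<le> 2 * N"
  proof (cases "r = 0")
    case False
    have d: "degree p = Suc (degree r)" unfolding r using False by (subst degree_mult_eq) auto
    then have "p \<noteq> 0" by auto
    then have "degree p \<noteq> 2 * Suc N" using z leading_coeff_0_iff by metis
    then show ?thesis using p d unfolding circle_nonneg_def by simp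
  qed simp
  moreover have "poly r x * cnj x ^ N \<in> \<real>\<^sub>\<ge>\<^sub>0" if x: "norm x = 1" for x
  proof -
    have "poly p x * cnj x ^ Suc N = (x * cnj x) * (poly r x * cnj x ^ N)" unfolding r by (simp add: mult_ac)
    moreover have "poly p x * cnj x ^ Suc N \<in> \<real>\<^sub>\<ge>\<^sub>0" using p x unfolding circle_nonneg_def by blast
    ultimately show ?thesis by (simp only: circle_mult_cnj[OF x] mult_1)
  qed
  ultimately show thesis using r that unfolding circle_nonneg_def by blast
qed

lemma norm_one_minus_cnj: "norm x = 1 \<Longrightarrow> norm (1 - cnj b * x) = norm (x - b)"
proof -
  assume x: "norm x = 1"
  have "1 - cnj b * x = x * cnj (x - b)" using circle_mult_cnj[OF x] by (simp add: algebra_simps)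
  then show ?thesis using x by (simp add: norm_mult del: complex_cnj_diff)
qed

text \<open>
  The nonnegative function \<open>R\<close> becomes, after multiplication by \<open>2 x\<^sup>n \<Prod>\<bar>x - \<beta>\<^sub>k\<bar>\<^sup>2\<close>, a polynomial \<open>Q\<close>
  of degree at most \<open>2n\<close>; its constant coefficient vanishes because \<open>\<Sum> b\<^sub>k\<close> is real, which is what
  lowers the degree of the spectral factor to \<open>n - 1\<close>.
\<close>

lemma rational_spectral_factor:
  fixes \<beta> :: "'n::finite \<Rightarrow> complex" and b :: "'n \<Rightarrow> complex"
  assumes \<beta>: "\<And>k. norm (\<beta> k) < 1" and b: "(\<Sum>k\<in>UNIV. b k) \<in> \<real>"
  defines "R \<equiv> (\<lambda>x. Re (\<Sum>k\<in>UNIV. b k * ((x + \<beta> k) / (x - \<beta> k))))"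
  assumes pos: "\<And>x. norm x = 1 \<Longrightarrow> 0 \<le> R x" and nz: "\<exists>x. norm x = 1 \<and> R x \<noteq> 0"
  obtains q where "degree q \<le> CARD('n) - 1" "\<And>z. norm z < 1 \<Longrightarrow> poly q z \<noteq> 0"
    "\<And>x. norm x = 1 \<Longrightarrow> (norm (poly q x))\<^sup>2 = R x * (\<Prod>k\<in>UNIV. (norm (1 - cnj (\<beta> k) * x))\<^sup>2)"
proof -
  \<comment> \<open>On the circle A k / B k is the k-th summand of R plus its conjugate, and B k is
    x times |1 - cnj \<beta>_k x|^2; Q is the sum of these quotients cleared of
    denominators.\<close>
  define A where "A k = smult (b k) ([:\<beta> k, 1:] * [:1, - cnj (\<beta> k):]) + smult (cnj (b k)) ([:1, cnj (\<beta> k):] * [:- \<beta> k, 1:])" for k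
  define B where "B k = [:- \<beta> k, 1:] * [:1, - cnj (\<beta> k):]" for k
  define Q where "Q = (\<Sum>k\<in>UNIV. A k * (\<Prod>j\<in>UNIV - {k}. B j))"
  define n where "n = CARD('n)"
  obtain N where N: "n = Suc N" unfolding n_def using not0_implies_Suc[of "CARD('n)"] by auto
  have pA: "poly (A k) x = b k * ((x + \<beta> k) * (1 - cnj (\<beta> k) * x)) + cnj (b k) * ((1 + cnj (\<beta> k) * x) * (x - \<beta> k))" for k x
    by (simp add: A_def algebra_simps)
  have pB: "poly (B k) x = (x - \<beta> k) * (1 - cnj (\<beta> k) * x)" for k x
    by (simp add: B_def algebra_simps)
  have pQ: "poly Q x = (\<Sum>k\<in>UNIV. poly (A k) x * (\<Prod>j\<in>UNIV - {k}. poly (B j) x))" for x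
    by (simp add: Q_def poly_sum poly_prod)
  have dA: "degree (A k) \<le> 2" for k
  proof -
    have "degree ([:x, y:] * [:u, v:]) \<le> 2" for x y u v :: complex
      by (rule order_trans[OF degree_mult_le]) (use degree_pCons_le[of x "[:y:]"] degree_pCons_le[of u "[:v:]"] in simp)
    then show ?thesis unfolding A_def by (intro degree_add_le order_trans[OF degree_smult_le])
  qed
  have dB: "degree (B k) \<le> 2" for k
    unfolding B_def by (rule order_trans[OF degree_mult_le])
      (use degree_pCons_le[of "- \<beta> k" "[:1:]"] degree_pCons_le[of 1 "[:- cnj (\<beta> k):]"] in simp)
  have dQ: "degree Q \<le> 2 * n" unfolding Q_def
  proof (rule degree_sum_le)
    fix k :: 'n
    have "degree (\<Prod>j\<in>UNIV - {k}. B j) \<le> (\<Sum>j\<in>UNIV - {k}. degree (B j))"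
      using degree_prod_sum_le[of "UNIV - {k}" B] by simp
    also have "\<dots> \<le> (\<Sum>j\<in>UNIV - {k}. 2)" by (rule sum_mono) (rule dB)
    also have "\<dots> = 2 * N" using N by (simp add: n_def card_Diff_singleton)
    finally have "degree (\<Prod>j\<in>UNIV - {k}. B j) \<le> 2 * N" .
    then show "degree (A k * (\<Prod>j\<in>UNIV - {k}. B j)) \<le> 2 * n"
      using dA[of k] degree_mult_le[of "A k" "\<Prod>j\<in>UNIV - {k}. B j"] N by linarith
  qed simp
  define W where "W x = (\<Prod>k\<in>UNIV. (norm (1 - cnj (\<beta> k) * x))\<^sup>2)" for x
  have ne: "x - \<beta> k \<noteq> 0" "1 - cnj (\<beta> k) * x \<noteq> 0" if "norm x = 1" for x k
    using that \<beta>[of k] one_minus_cnj_ne[OF \<beta>, of x k] by auto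
  have Bx: "poly (B k) x = x * of_real ((norm (1 - cnj (\<beta> k) * x))\<^sup>2)" if x: "norm x = 1" for x k
  proof -
    have "1 - cnj (\<beta> k) * x = x * cnj (x - \<beta> k)" using circle_mult_cnj[OF x] by (simp add: algebra_simps)
    then have "poly (B k) x = x * ((x - \<beta> k) * cnj (x - \<beta> k))" unfolding pB by (simp only: mult_ac)
    then show ?thesis unfolding norm_one_minus_cnj[OF x] complex_norm_square .
  qed
  have prodB: "(\<Prod>k\<in>UNIV. poly (B k) x) = x ^ n * of_real (W x)" if x: "norm x = 1" for x
    unfolding Bx[OF x] prod.distrib W_def by (simp add: n_def)
  have Qx: "poly Q x = x ^ n * of_real (2 * R x * W x)" if x: "norm x = 1" for x
  proof -
    have x0: "x \<noteq> 0" using x by auto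
    have summand: "poly (A k) x * (\<Prod>j\<in>UNIV - {k}. poly (B j) x)
        = (b k * ((x + \<beta> k) / (x - \<beta> k)) + cnj (b k * ((x + \<beta> k) / (x - \<beta> k)))) * (\<Prod>j\<in>UNIV. poly (B j) x)" for k
    proof -
      have c: "cnj ((x + \<beta> k) / (x - \<beta> k)) = (1 + cnj (\<beta> k) * x) / (1 - cnj (\<beta> k) * x)"
        using x0 ne[OF x, of k] by (simp add: cnj_eq_inverse[OF x] divide_simps)
      have "(b k * ((x + \<beta> k) / (x - \<beta> k)) + cnj (b k * ((x + \<beta> k) / (x - \<beta> k)))) * poly (B k) x = poly (A k) x"
        unfolding complex_cnj_mult c pA pB using ne[OF x, of k] by (simp add: divide_simps)
      moreover have "(\<Prod>j\<in>UNIV. poly (B j) x) = poly (B k) x * (\<Prod>j\<in>UNIV - {k}. poly (B j) x)"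
        by (rule prod.remove) auto
      ultimately show ?thesis by (simp only: mult.assoc[symmetric])
    qed
    have "poly Q x = (\<Sum>k\<in>UNIV. b k * ((x + \<beta> k) / (x - \<beta> k)) + cnj (b k * ((x + \<beta> k) / (x - \<beta> k)))) * (\<Prod>j\<in>UNIV. poly (B j) x)"
      unfolding pQ summand by (simp only: sum_distrib_right)
    also have "(\<Sum>k\<in>UNIV. b k * ((x + \<beta> k) / (x - \<beta> k)) + cnj (b k * ((x + \<beta> k) / (x - \<beta> k)))) = of_real (2 * R x)"
      unfolding R_def complex_add_cnj Re_sum by (simp only: of_real_sum[symmetric] sum_distrib_left)
    finally show ?thesis unfolding prodB[OF x] by simp
  qed
  have W_pos: "0 < W x" if "norm x = 1" for x
    unfolding W_def by (rule prod_pos) (use ne(2)[OF that] in simp)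
  have "circle_nonneg n Q"
    unfolding circle_nonneg_def
  proof (intro conjI dQ allI impI)
    fix x :: complex assume x: "norm x = 1"
    have "poly Q x * cnj x ^ n = (x ^ n * cnj x ^ n) * of_real (2 * R x * W x)" unfolding Qx[OF x] by (simp only: mult_ac)
    also have "\<dots> = of_real (2 * R x * W x)" unfolding circle_power_mult_cnj[OF x] by simp
    finally show "poly Q x * cnj x ^ n \<in> \<real>\<^sub>\<ge>\<^sub>0"
      using pos[OF x] W_pos[OF x] by (simp only: nonneg_Reals_of_real_iff) simp
  qed
  then have cQ: "circle_nonneg (Suc N) Q" by (simp only: N)
  have "poly Q 0 = 0"
  proof -
    have "poly Q 0 = (\<Sum>k\<in>UNIV. - (b k - cnj (b k)) * (\<Prod>j\<in>UNIV. - \<beta> j))"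
      unfolding pQ
    proof (rule sum.cong[OF refl])
      fix k
      have "(\<Prod>j\<in>UNIV. - \<beta> j) = - \<beta> k * (\<Prod>j\<in>UNIV - {k}. - \<beta> j)" by (rule prod.remove) auto
      then show "poly (A k) 0 * (\<Prod>j\<in>UNIV - {k}. poly (B j) 0) = - (b k - cnj (b k)) * (\<Prod>j\<in>UNIV. - \<beta> j)"
        by (simp add: pA pB algebra_simps)
    qed
    also have "\<dots> = - ((\<Sum>k\<in>UNIV. b k) - cnj (\<Sum>k\<in>UNIV. b k)) * (\<Prod>j\<in>UNIV. - \<beta> j)"
      unfolding sum_distrib_right[symmetric] sum_negf sum_subtractf cnj_sum ..
    finally show ?thesis using b by (simp add: Reals_cnj_iff)
  qed
  then have "coeff Q 0 = 0" by (simp add: poly_0_coeff_0)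
  then obtain r where r: "Q = [:0, 1:] * r" "circle_nonneg N r" by (rule circle_nonneg_shift[OF cQ])
  have "r \<noteq> 0"
  proof
    assume "r = 0"
    then have Q0: "Q = 0" using r by simp
    obtain x where x: "norm x = 1" "R x \<noteq> 0" using nz by blast
    then have "x ^ n * complex_of_real (2 * R x * W x) = 0" using Qx[OF x(1)] Q0 by simp
    then show False using x W_pos[OF x(1)] by auto
  qed
  from fejer_riesz[OF r(2) this] obtain q where q: "degree q \<le> N" "\<forall>z. norm z < 1 \<longrightarrow> poly q z \<noteq> 0"
    "\<forall>x. norm x = 1 \<longrightarrow> poly r x = x ^ N * of_real ((norm (poly q x))\<^sup>2)" by blast
  \<comment> \<open>Adding conjugates produced 2 R; the factor 1 / sqrt 2 removes the 2 from the
    square of the modulus.\<close>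
  define q' where "q' = smult (of_real (1 / sqrt 2)) q"
  show thesis
  proof (rule that[of q'])
    show "degree q' \<le> CARD('n) - 1" unfolding q'_def using q(1) N degree_smult_le[of _ q] by (simp add: n_def)
    show "poly q' z \<noteq> 0" if "norm z < 1" for z using q(2) that by (simp add: q'_def)
    fix x :: complex assume x: "norm x = 1"
    have x0: "x \<noteq> 0" using x by auto
    have "x ^ n * complex_of_real (2 * R x * W x) = x * (x ^ N * of_real ((norm (poly q x))\<^sup>2))"
      using Qx[OF x] q(3) x unfolding r(1) by simp
    then have "x ^ Suc N * complex_of_real (2 * R x * W x) = x ^ Suc N * of_real ((norm (poly q x))\<^sup>2)"
      unfolding N by (simp only: power_Suc mult.assoc)
    then have "complex_of_real (2 * R x * W x) = of_real ((norm (poly q x))\<^sup>2)" using x0 by simp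
    then have "2 * R x * W x = (norm (poly q x))\<^sup>2" by (simp only: of_real_eq_iff)
    moreover have "(norm (poly q' x))\<^sup>2 = (norm (poly q x))\<^sup>2 / 2"
      by (simp add: q'_def norm_mult power_mult_distrib power_divide norm_divide)
    ultimately show "(norm (poly q' x))\<^sup>2 = R x * (\<Prod>k\<in>UNIV. (norm (1 - cnj (\<beta> k) * x))\<^sup>2)"
      by (simp add: W_def)
  qed
qed

text \<open>The Poisson representation makes Im u vanish in the disc, and a holomorphic function
  with real values is constant; the latter is read off from Schwarz's formula.\<close>

lemma real_boundary_constant:
  assumes u: "u \<in> hardy1" and re: "AE x in \<sigma>. Im (boundary_value u x) = 0" and z: "norm z < 1"
  shows "u z = of_real (Re (u 0))"
proof -
  have im0: "Im (u y) = 0" if y: "norm y < 1" for y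
  proof -
    note i = poisson_mult_integrable[OF hardy1_boundary_integrable[OF u] y]
    have [measurable]: "boundary_value u \<in> borel_measurable \<sigma>" using hardy1_boundary_integrable[OF u] by simp
    have "Im (u y) = (\<integral>x. Im (poisson y x *\<^sub>R boundary_value u x) \<partial>\<sigma>)"
      unfolding hardy1_poisson_boundary[OF u y] by (rule integral_Im[OF i, symmetric])
    also have "\<dots> = (\<integral>x. 0 \<partial>\<sigma>)"
    proof (rule integral_cong_AE)
      show "AE x in \<sigma>. Im (poisson y x *\<^sub>R boundary_value u x) = 0" using re by eventually_elim simp
    qed measurable
    finally show ?thesis by simp
  qed
  define r where "r = (norm z + 1) / 2"
  have r: "0 < r" "r < 1" "norm z < r" using z norm_ge_zero[of z] by (auto simp: r_def add_nonneg_pos)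
  \<comment> \<open>The real part of i u is - Im u = 0, so the Herglotz integral in Schwarz's
    formula vanishes; the dilation supplies continuity up to the circle.\<close>
  define f where "f x = \<i> * u (of_real r * x)" for x
  have f: "continuous_on (cball 0 1) f" "f holomorphic_on ball 0 1"
    unfolding f_def using r
    by (intro continuous_intros radial_continuous(1)[OF hardy1_continuous[OF u]]
        holomorphic_intros dilation_holomorphic[OF hardy1_holomorphic[OF u]]; simp)+
  have n: "norm (z / of_real r) < 1" using r by (simp add: norm_divide)
  have "herglotz (\<lambda>x. Re (f x)) (z / of_real r) = herglotz (\<lambda>x. 0) (z / of_real r)"
    by (rule herglotz_cong) (use im0 r in \<open>simp add: f_def norm_mult\<close>)
  also have "\<dots> = 0" by (simp add: herglotz_def)
  finally have "f (z / of_real r) = \<i> * Im (f 0)" using schwarz_formula[OF f n] by simp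
  then show ?thesis using r by (simp add: f_def)
qed

section \<open>The extremal problem\<close>

lemma eval_at_in_interp_body: "f \<in> hardy1 \<Longrightarrow> hardy1_norm f \<le> 1 \<Longrightarrow> eval_at \<beta> f \<in> interp_body \<beta>"
  unfolding interp_body_def by blast

lemma hardy1_convex_combination:
  assumes f: "f \<in> hardy1" "hardy1_norm f \<le> 1" and g: "g \<in> hardy1" "hardy1_norm g \<le> 1"
    and t: "0 \<le> t" "t \<le> 1"
  shows "(\<lambda>z. of_real (1 - t) * f z + of_real t * g z) \<in> hardy1"
    and "hardy1_norm (\<lambda>z. of_real (1 - t) * f z + of_real t * g z) \<le> 1"
proof -
  note fg = hardy1_cmult(1)[OF f(1), of "of_real (1 - t)"] hardy1_cmult(1)[OF g(1), of "of_real t"]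
  show "(\<lambda>z. of_real (1 - t) * f z + of_real t * g z) \<in> hardy1" by (rule hardy1_add(1)[OF fg])
  have "hardy1_norm (\<lambda>z. of_real (1 - t) * f z + of_real t * g z)
      \<le> hardy1_norm (\<lambda>z. of_real (1 - t) * f z) + hardy1_norm (\<lambda>z. of_real t * g z)"
    by (rule hardy1_norm_add(2)[OF fg])
  also have "\<dots> = (1 - t) * hardy1_norm f + t * hardy1_norm g"
    unfolding hardy1_cmult(3)[OF f(1)] hardy1_cmult(3)[OF g(1)] using t by (simp del: of_real_diff)
  also have "\<dots> \<le> (1 - t) * 1 + t * 1" using f g t by (intro add_mono mult_left_mono) auto
  finally show "hardy1_norm (\<lambda>z. of_real (1 - t) * f z + of_real t * g z) \<le> 1" by simp
qed

lemma eval_at_convex_combination: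
  "eval_at \<beta> (\<lambda>z. of_real s * f z + of_real t * g z) = s *\<^sub>R eval_at \<beta> f + t *\<^sub>R eval_at \<beta> g"
  by (simp add: eval_at_def vec_eq_iff) (simp add: scaleR_conv_of_real)

lemma convex_interp_body:
  fixes \<beta> :: "'n::finite \<Rightarrow> complex"
  shows "convex (interp_body \<beta>)"
proof (rule convexI)
  fix x y :: "complex ^ 'n" and u v :: real
  assume x: "x \<in> interp_body \<beta>" and y: "y \<in> interp_body \<beta>" and uv: "0 \<le> u" "0 \<le> v" "u + v = 1"
  obtain f where f: "x = eval_at \<beta> f" "f \<in> hardy1" "hardy1_norm f \<le> 1" using x unfolding interp_body_def by blast
  obtain g where g: "y = eval_at \<beta> g" "g \<in> hardy1" "hardy1_norm g \<le> 1" using y unfolding interp_body_def by blast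
  have u: "u = 1 - v" using uv by simp
  have v: "v \<le> 1" using uv by simp
  show "u *\<^sub>R x + v *\<^sub>R y \<in> interp_body \<beta>"
    unfolding f(1) g(1) eval_at_convex_combination[symmetric] u
    by (intro eval_at_in_interp_body hardy1_convex_combination f g uv v)
qed

text \<open>Convexity provides a real hyperplane through the frontier point. Strict positivity of
  the maximum needs a test function: the nodes being distinct, a polynomial can vanish at all of
  them but one where \<gamma> is nonzero.\<close>

lemma supporting_functional:
  fixes \<beta> :: "'n::finite \<Rightarrow> complex"
  assumes inj: "inj \<beta>" and F: "F \<in> hardy1" "hardy1_norm F = 1" and fr: "eval_at \<beta> F \<in> frontier (interp_body \<beta>)"
  obtains \<gamma> :: "'n \<Rightarrow> complex" where "0 < Re (\<Sum>k\<in>UNIV. \<gamma> k * F (\<beta> k))"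
    "\<And>f. f \<in> hardy1 \<Longrightarrow> hardy1_norm f \<le> 1 \<Longrightarrow> Re (\<Sum>k\<in>UNIV. \<gamma> k * f (\<beta> k)) \<le> Re (\<Sum>k\<in>UNIV. \<gamma> k * F (\<beta> k))"
proof -
  let ?S = "interp_body \<beta>" and ?x = "eval_at \<beta> F"
  have xS: "?x \<in> ?S" using F by (intro eval_at_in_interp_body) auto
  have "\<exists>a. a \<noteq> 0 \<and> (\<forall>y\<in>?S. a \<bullet> ?x \<le> a \<bullet> y)"
  proof (cases "interior ?S = {}")
    \<comment> \<open>In this case the body lies in a hyperplane, and its normal vector is constant
      on the body, so it supports at every point.\<close>
    case True
    obtain a b where a: "a \<noteq> 0" "?S \<subseteq> {x. a \<bullet> x = b}"
      by (rule empty_interior_subset_hyperplane[OF convex_interp_body True])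
    have "a \<bullet> y = b" if "y \<in> ?S" for y using a(2) that by blast
    then show ?thesis using a(1) xS by (intro exI[of _ a]) simp
  next
    case False
    have "?x \<notin> rel_interior ?S" using fr unfolding rel_interior_nonempty_interior[OF False] frontier_def by blast
    then obtain a where "a \<noteq> 0" "\<And>y. y \<in> ?S \<Longrightarrow> a \<bullet> ?x \<le> a \<bullet> y"
      by (rule supporting_hyperplane_rel_boundary[OF convex_interp_body xS]) (rule that)
    then show ?thesis by blast
  qed
  then obtain a where a: "a \<noteq> 0" "\<And>y. y \<in> ?S \<Longrightarrow> a \<bullet> ?x \<le> a \<bullet> y" by blast
  \<comment> \<open>The conjugate turns the real inner product on the complex vectors into the real
    part of a complex linear form; the sign turns the minimum into a maximum.\<close>
  define \<gamma> where "\<gamma> k = - cnj (a $ k)" for k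
  have inner: "Re (\<Sum>k\<in>UNIV. \<gamma> k * f (\<beta> k)) = - (a \<bullet> eval_at \<beta> f)" for f
    by (simp add: \<gamma>_def inner_vec_def eval_at_def inner_complex_def sum_negf[symmetric] algebra_simps)
  have le: "Re (\<Sum>k\<in>UNIV. \<gamma> k * f (\<beta> k)) \<le> Re (\<Sum>k\<in>UNIV. \<gamma> k * F (\<beta> k))"
    if "f \<in> hardy1" "hardy1_norm f \<le> 1" for f
    unfolding inner using a(2)[OF eval_at_in_interp_body[OF that]] by simp
  obtain k where k: "a $ k \<noteq> 0" using a(1) by (auto simp: vec_eq_iff)
  \<comment> \<open>Lagrange polynomial of the node k up to scaling. The constant c below rotates
    the value of the functional on p to the positive axis and brings c p into the unit ball; N + 1
    avoids a separate treatment of N = 0.\<close>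
  define p where "p z = (\<Prod>j\<in>UNIV - {k}. z - \<beta> j)" for z
  have pk: "p (\<beta> k) \<noteq> 0" unfolding p_def using inj by (auto simp: inj_eq)
  have pj: "p (\<beta> j) = 0" if "j \<noteq> k" for j unfolding p_def using that by (intro prod_zero) auto
  have cont: "continuous_on (cball 0 1) p" and hol: "p holomorphic_on ball 0 1"
    unfolding p_def by (intro continuous_intros holomorphic_intros)+
  have hp: "p \<in> hardy1" using hardy1_mult_continuous(1)[OF hardy1_const[of 1] hol cont] by simp
  define v where "v = \<gamma> k * p (\<beta> k)"
  have v0: "v \<noteq> 0" using k pk by (simp add: v_def \<gamma>_def)
  define N where "N = hardy1_norm p"
  have N: "0 \<le> N" unfolding N_def by (rule hardy1_norm_nonneg)
  define c where "c = cnj v * of_real (1 / ((N + 1) * norm v))"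
  have nc: "norm c = 1 / (N + 1)" using v0 N by (simp add: c_def norm_mult norm_divide)
  have h1: "(\<lambda>z. c * p z) \<in> hardy1" by (rule hardy1_cmult(1)[OF hp])
  have "hardy1_norm (\<lambda>z. c * p z) = N / (N + 1)" unfolding hardy1_cmult(3)[OF hp] nc N_def[symmetric] by simp
  then have "hardy1_norm (\<lambda>z. c * p z) \<le> 1" using N by (simp add: divide_le_eq)
  from le[OF h1 this] have "Re (\<Sum>j\<in>UNIV. \<gamma> j * (c * p (\<beta> j))) \<le> Re (\<Sum>k\<in>UNIV. \<gamma> k * F (\<beta> k))" .
  moreover have "(\<Sum>j\<in>UNIV. \<gamma> j * (c * p (\<beta> j))) = c * v"
  proof -
    have "(\<Sum>j\<in>UNIV. \<gamma> j * (c * p (\<beta> j))) = (\<Sum>j\<in>{k}. \<gamma> j * (c * p (\<beta> j)))"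
      by (rule sum.mono_neutral_right) (use pj in auto)
    then show ?thesis by (simp add: v_def)
  qed
  moreover have "c * v = of_real (norm v / (N + 1))"
  proof -
    have "c * v = (v * cnj v) * of_real (1 / ((N + 1) * norm v))" by (simp add: c_def)
    also have "v * cnj v = of_real ((norm v)\<^sup>2)" by (rule complex_norm_square[symmetric])
    also have "\<dots> * of_real (1 / ((N + 1) * norm v)) = complex_of_real ((norm v)\<^sup>2 * (1 / ((N + 1) * norm v)))"
      by (simp only: of_real_mult)
    also have "(norm v)\<^sup>2 * (1 / ((N + 1) * norm v)) = norm v / (N + 1)" using v0 by (simp add: power2_eq_square)
    finally show ?thesis .
  qed
  moreover have "0 < norm v / (N + 1)" using v0 N by simp
  ultimately have "0 < Re (\<Sum>k\<in>UNIV. \<gamma> k * F (\<beta> k))" by simp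
  then show thesis using le by (rule that)
qed

text \<open>From 2 y \<le> 1 + y^2 with y = |1 + w|. The excess over 1 + Re w is quadratic, so only
  Re h survives in the first variation.\<close>

lemma norm_one_plus_le: "norm (1 + w :: complex) \<le> 1 + Re w + (norm w)\<^sup>2 / 2"
proof -
  have s: "(norm (1 + w))\<^sup>2 = 1 + 2 * Re w + (norm w)\<^sup>2"
    unfolding cmod_power2 by (simp add: power2_eq_square algebra_simps)
  have "0 \<le> (norm (1 + w) - 1)\<^sup>2" by simp
  also have "\<dots> = (norm (1 + w))\<^sup>2 - 2 * norm (1 + w) + 1" by (simp add: power2_eq_square algebra_simps)
  finally show ?thesis unfolding s by simp
qed

section \<open>Maximisers of the supporting functional and their boundary modulus\<close>

locale support_functional =
  fixes \<beta> :: "'n::finite \<Rightarrow> complex" and \<gamma> :: "'n \<Rightarrow> complex" and M :: real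
  assumes \<beta>_in: "norm (\<beta> k) < 1" and M_pos: "0 < M"
    and bound: "f \<in> hardy1 \<Longrightarrow> hardy1_norm f \<le> 1 \<Longrightarrow> Re (\<Sum>k\<in>UNIV. \<gamma> k * f (\<beta> k)) \<le> M"
begin

definition L :: "(complex \<Rightarrow> complex) \<Rightarrow> complex" where "L f = (\<Sum>k\<in>UNIV. \<gamma> k * f (\<beta> k))"

definition maximiser :: "(complex \<Rightarrow> complex) \<Rightarrow> bool" where
  "maximiser f \<longleftrightarrow> f \<in> hardy1 \<and> hardy1_norm f \<le> 1 \<and> Re (L f) = M"

lemma L_add: "L (\<lambda>z. f z + g z) = L f + L g"
  by (simp add: L_def distrib_left sum.distrib)

lemma L_cmult: "L (\<lambda>z. c * f z) = c * L f"
  by (simp add: L_def sum_distrib_left mult.left_commute)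

lemma L_le:
  assumes f: "f \<in> hardy1" and B: "hardy1_norm f \<le> B" "0 < B"
  shows "Re (L f) \<le> M * B"
proof -
  have "hardy1_norm (\<lambda>z. of_real (1 / B) * f z) \<le> 1"
    unfolding hardy1_cmult(3)[OF f] using B by (simp add: norm_divide divide_le_eq)
  from bound[OF hardy1_cmult(1)[OF f] this] have "Re (L (\<lambda>z. of_real (1 / B) * f z)) \<le> M" by (simp add: L_def)
  then have "Re (L f) / B \<le> M" unfolding L_cmult by simp
  then show ?thesis using B by (simp add: divide_le_eq)
qed

lemma maximiser_norm:
  assumes "maximiser f" shows "hardy1_norm f = 1"
proof (rule ccontr)
  assume "hardy1_norm f \<noteq> 1"
  \<comment> \<open>The lower bound 1/2 permits dividing by B even if the norm were 0, while B stays
    below 1.\<close>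
  define B where "B = max (hardy1_norm f) (1/2)"
  have B: "hardy1_norm f \<le> B" "0 < B" "B < 1"
    using assms \<open>hardy1_norm f \<noteq> 1\<close> by (auto simp: B_def maximiser_def)
  have "M \<le> M * B" using L_le[OF _ B(1,2)] assms by (simp add: maximiser_def)
  moreover have "M * B < M * 1" using B M_pos by (intro mult_strict_left_mono) auto
  ultimately show False by simp
qed

text \<open>The norm of f (1 + e h) is at most 1 + e I + O(e^2), where I is the integral of |f| Re
  h. Maximality bounds the functional by M times this, and since its value at f is M, comparing the
  terms linear in e gives the claim.\<close>

lemma maximiser_variation:
  assumes f: "maximiser f" and h: "h holomorphic_on ball 0 1" "continuous_on (cball 0 1) h"
  shows "Re (L (\<lambda>z. f z * h z)) \<le> M * (\<integral>x. norm (boundary_value f x) * Re (h x) \<partial>\<sigma>)"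
proof -
  have f1: "f \<in> hardy1" and Lf: "Re (L f) = M" using f by (simp_all add: maximiser_def)
  have nf: "hardy1_norm f = 1" by (rule maximiser_norm[OF f])
  have "bounded (h ` cball 0 1)" by (intro compact_imp_bounded compact_continuous_image h) auto
  then obtain B where B: "\<forall>x\<in>cball 0 1. norm (h x) \<le> B" unfolding bounded_iff by auto
  have ch: "continuous_on (sphere 0 1) h" by (rule continuous_on_subset[OF h(2)]) auto
  have fi: "integrable \<sigma> (boundary_value f)" by (rule hardy1_boundary_integrable[OF f1])
  have [measurable]: "boundary_value f \<in> borel_measurable \<sigma>" "h \<in> borel_measurable \<sigma>"
    using fi circle_measurable_continuous[OF ch] by auto
  define I where "I = (\<integral>x. norm (boundary_value f x) * Re (h x) \<partial>\<sigma>)"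
  have intI: "integrable \<sigma> (\<lambda>x. norm (boundary_value f x) * Re (h x))"
  proof (rule Bochner_Integration.integrable_bound[where f = "\<lambda>x. B * norm (boundary_value f x)"])
    show "AE x in \<sigma>. norm (norm (boundary_value f x) * Re (h x)) \<le> norm (B * norm (boundary_value f x))"
    proof (rule AE_I2)
      fix x assume "x \<in> space \<sigma>"
      then have "\<bar>Re (h x)\<bar> \<le> B" using B abs_Re_le_cmod[of "h x"] by (auto intro: order_trans)
      then have "norm (boundary_value f x) * \<bar>Re (h x)\<bar> \<le> norm (boundary_value f x) * B" "0 \<le> B"
        by (auto intro!: mult_left_mono)
      then show "norm (norm (boundary_value f x) * Re (h x)) \<le> norm (B * norm (boundary_value f x))"
        by (simp add: abs_mult mult.commute)
    qed
  qed (use fi in auto)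
  have step: "Re (L (\<lambda>z. f z * h z)) \<le> M * I + e * (M * (B\<^sup>2 / 2 + 1))" if e: "0 < e" for e
  proof -
    define h' where "h' z = 1 + of_real e * h z" for z
    have h': "h' holomorphic_on ball 0 1" "continuous_on (cball 0 1) h'"
      unfolding h'_def by (intro holomorphic_intros continuous_intros h)+
    note g = hardy1_mult_continuous[OF f1 h']
    define N where "N = 1 + e * I + e\<^sup>2 * B\<^sup>2 / 2"
    have "hardy1_norm (\<lambda>z. f z * h' z) = (\<integral>x. norm (boundary_value f x * h' x) \<partial>\<sigma>)"
      by (rule hardy1_norm_eqI[OF g(1) _ g(2)]) (simp add: h'_def[abs_def])
    also have "\<dots> \<le> (\<integral>x. norm (boundary_value f x) + e * (norm (boundary_value f x) * Re (h x)) + e\<^sup>2 * B\<^sup>2 / 2 * norm (boundary_value f x) \<partial>\<sigma>)"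
    proof (rule integral_mono)
      show "integrable \<sigma> (\<lambda>x. norm (boundary_value f x * h' x))"
      proof -
        have "integrable \<sigma> (\<lambda>x. boundary_value f x * h' x)"
          by (rule integrable_cong_AE_imp[OF hardy1_boundary_integrable[OF g(1)]])
            (use g(2) in \<open>simp_all add: h'_def[abs_def]\<close>)
        then show ?thesis by (rule integrable_norm)
      qed
      show "integrable \<sigma> (\<lambda>x. norm (boundary_value f x) + e * (norm (boundary_value f x) * Re (h x)) + e\<^sup>2 * B\<^sup>2 / 2 * norm (boundary_value f x))"
        by (intro Bochner_Integration.integrable_add integrable_mult_right intI integrable_norm fi)
      fix x assume "x \<in> space \<sigma>"
      then have Bx: "norm (h x) \<le> B" using B by simp
      have "norm (h' x) \<le> 1 + Re (of_real e * h x) + (norm (of_real e * h x))\<^sup>2 / 2"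
        unfolding h'_def by (rule norm_one_plus_le)
      also have "(norm (of_real e * h x))\<^sup>2 = e\<^sup>2 * (norm (h x))\<^sup>2" by (simp add: norm_mult power_mult_distrib)
      also have "e\<^sup>2 * (norm (h x))\<^sup>2 \<le> e\<^sup>2 * B\<^sup>2" using Bx by (intro mult_left_mono power_mono) auto
      finally have "norm (h' x) \<le> 1 + e * Re (h x) + e\<^sup>2 * B\<^sup>2 / 2" by simp
      then have "norm (boundary_value f x) * norm (h' x) \<le> norm (boundary_value f x) * (1 + e * Re (h x) + e\<^sup>2 * B\<^sup>2 / 2)"
        by (rule mult_left_mono) simp
      then show "norm (boundary_value f x * h' x) \<le> norm (boundary_value f x) + e * (norm (boundary_value f x) * Re (h x)) + e\<^sup>2 * B\<^sup>2 / 2 * norm (boundary_value f x)"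
        by (simp add: norm_mult algebra_simps)
    qed
    also have "\<dots> = (\<integral>x. norm (boundary_value f x) \<partial>\<sigma>) + e * I + e\<^sup>2 * B\<^sup>2 / 2 * (\<integral>x. norm (boundary_value f x) \<partial>\<sigma>)"
      unfolding I_def using fi intI
      by (simp only: Bochner_Integration.integral_add Bochner_Integration.integrable_add integrable_mult_right integrable_norm integral_mult_right_zero)
    also have "\<dots> = N" using nf by (simp add: N_def hardy1_norm_def)
    finally have le: "hardy1_norm (\<lambda>z. f z * h' z) \<le> N" .
    then have N: "0 \<le> N" using hardy1_norm_nonneg by (rule order_trans[rotated])
    \<comment> \<open>N is only known to be nonnegative, whereas \<open>L_le\<close> wants a
      positive bound; adding e^2 provides it at a cost of second order.\<close>
    have "Re (L (\<lambda>z. f z * h' z)) \<le> M * (N + e\<^sup>2)"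
    proof (rule L_le[OF g(1)])
      show "hardy1_norm (\<lambda>z. f z * h' z) \<le> N + e\<^sup>2" by (rule order_trans[OF le]) simp
      show "0 < N + e\<^sup>2" using N e by (intro add_nonneg_pos) auto
    qed
    moreover have "L (\<lambda>z. f z * h' z) = L f + of_real e * L (\<lambda>z. f z * h z)"
    proof -
      have "(\<lambda>z. f z * h' z) = (\<lambda>z. f z + of_real e * (f z * h z))" by (simp add: h'_def fun_eq_iff algebra_simps)
      then show ?thesis by (simp only: L_add L_cmult)
    qed
    ultimately have "M + e * Re (L (\<lambda>z. f z * h z)) \<le> M * (N + e\<^sup>2)" using Lf by simp
    also have "\<dots> = M + e * (M * I + e * (M * (B\<^sup>2 / 2 + 1)))"
      by (simp add: N_def power2_eq_square algebra_simps)
    finally have "e * Re (L (\<lambda>z. f z * h z)) \<le> e * (M * I + e * (M * (B\<^sup>2 / 2 + 1)))" by simp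
    then show ?thesis using e by simp
  qed
  have "Re (L (\<lambda>z. f z * h z)) \<le> M * I"
  proof (rule field_le_epsilon)
    fix e :: real assume e: "0 < e"
    define K where "K = M * (B\<^sup>2 / 2 + 1)"
    have K: "0 < K" using M_pos by (simp add: K_def add_nonneg_pos)
    have "Re (L (\<lambda>z. f z * h z)) \<le> M * I + e / K * K" unfolding K_def by (rule step) (use e K in \<open>simp add: K_def\<close>)
    then show "Re (L (\<lambda>z. f z * h z)) \<le> M * I + e" using K by simp
  qed
  then show ?thesis by (simp add: I_def)
qed

text \<open>The one-sided estimate applied to - h reverses itself, because both sides are linear
  over the reals in h.\<close>

lemma maximiser_dual:
  assumes f: "maximiser f" and h: "h holomorphic_on ball 0 1" "continuous_on (cball 0 1) h"
  shows "Re (L (\<lambda>z. f z * h z)) = M * (\<integral>x. norm (boundary_value f x) * Re (h x) \<partial>\<sigma>)"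
proof -
  have m: "(\<lambda>z. - h z) holomorphic_on ball 0 1" "continuous_on (cball 0 1) (\<lambda>z. - h z)"
    by (intro holomorphic_intros continuous_intros h)+
  have e: "L (\<lambda>z. f z * - h z) = - L (\<lambda>z. f z * h z)" using L_cmult[of "- 1" "\<lambda>z. f z * h z"] by simp
  have "- Re (L (\<lambda>z. f z * h z)) \<le> M * - (\<integral>x. norm (boundary_value f x) * Re (h x) \<partial>\<sigma>)"
    using maximiser_variation[OF f m] unfolding e by simp
  then show ?thesis using maximiser_variation[OF f h] by simp
qed

text \<open>The functional divided by M, applied to f times the analytic completion of the Poisson
  kernel at x. It sees f only at the nodes, and the form with cnj x makes sense inside the disc as
  well as on the circle.\<close>

definition R :: "(complex \<Rightarrow> complex) \<Rightarrow> complex \<Rightarrow> real" where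
  "R f x = Re (\<Sum>k\<in>UNIV. \<gamma> k * f (\<beta> k) / of_real M * ((1 + cnj x * \<beta> k) / (1 - cnj x * \<beta> k)))"

lemma maximiser_poisson:
  assumes f: "maximiser f" and z: "norm z < 1"
  shows "(\<integral>x. poisson z x * norm (boundary_value f x) \<partial>\<sigma>) = R f z"
proof -
  let ?h = "\<lambda>x. (1 + cnj z * x) / (1 - cnj z * x)"
  have h: "?h holomorphic_on ball 0 1" "continuous_on (cball 0 1) ?h"
    using one_minus_cnj_ne[OF z] by (auto intro!: holomorphic_intros continuous_intros)
  have "(\<integral>x. poisson z x * norm (boundary_value f x) \<partial>\<sigma>) = (\<integral>x. norm (boundary_value f x) * Re (?h x) \<partial>\<sigma>)"
    by (rule Bochner_Integration.integral_cong[OF refl]) (simp only: poisson_Re(2)[OF z] space_circle mem_sphere_0 mult.commute)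
  also have "\<dots> = Re (L (\<lambda>z. f z * ?h z)) / M" using maximiser_dual[OF f h] M_pos by simp
  also have "\<dots> = Re (L (\<lambda>z. f z * ?h z) / of_real M)" by simp
  also have "L (\<lambda>z. f z * ?h z) / of_real M = (\<Sum>k\<in>UNIV. \<gamma> k * f (\<beta> k) / of_real M * ?h (\<beta> k))"
  proof -
    have aux: "a * (b * y) / c = a * b / c * y" for a b c y :: complex by (simp add: mult.assoc)
    show ?thesis unfolding L_def sum_divide_distrib by (rule sum.cong[OF refl], rule aux)
  qed
  finally show ?thesis by (simp only: R_def)
qed

lemma R_tendsto:
  assumes x: "norm x = 1" shows "((\<lambda>r. R f (of_real r * x)) \<longlongrightarrow> R f x) (at_left 1)"
proof -
  have ne: "1 - cnj x * \<beta> k \<noteq> 0" for k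
  proof
    assume "1 - cnj x * \<beta> k = 0"
    then have "norm (cnj x * \<beta> k) = 1" by (metis eq_iff_diff_eq_0 norm_one)
    then show False using x \<beta>_in[of k] by (simp add: norm_mult)
  qed
  have "((\<lambda>r. of_real r * x) \<longlongrightarrow> of_real 1 * x) (at_left 1)" by (intro tendsto_intros)
  then have l: "((\<lambda>r. of_real r * x) \<longlongrightarrow> x) (at_left 1)" by simp
  show ?thesis unfolding R_def by (intro tendsto_intros l ne)
qed

text \<open>Inside the disc R f is the Poisson integral of |f|; take radial limits on both sides.
  Continuity of R f up to the circle makes it nonnegative at every point there and not only almost
  everywhere, as the spectral factorization requires.\<close>

lemma maximiser_modulus:
  assumes f: "maximiser f"
  shows "AE x in \<sigma>. norm (boundary_value f x) = R f x" and "norm x = 1 \<Longrightarrow> 0 \<le> R f x"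
proof -
  have f1: "f \<in> hardy1" using f by (simp add: maximiser_def)
  have i: "integrable \<sigma> (\<lambda>x. norm (boundary_value f x))"
    by (rule integrable_norm[OF hardy1_boundary_integrable[OF f1]])
  have ev: "\<forall>\<^sub>F r in at_left 1. (\<integral>y. poisson (of_real r * x) y * norm (boundary_value f y) \<partial>\<sigma>) = R f (of_real r * x)"
    if x: "norm x = 1" for x
    using eventually_radius[of 0, simplified]
  proof eventually_elim
    case (elim r)
    then have "norm (of_real r * x) < 1" using x by (simp add: norm_mult)
    then show ?case by (rule maximiser_poisson[OF f])
  qed
  show "AE x in \<sigma>. norm (boundary_value f x) = R f x"
    using poisson_radial_limit[OF i] AE_space
  proof eventually_elim
    case (elim x)
    then have x: "norm x = 1" by simp
    have "((\<lambda>r. \<integral>y. poisson (of_real r * x) y * norm (boundary_value f y) \<partial>\<sigma>) \<longlongrightarrow> norm (boundary_value f x)) (at_left 1)"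
      using elim(1) by simp
    then have "((\<lambda>r. R f (of_real r * x)) \<longlongrightarrow> norm (boundary_value f x)) (at_left 1)"
      by (rule Lim_transform_eventually[OF _ ev[OF x]])
    then show ?case by (rule tendsto_unique[OF trivial_limit_at_left_real _ R_tendsto[OF x]])
  qed
  show "0 \<le> R f x" if x: "norm x = 1"
  proof (rule tendsto_lowerbound[OF R_tendsto[OF x] _ trivial_limit_at_left_real])
    show "\<forall>\<^sub>F r in at_left 1. 0 \<le> R f (of_real r * x)"
      using ev[OF x] eventually_radius[of 0, simplified]
    proof eventually_elim
      case (elim r)
      then have "norm (of_real r * x) < 1" using x by (simp add: norm_mult)
      then show ?case unfolding elim(1)[symmetric]
        by (intro Bochner_Integration.integral_nonneg mult_nonneg_nonneg poisson_nonneg norm_ge_zero)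
    qed
  qed
qed

text \<open>The average of f and g is again a maximiser with the same node values, so f, g and their
  average have the same modulus almost everywhere; by the parallelogram law f - g vanishes.\<close>

lemma maximiser_unique:
  assumes f: "maximiser f" and g: "maximiser g" and eq: "\<And>k. f (\<beta> k) = g (\<beta> k)"
  shows "AE x in \<sigma>. boundary_value f x = boundary_value g x"
proof -
  have f1: "f \<in> hardy1" "hardy1_norm f \<le> 1" and g1: "g \<in> hardy1" "hardy1_norm g \<le> 1"
    and Lf: "Re (L f) = M" and Lg: "Re (L g) = M" using f g by (simp_all add: maximiser_def)
  let ?m = "\<lambda>z. of_real (1 - 1/2) * f z + of_real (1/2) * g z"
  have m: "maximiser ?m"
    unfolding maximiser_def
  proof (intro conjI hardy1_convex_combination f1 g1)
    show "Re (L ?m) = M" unfolding L_add L_cmult using Lf Lg by simp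
  qed auto
  have Rm: "R ?m x = R g x" "R f x = R g x" for x unfolding R_def using eq by (simp_all add: field_simps)
  have bm: "AE x in \<sigma>. boundary_value ?m x = of_real (1 - 1/2) * boundary_value f x + of_real (1/2) * boundary_value g x"
    using hardy1_add(2)[OF hardy1_cmult(1)[OF f1(1), of "of_real (1 - 1/2)"] hardy1_cmult(1)[OF g1(1), of "of_real (1/2)"]]
      hardy1_cmult(2)[OF f1(1), of "of_real (1 - 1/2)"] hardy1_cmult(2)[OF g1(1), of "of_real (1/2)"]
    by eventually_elim (simp only:)
  from bm maximiser_modulus(1)[OF m] maximiser_modulus(1)[OF f] maximiser_modulus(1)[OF g]
  show ?thesis
  proof eventually_elim
    case (elim x)
    define u v where "u = boundary_value f x" and "v = boundary_value g x"
    have b: "boundary_value ?m x = (u + v) / 2" unfolding elim(1) by (simp add: u_def v_def add_divide_distrib)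
    have "norm ((u + v) / 2) = norm v" using elim(2) unfolding b Rm(1) v_def elim(4) .
    moreover have "norm u = norm v" using elim(3,4) unfolding Rm(2) u_def v_def by simp
    ultimately have n: "norm (u + v) = 2 * norm v" "norm u = norm v" by (simp_all add: norm_divide)
    have "(norm (u + v))\<^sup>2 + (norm (u - v))\<^sup>2 = 2 * (norm u)\<^sup>2 + 2 * (norm v)\<^sup>2"
      unfolding cmod_power2 by (simp add: power2_eq_square algebra_simps)
    then have "(norm (u - v))\<^sup>2 = 0" unfolding n by (simp add: power_mult_distrib)
    then show ?case by (simp add: u_def v_def)
  qed
qed

end

section \<open>Quotients by the spectral factor\<close>

lemma AE_poly_nonzero:
  fixes q :: "complex poly"
  assumes "q \<noteq> 0"
  shows "AE x in \<sigma>. poly q x \<noteq> 0"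
proof -
  have "finite {a. poly q a = 0}" by (rule poly_roots_finite[OF assms])
  then have "AE x in \<sigma>. \<forall>a\<in>{a. poly q a = 0}. x \<noteq> a"
    by (subst AE_finite_all) (auto intro: circle_singleton_null)
  then show ?thesis by eventually_elim auto
qed

locale spectral_majorant =
  fixes \<beta> :: "'n::finite \<Rightarrow> complex" and q :: "complex poly"
  assumes nodes: "norm (\<beta> k) < 1" and zero_free: "norm z < 1 \<Longrightarrow> poly q z \<noteq> 0"
begin

definition K :: "complex \<Rightarrow> complex" where "K z = (\<Prod>k\<in>UNIV. 1 - cnj (\<beta> k) * z)"

definition G :: "complex \<Rightarrow> complex" where "G z = (poly q z)\<^sup>2 * kernel_prod \<beta> z"

lemma G_eq: "G z = (poly q z / K z)\<^sup>2"
  by (simp add: G_def K_def kernel_prod_def power_divide prod_dividef prod_power_distrib)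

lemma K_nonzero: "norm z \<le> 1 \<Longrightarrow> K z \<noteq> 0"
  unfolding K_def using one_minus_cnj_ne[OF nodes] by simp

lemma K_holomorphic: "K holomorphic_on S" and K_continuous: "continuous_on S K"
  unfolding K_def by (intro holomorphic_intros continuous_intros)+

lemma poly_holomorphic: "(\<lambda>z. poly q (c * z)) holomorphic_on S"
  by (rule holomorphic_on_compose_gen[of "\<lambda>z. c * z" S "poly q" UNIV, unfolded o_def])
     (auto intro!: holomorphic_intros)

lemma G_holomorphic: "G holomorphic_on ball 0 1" and G_continuous: "continuous_on (cball 0 1) G"
  unfolding G_eq[abs_def] using K_nonzero poly_holomorphic[of 1, simplified]
  by (auto intro!: holomorphic_intros continuous_intros K_holomorphic K_continuous)

lemma G_hardy1: "G \<in> hardy1"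
  using hardy1_mult_continuous(1)[OF hardy1_const[of 1] G_holomorphic G_continuous] by simp

lemma G_boundary: "norm x = 1 \<Longrightarrow> boundary_value G x = G x"
  by (rule boundary_valueI[OF boundary_value_continuous[OF G_continuous]])

lemma G_nonzero: "norm z < 1 \<Longrightarrow> G z \<noteq> 0"
  unfolding G_eq using zero_free K_nonzero by simp

lemma q_nonzero: "q \<noteq> 0"
  using zero_free[of 0] by auto

lemma AE_G_nonzero: "AE x in \<sigma>. G x \<noteq> 0"
  using AE_poly_nonzero[OF q_nonzero] AE_space by eventually_elim (use K_nonzero in \<open>simp add: G_eq\<close>)

lemma norm_G: "norm x = 1 \<Longrightarrow> norm (G x) = (norm (poly q x))\<^sup>2 / (\<Prod>k\<in>UNIV. (norm (1 - cnj (\<beta> k) * x))\<^sup>2)"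
  by (simp add: G_eq K_def norm_power norm_divide power_divide prod_power_distrib flip: prod_norm)

text \<open>Both q and the denominator K are free of zeros in the disc and factor into outer linear
  terms; outer functions are stable under products and inverses.\<close>

lemma outer_G: "\<exists>\<phi>. outer_modulus G \<phi>"
proof -
  have "\<exists>\<phi>. outer_modulus (\<lambda>z. 1 - cnj (\<beta> k) * z) \<phi>" for k
    using outer_linear_factor[of "cnj (\<beta> k)"] nodes[of k] by auto
  then obtain \<phi> where \<phi>: "outer_modulus K \<phi>"
    using outer_prod[of "UNIV :: 'n set" "\<lambda>k z. 1 - cnj (\<beta> k) * z"] unfolding K_def[abs_def] by auto
  obtain \<psi> where \<psi>: "outer_modulus (poly q) \<psi>" using outer_poly[OF zero_free] by blast
  note h = outer_mult[OF \<psi> outer_inverse[OF \<phi>]]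
  have "outer_modulus G (\<lambda>x. (\<psi> x * inverse (\<phi> x)) * (\<psi> x * inverse (\<phi> x)))"
    by (rule outer_modulus_cong[OF outer_mult[OF h h]]) (simp add: G_eq power2_eq_square divide_inverse)
  then show ?thesis by blast
qed

text \<open>
  If \<open>q\<close> has zeros on the circle, then \<open>f / G\<close> is not obviously of class \<open>H\<^sup>1\<close>; dividing by the dilation
  \<open>q (s z)\<close> instead costs only the factor \<open>\<bar>q x / q (s x)\<bar> \<le> 2\<^sup>d\<close>, which tends to 1 as \<open>s \<rightarrow> 1\<close>.
\<close>

lemma dominated:
  assumes f: "f \<in> hardy1" and le: "AE x in \<sigma>. norm (boundary_value f x) \<le> C * norm (G x)"
    and C: "0 \<le> C" and z: "norm z < 1"
  shows "norm (f z) \<le> C * norm (G z)"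
proof -
  define s where "s n = 1 - 1 / real (n + 2)" for n
  have s: "0 \<le> s n" "s n < 1" for n unfolding s_def by (rule inverse_Suc_radius)+
  have s_lim: "s \<longlonglongrightarrow> 1"
  proof -
    have "(\<lambda>n. 1 - 1 / real (n + 2)) \<longlonglongrightarrow> 1 - 0"
      by (intro tendsto_diff tendsto_const LIMSEQ_ignore_initial_segment[OF lim_1_over_n])
    then show ?thesis by (simp add: s_def[abs_def])
  qed
  have qs: "poly q (of_real (s n) * x) \<noteq> 0" if "norm x \<le> 1" for n x
  proof (rule zero_free)
    have "norm (of_real (s n) * x) \<le> s n * 1" unfolding norm_mult using s[of n] that by (intro mult_mono) auto
    then show "norm (of_real (s n) * x) < 1" using s[of n] by simp
  qed
  \<comment> \<open>h n approximates 1 / G and is continuous on the closed disc, so f h n is in H^1;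
    v n is the resulting majorant of its modulus on the circle.\<close>
  define h where "h n x = (K x / poly q (of_real (s n) * x))\<^sup>2" for n x
  have h: "h n holomorphic_on ball 0 1" "continuous_on (cball 0 1) (h n)" for n
    unfolding h_def using qs[of _ n]
    by (auto intro!: holomorphic_intros continuous_intros K_holomorphic K_continuous poly_holomorphic)
  define v where "v n x = C * (norm (poly q x) / norm (poly q (of_real (s n) * x)))\<^sup>2" for n x
  define d where "d = (2::real) ^ degree q"
  have v_cont: "continuous_on (sphere 0 1) (v n)" for n
    unfolding v_def using qs[of _ n] by (intro continuous_intros) auto
  have v_le: "v n x \<le> C * d\<^sup>2" "0 \<le> v n x" if x: "norm x = 1" for n x
  proof -
    have "norm (poly q x) \<le> d * norm (poly q (of_real (s n) * x))"
      unfolding d_def by (rule zero_free_poly_dilation[OF zero_free x]) (use s[of n] in auto)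
    then have "norm (poly q x) / norm (poly q (of_real (s n) * x)) \<le> d"
      using qs[of x n] x by (simp add: divide_le_eq)
    then show "v n x \<le> C * d\<^sup>2" unfolding v_def using C by (intro mult_left_mono power_mono) auto
    show "0 \<le> v n x" unfolding v_def using C by simp
  qed
  have step: "norm (f z * h n z) \<le> (\<integral>x. poisson z x * v n x \<partial>\<sigma>)" for n
  proof (rule hardy1_norm_le_poisson[OF hardy1_mult_continuous(1)[OF f h] circle_integrable_continuous[OF v_cont] _ z])
    show "AE x in \<sigma>. norm (boundary_value (\<lambda>z. f z * h n z) x) \<le> v n x"
      using hardy1_mult_continuous(2)[OF f h, of n] le AE_space
    proof eventually_elim
      case (elim x)
      then have x: "norm x \<le> 1" by simp
      have "norm (boundary_value f x * h n x) \<le> (C * norm (G x)) * norm (h n x)"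
        unfolding norm_mult using elim(2) by (rule mult_right_mono) simp
      also have "\<dots> = v n x"
        using K_nonzero[OF x] by (simp add: G_eq h_def v_def norm_power norm_divide power_divide)
      finally show ?case unfolding elim(1) .
    qed
  qed
  have "(\<lambda>n. \<integral>x. poisson z x * v n x \<partial>\<sigma>) \<longlonglongrightarrow> (\<integral>x. poisson z x * C \<partial>\<sigma>)"
  proof (rule integral_dominated_convergence[where w = "\<lambda>x. poisson z x * (C * d\<^sup>2)"])
    show "(\<lambda>x. poisson z x * v n x) \<in> borel_measurable \<sigma>" for n
      by (intro circle_measurable_continuous continuous_intros v_cont poisson_continuous z)
    show "integrable \<sigma> (\<lambda>x. poisson z x * (C * d\<^sup>2))"
      by (intro circle_integrable_continuous continuous_intros poisson_continuous z)
    show "AE x in \<sigma>. (\<lambda>n. poisson z x * v n x) \<longlonglongrightarrow> poisson z x * C"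
      using AE_poly_nonzero[OF q_nonzero]
    proof eventually_elim
      case (elim x)
      have "(\<lambda>n. v n x) \<longlonglongrightarrow> C * (norm (poly q x) / norm (poly q (of_real 1 * x)))\<^sup>2"
        unfolding v_def using elim by (intro tendsto_intros s_lim) auto
      then have "(\<lambda>n. v n x) \<longlonglongrightarrow> C" using elim by simp
      then show ?case by (intro tendsto_mult tendsto_const)
    qed
    show "AE x in \<sigma>. norm (poisson z x * v n x) \<le> poisson z x * (C * d\<^sup>2)" for n
    proof (rule AE_I2)
      fix x assume "x \<in> space \<sigma>"
      then show "norm (poisson z x * v n x) \<le> poisson z x * (C * d\<^sup>2)"
        using v_le[of x n] poisson_nonneg[OF z, of x] by (simp add: abs_mult mult_left_mono)
    qed
  qed measurable
  then have R: "(\<lambda>n. \<integral>x. poisson z x * v n x \<partial>\<sigma>) \<longlonglongrightarrow> C" using poisson_integral_one[OF z] by simp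
  have "(\<lambda>n. norm (f z * h n z)) \<longlonglongrightarrow> norm (f z * (K z / poly q (of_real 1 * z))\<^sup>2)"
    unfolding h_def using zero_free[OF z] by (intro tendsto_intros s_lim) auto
  from LIMSEQ_le[OF this R] step have "norm (f z * (K z / poly q z)\<^sup>2) \<le> C" by auto
  moreover have "(K z / poly q z)\<^sup>2 = inverse (G z)" by (simp add: G_eq power_divide)
  ultimately have "norm (f z) * inverse (norm (G z)) \<le> C" by (simp add: norm_mult norm_inverse)
  then show ?thesis using G_nonzero[OF z] by (simp add: field_simps)
qed

text \<open>By \<open>dominated\<close> the bound on the circle passes to the disc, so the quotient
  is bounded there; its radial limit exists wherever that of f does and G x is nonzero.\<close>

lemma quotient_hardy1:
  assumes f: "f \<in> hardy1" and le: "AE x in \<sigma>. norm (boundary_value f x) \<le> C * norm (G x)" and C: "0 \<le> C"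
  shows "(\<lambda>z. f z / G z) holomorphic_on ball 0 1" "(\<lambda>z. f z / G z) \<in> hardy1"
    "norm z < 1 \<Longrightarrow> norm (f z / G z) \<le> C"
    "AE x in \<sigma>. boundary_value (\<lambda>z. f z / G z) x = boundary_value f x / G x"
proof -
  show 1: "(\<lambda>z. f z / G z) holomorphic_on ball 0 1"
    using G_nonzero by (intro holomorphic_intros hardy1_holomorphic[OF f] G_holomorphic) auto
  show 2: "norm (f z / G z) \<le> C" if "norm z < 1" for z
    using dominated[OF f le C that] G_nonzero[OF that] by (simp add: norm_divide divide_le_eq)
  show "(\<lambda>z. f z / G z) \<in> hardy1" by (rule hardy1_boundedI[OF 1 2])
  show "AE x in \<sigma>. boundary_value (\<lambda>z. f z / G z) x = boundary_value f x / G x"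
    using hardy1_radial_limit[OF f] AE_G_nonzero AE_space
  proof eventually_elim
    case (elim x)
    then have "norm x = 1" by simp
    then show ?case by (intro boundary_valueI tendsto_divide elim(1,2) boundary_value_continuous[OF G_continuous])
  qed
qed

end

context support_functional
begin

text \<open>Testing the duality with the constant i, whose real part is 0, kills the imaginary part.
  This supplies the real coefficient sum that lowers the degree of the spectral factor.\<close>

lemma maximiser_L:
  assumes f: "maximiser f" shows "L f = of_real M"
proof -
  have "Re (L (\<lambda>z. f z * \<i>)) = M * (\<integral>x. norm (boundary_value f x) * Re \<i> \<partial>\<sigma>)"
    by (rule maximiser_dual[OF f]) auto
  then have "Im (L f) = 0" using L_cmult[of \<i> f] by (simp add: mult.commute)
  then show ?thesis using f by (simp add: maximiser_def complex_eq_iff)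
qed

lemma maximiser_spectral_factor:
  assumes f: "maximiser f"
  obtains q where "degree q \<le> CARD('n) - 1" "spectral_majorant \<beta> q"
    "AE x in \<sigma>. norm (boundary_value f x) = norm (spectral_majorant.G \<beta> q x)"
proof -
  define b where "b k = \<gamma> k * f (\<beta> k) / of_real M" for k
  have "(\<Sum>k\<in>UNIV. b k) = L f / of_real M" by (simp add: b_def L_def sum_divide_distrib)
  then have sb: "(\<Sum>k\<in>UNIV. b k) \<in> \<real>" unfolding maximiser_L[OF f] using M_pos by simp
  have Rb: "R f x = Re (\<Sum>k\<in>UNIV. b k * ((x + \<beta> k) / (x - \<beta> k)))" if x: "norm x = 1" for x
  proof -
    have "(1 + cnj x * \<beta> k) / (1 - cnj x * \<beta> k) = (x + \<beta> k) / (x - \<beta> k)" for k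
    proof -
      have "x \<noteq> 0" "x - \<beta> k \<noteq> 0" using x \<beta>_in[of k] by auto
      then show ?thesis by (simp add: cnj_eq_inverse[OF x] divide_simps)
    qed
    then show ?thesis by (simp only: R_def b_def)
  qed
  \<comment> \<open>Fejer-Riesz needs a nonzero polynomial; R identically 0 on the circle would make
    f the zero function, contrary to norm 1.\<close>
  have "\<exists>x. norm x = 1 \<and> R f x \<noteq> 0"
  proof (rule ccontr)
    assume "\<not> (\<exists>x. norm x = 1 \<and> R f x \<noteq> 0)"
    then have R0: "R f x = 0" if "norm x = 1" for x using that by blast
    have "AE x in \<sigma>. boundary_value f x = 0"
      using maximiser_modulus(1)[OF f] AE_space
    proof eventually_elim
      case (elim x)
      then have "norm (boundary_value f x) = 0" using R0[of x] by simp
      then show ?case by simp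
    qed
    then have "hardy1_norm f = (\<integral>x. norm (0::complex) \<partial>\<sigma>)"
      using f by (intro hardy1_norm_eqI) (simp_all add: maximiser_def)
    then show False using maximiser_norm[OF f] by simp
  qed
  then have nz: "\<exists>x. norm x = 1 \<and> Re (\<Sum>k\<in>UNIV. b k * ((x + \<beta> k) / (x - \<beta> k))) \<noteq> 0"
    using Rb by auto
  have pos: "0 \<le> Re (\<Sum>k\<in>UNIV. b k * ((x + \<beta> k) / (x - \<beta> k)))" if "norm x = 1" for x
    using maximiser_modulus(2)[OF f that] Rb[OF that] by simp
  obtain q where q: "degree q \<le> CARD('n) - 1" "\<And>z. norm z < 1 \<Longrightarrow> poly q z \<noteq> 0"
    "\<And>x. norm x = 1 \<Longrightarrow> (norm (poly q x))\<^sup>2 = Re (\<Sum>k\<in>UNIV. b k * ((x + \<beta> k) / (x - \<beta> k))) * (\<Prod>k\<in>UNIV. (norm (1 - cnj (\<beta> k) * x))\<^sup>2)"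
    by (rule rational_spectral_factor[OF \<beta>_in sb pos nz]) (assumption | rule that)+
  interpret spectral_majorant \<beta> q by unfold_locales (rule \<beta>_in, rule q(2))
  have "AE x in \<sigma>. norm (boundary_value f x) = norm (G x)"
    using maximiser_modulus(1)[OF f] AE_space
  proof eventually_elim
    case (elim x)
    then have x: "norm x = 1" by simp
    have "(\<Prod>k\<in>UNIV. (norm (1 - cnj (\<beta> k) * x))\<^sup>2) \<noteq> 0"
      using one_minus_cnj_ne[OF \<beta>_in, of x] x by simp
    then have "norm (G x) = R f x" unfolding norm_G[OF x] q(3)[OF x] Rb[OF x] by simp
    then show ?case using elim(1) by simp
  qed
  then show thesis by (rule that[OF q(1) spectral_majorant_axioms])
qed

end

text \<open>Equality in the triangle inequality forces Re (a cnj b) = |a cnj b|, so a cnj b is real.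
  The conclusion says without division that a is a real multiple of a + b whenever a + b is
  nonzero.\<close>

lemma norm_add_eq_imp_real:
  fixes a b :: complex
  assumes "norm (a + b) = norm a + norm b"
  shows "Im (a * cnj (a + b)) = 0"
proof -
  have "(norm (a + b))\<^sup>2 = (norm a)\<^sup>2 + (norm b)\<^sup>2 + 2 * Re (a * cnj b)"
    unfolding cmod_power2 by (simp add: power2_eq_square algebra_simps)
  then have "Re (a * cnj b) = norm a * norm b" unfolding assms by (simp add: power2_eq_square algebra_simps)
  also have "\<dots> = norm (a * cnj b)" by (simp add: norm_mult)
  finally have "Re (a * cnj b) = norm (a * cnj b)" .
  then have "Im (a * cnj b) = 0" using cmod_power2[of "a * cnj b"] by simp
  then show ?thesis by (simp add: algebra_simps)
qed

section \<open>Extreme points and outer functions\<close>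

locale extremal_pair = support_functional \<beta> \<gamma> M + spectral_majorant \<beta> q
  for \<beta> :: "'n::finite \<Rightarrow> complex" and \<gamma> M q +
  fixes F :: "complex \<Rightarrow> complex"
  assumes F_max: "maximiser F" and F_modulus: "AE x in \<sigma>. norm (boundary_value F x) = norm (G x)"
begin

lemma F_hardy1: "F \<in> hardy1" and F_norm: "hardy1_norm F = 1"
  using F_max maximiser_norm by (simp_all add: maximiser_def)

lemma F_integrable: "integrable \<sigma> (boundary_value F)"
  by (rule hardy1_boundary_integrable[OF F_hardy1])

lemma F_boundary_measurable [measurable]: "boundary_value F \<in> borel_measurable \<sigma>"
  using F_integrable by simp

lemma outer_imp_multiple:
  assumes "outer_function F"
  shows "\<exists>c. norm c = 1 \<and> (\<forall>z. norm z < 1 \<longrightarrow> F z = c * G z)"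
proof -
  obtain \<phi> where \<phi>: "outer_modulus F \<phi>" using assms unfolding outer_function_iff by blast
  obtain \<psi> where \<psi>: "outer_modulus G \<psi>" using outer_G by blast
  have "AE x in \<sigma>. \<phi> x = \<psi> x"
    using outer_boundary[OF \<phi> F_hardy1] outer_boundary[OF \<psi> G_hardy1] F_modulus AE_space
    by eventually_elim (simp add: G_boundary)
  then show ?thesis by (rule outer_unique[OF \<phi> \<psi>])
qed

lemma multiple_imp_outer:
  assumes "norm c = 1" "\<And>z. norm z < 1 \<Longrightarrow> F z = c * G z"
  shows "outer_function F"
proof -
  have "c \<noteq> 0" using assms(1) by auto
  obtain \<psi> where \<psi>: "outer_modulus G \<psi>" using outer_G by blast
  have "outer_modulus F (\<lambda>x. norm c * \<psi> x)"
    by (rule outer_modulus_cong[OF outer_mult[OF outer_const[OF \<open>c \<noteq> 0\<close>] \<psi>]]) (simp add: assms(2))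
  then show ?thesis unfolding outer_function_iff by blast
qed

text \<open>
  With \<open>I = F / G\<close> the inner factor and \<open>\<bar>u\<bar> = 1\<close>, the functions \<open>F \<plusminus> w\<close>, \<open>w = (u G I\<^sup>2 + cnj u G) / 2\<close>, equal
  \<open>F (1 \<plusminus> Re (u I))\<close> on the circle. For suitable \<open>u\<close> both have norm 1, so extremality forces \<open>w\<close> to vanish at
  the nodes, hence \<open>\<bar>I\<bar> = 1\<close> there.
\<close>

lemma extreme_imp_outer:
  assumes ext: "eval_at \<beta> F extreme_point_of interp_body \<beta>"
  shows "outer_function F"
proof -
  have le1: "AE x in \<sigma>. norm (boundary_value F x) \<le> 1 * norm (G x)" using F_modulus by eventually_elim simp
  define I where "I z = F z / G z" for z
  note I = quotient_hardy1[OF F_hardy1 le1 zero_le_one, folded I_def]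
  define IB where "IB = boundary_value I"
  have IB_m [measurable]: "IB \<in> borel_measurable \<sigma>"
    unfolding IB_def using hardy1_boundary_integrable[OF I(2)] by simp
  have IB: "AE x in \<sigma>. IB x = boundary_value F x / G x" unfolding IB_def by (rule I(4))
  have IB1: "AE x in \<sigma>. norm (IB x) = 1"
    using IB F_modulus AE_G_nonzero by eventually_elim (simp add: norm_divide)
  define c0 where "c0 = (\<integral>x. of_real (norm (boundary_value F x)) * IB x \<partial>\<sigma>)"
  \<comment> \<open>Multiplication by u rotates c0 onto the imaginary axis, so that Re (u I) has
    mean zero against |F|. If c0 = 0, any unimodular number serves.\<close>
  define u where "u = (if c0 = 0 then 1 else \<i> * cnj c0 / of_real (norm c0))"
  have u: "norm u = 1" "Re (u * c0) = 0"
  proof -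
    show "norm u = 1" by (auto simp: u_def norm_mult norm_divide)
    have "c0 * cnj c0 = of_real ((norm c0)\<^sup>2)" by (rule complex_norm_square[symmetric])
    then have "u * c0 = \<i> * of_real (norm c0)" if "c0 \<noteq> 0"
      using that by (simp add: u_def power2_eq_square mult_ac)
    then show "Re (u * c0) = 0" by (cases "c0 = 0") auto
  qed
  have int0: "integrable \<sigma> (\<lambda>x. of_real (norm (boundary_value F x)) * IB x)"
  proof (rule Bochner_Integration.integrable_bound[OF F_integrable])
    show "AE x in \<sigma>. norm (of_real (norm (boundary_value F x)) * IB x) \<le> norm (boundary_value F x)"
      using IB1 by eventually_elim (simp add: norm_mult)
  qed measurable
  define \<rho> where "\<rho> x = Re (u * IB x)" for x
  have \<rho>_m [measurable]: "\<rho> \<in> borel_measurable \<sigma>" unfolding \<rho>_def by measurable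
  have \<rho>_eq: "norm (boundary_value F x) * \<rho> x = Re (u * (of_real (norm (boundary_value F x)) * IB x))" for x
    by (simp add: \<rho>_def algebra_simps)
  have int\<rho>: "integrable \<sigma> (\<lambda>x. norm (boundary_value F x) * \<rho> x)"
    unfolding \<rho>_eq using int0 by (intro integrable_Re integrable_mult_right)
  have mean\<rho>: "(\<integral>x. norm (boundary_value F x) * \<rho> x \<partial>\<sigma>) = 0"
  proof -
    have "(\<integral>x. norm (boundary_value F x) * \<rho> x \<partial>\<sigma>) = Re (\<integral>x. u * (of_real (norm (boundary_value F x)) * IB x) \<partial>\<sigma>)"
      unfolding \<rho>_eq by (rule integral_Re) (intro integrable_mult_right int0)
    also have "\<dots> = Re (u * c0)" unfolding c0_def by (simp only: integral_mult_right_zero)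
    finally show ?thesis using u by simp
  qed
  define w where "w z = G z * ((u * (I z)\<^sup>2 + cnj u) / 2)" for z
  have w: "w \<in> hardy1"
    unfolding w_def
  proof (rule hardy1_mult_bounded[OF G_hardy1, of _ 1])
    show "(\<lambda>z. (u * (I z)\<^sup>2 + cnj u) / 2) holomorphic_on ball 0 1" by (intro holomorphic_intros I(1)) auto
    fix z :: complex assume z: "norm z < 1"
    have "norm (u * (I z)\<^sup>2 + cnj u) \<le> norm (u * (I z)\<^sup>2) + norm (cnj u)" by (rule norm_triangle_ineq)
    also have "norm (u * (I z)\<^sup>2) = (norm (I z))\<^sup>2" using u by (simp add: norm_mult norm_power)
    also have "(norm (I z))\<^sup>2 \<le> 1" using I(3)[OF z] by (simp add: power_le_one)
    finally have "norm (u * (I z)\<^sup>2 + cnj u) \<le> 1 + 1" using u by simp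
    then show "norm ((u * (I z)\<^sup>2 + cnj u) / 2) \<le> 1" by (simp add: norm_divide)
  qed
  \<comment> \<open>Since |I| = 1 almost everywhere, u I^2 + cnj u = I (u I + cnj (u I)) = 2 I Re (u
    I), and G I = F.\<close>
  have bw: "AE x in \<sigma>. boundary_value w x = boundary_value F x * of_real (\<rho> x)"
    using hardy1_radial_limit[OF I(2)] IB IB1 AE_G_nonzero AE_space
  proof eventually_elim
    case (elim x)
    then have x: "norm x = 1" by simp
    have "((\<lambda>r. w (of_real r * x)) \<longlongrightarrow> G x * ((u * (boundary_value I x)\<^sup>2 + cnj u) / 2)) (at_left 1)"
      unfolding w_def by (intro tendsto_intros elim(1) boundary_value_continuous[OF G_continuous x]) simp
    then have b: "boundary_value w x = G x * ((u * (IB x)\<^sup>2 + cnj u) / 2)" unfolding IB_def by (rule boundary_valueI)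
    have c: "IB x * cnj (IB x) = 1" using elim(3) by (rule circle_mult_cnj)
    have "of_real (2 * \<rho> x) = u * IB x + cnj u * cnj (IB x)"
      unfolding \<rho>_def using complex_add_cnj[of "u * IB x"] by simp
    then have "IB x * of_real (2 * \<rho> x) = u * (IB x)\<^sup>2 + cnj u * (IB x * cnj (IB x))"
      by (simp add: power2_eq_square algebra_simps)
    then have "u * (IB x)\<^sup>2 + cnj u = IB x * of_real (2 * \<rho> x)" unfolding c by simp
    then have "boundary_value w x = (G x * IB x) * of_real (\<rho> x)" unfolding b by simp
    also have "G x * IB x = boundary_value F x" unfolding elim(2) using elim(4) by simp
    finally show ?case .
  qed
  \<comment> \<open>|Re (u I)| \<le> 1 makes 1 + s \<open>\<rho>\<close> nonnegative for s = 1 and s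
    = - 1, so the norm is linear in s and the mean-zero condition leaves exactly 1.\<close>
  have norm1: "hardy1_norm (\<lambda>z. F z + of_real s * w z) \<le> 1" "(\<lambda>z. F z + of_real s * w z) \<in> hardy1"
    if s: "\<bar>s\<bar> = 1" for s
  proof -
    note sw = hardy1_cmult(1,2)[OF w, of "of_real s"]
    show h: "(\<lambda>z. F z + of_real s * w z) \<in> hardy1" by (rule hardy1_add(1)[OF F_hardy1 sw(1)])
    have b: "AE x in \<sigma>. boundary_value (\<lambda>z. F z + of_real s * w z) x = boundary_value F x * of_real (1 + s * \<rho> x)"
      using hardy1_add(2)[OF F_hardy1 sw(1)] sw(2) bw by eventually_elim (simp add: algebra_simps)
    have "hardy1_norm (\<lambda>z. F z + of_real s * w z) = (\<integral>x. norm (boundary_value F x * of_real (1 + s * \<rho> x)) \<partial>\<sigma>)"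
      by (rule hardy1_norm_eqI[OF h _ b]) measurable
    also have "\<dots> = (\<integral>x. norm (boundary_value F x) + s * (norm (boundary_value F x) * \<rho> x) \<partial>\<sigma>)"
    proof (rule integral_cong_AE)
      show "AE x in \<sigma>. norm (boundary_value F x * of_real (1 + s * \<rho> x)) = norm (boundary_value F x) + s * (norm (boundary_value F x) * \<rho> x)"
        using IB1
      proof eventually_elim
        case (elim x)
        have "\<bar>\<rho> x\<bar> \<le> norm (u * IB x)" unfolding \<rho>_def by (rule abs_Re_le_cmod)
        then have "\<bar>s * \<rho> x\<bar> \<le> 1" using elim u s by (simp add: norm_mult abs_mult)
        then have "\<bar>1 + s * \<rho> x\<bar> = 1 + s * \<rho> x" by linarith
        moreover have "norm (boundary_value F x * of_real (1 + s * \<rho> x)) = norm (boundary_value F x) * \<bar>1 + s * \<rho> x\<bar>"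
          unfolding norm_mult norm_of_real ..
        ultimately show ?case by (simp add: algebra_simps)
      qed
    qed measurable
    also have "\<dots> = (\<integral>x. norm (boundary_value F x) \<partial>\<sigma>) + s * (\<integral>x. norm (boundary_value F x) * \<rho> x \<partial>\<sigma>)"
      using F_integrable int\<rho>
      by (simp only: Bochner_Integration.integral_add integrable_norm integrable_mult_right integral_mult_right_zero)
    also have "\<dots> = 1" using F_norm mean\<rho> by (simp add: hardy1_norm_def)
    finally show "hardy1_norm (\<lambda>z. F z + of_real s * w z) \<le> 1" by simp
  qed
  let ?p = "eval_at \<beta> (\<lambda>z. F z + of_real 1 * w z)" and ?m = "eval_at \<beta> (\<lambda>z. F z + of_real (- 1) * w z)"
  have p: "?p \<in> interp_body \<beta>" by (intro eval_at_in_interp_body norm1) auto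
  have m: "?m \<in> interp_body \<beta>" by (intro eval_at_in_interp_body norm1) auto
  have half_segment: "p = m" if "x = (1 - 1/2) *\<^sub>R p + (1/2) *\<^sub>R m" "x \<notin> open_segment p m" for x p m :: "complex ^ 'n"
    using that unfolding in_segment(2) by (auto dest!: spec[of _ "1/2"])
  have "eval_at \<beta> F = (1 - 1/2) *\<^sub>R ?p + (1/2) *\<^sub>R ?m"
    unfolding eval_at_convex_combination[symmetric] by (simp add: eval_at_def field_simps)
  moreover have "eval_at \<beta> F \<notin> open_segment ?p ?m" using ext p m unfolding extreme_point_of_def by blast
  ultimately have "?p = ?m"
    using half_segment by blast
  then have pm: "F (\<beta> k) + w (\<beta> k) = F (\<beta> k) - w (\<beta> k)" for k
    unfolding eval_at_def vec_eq_iff by simp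
  have w0: "w (\<beta> k) = 0" for k
  proof -
    have "w (\<beta> k) + w (\<beta> k) = (F (\<beta> k) + w (\<beta> k)) - (F (\<beta> k) - w (\<beta> k))" by simp
    also have "\<dots> = 0" unfolding pm[of k] by simp
    finally show ?thesis by simp
  qed
  \<comment> \<open>A single node suffices: at an interior point with |I| = 1 the modulus of I
    attains its maximum, so I is constant.\<close>
  fix k :: 'n
  have "u * (I (\<beta> k))\<^sup>2 + cnj u = 0" using w0[of k] G_nonzero[OF \<beta>_in] by (simp add: w_def)
  then have "norm (u * (I (\<beta> k))\<^sup>2) = norm (cnj u)" by (metis add_eq_0_iff norm_minus_cancel)
  then have "(norm (I (\<beta> k)))\<^sup>2 = 1" using u by (simp add: norm_mult norm_power)
  then have I1: "norm (I (\<beta> k)) = 1" using power2_eq_1_iff[of "norm (I (\<beta> k))"] norm_ge_zero[of "I (\<beta> k)"] by auto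
  have "I constant_on ball 0 1"
  proof (rule maximum_modulus_principle[where U = "ball 0 1" and \<xi> = "\<beta> k"])
    show "norm (I z) \<le> norm (I (\<beta> k))" if "z \<in> ball 0 1" for z using I(3)[of z] that I1 by simp
  qed (use I(1) \<beta>_in[of k] in auto)
  then obtain c where c: "\<And>z. norm z < 1 \<Longrightarrow> I z = c" unfolding constant_on_def by auto
  have "norm c = 1" using c[OF \<beta>_in] I1 by simp
  moreover have "F z = c * G z" if "norm z < 1" for z
    using c[OF that] G_nonzero[OF that] by (simp add: I_def field_simps)
  ultimately show ?thesis by (rule multiple_imp_outer)
qed

lemma outer_imp_extreme:
  assumes out: "outer_function F"
  shows "eval_at \<beta> F extreme_point_of interp_body \<beta>"
  unfolding extreme_point_of_def
proof (intro conjI ballI notI)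
  show "eval_at \<beta> F \<in> interp_body \<beta>" by (rule eval_at_in_interp_body[OF F_hardy1]) (simp add: F_norm)
  fix p1 p2 assume p1: "p1 \<in> interp_body \<beta>" and p2: "p2 \<in> interp_body \<beta>"
    and seg: "eval_at \<beta> F \<in> open_segment p1 p2"
  obtain c where c: "norm c = 1" "\<And>z. norm z < 1 \<Longrightarrow> F z = c * G z" using outer_imp_multiple[OF out] by blast
  have c0: "c \<noteq> 0" using c(1) by auto
  obtain f1 where f1: "p1 = eval_at \<beta> f1" "f1 \<in> hardy1" "hardy1_norm f1 \<le> 1" using p1 unfolding interp_body_def by blast
  obtain f2 where f2: "p2 = eval_at \<beta> f2" "f2 \<in> hardy1" "hardy1_norm f2 \<le> 1" using p2 unfolding interp_body_def by blast
  obtain t where t: "0 < t" "t < 1" "eval_at \<beta> F = (1 - t) *\<^sub>R p1 + t *\<^sub>R p2" and ne: "p1 \<noteq> p2"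
    using seg unfolding in_segment(2) by blast
  let ?f = "\<lambda>z. of_real (1 - t) * f1 z + of_real t * f2 z"
  have ev: "?f (\<beta> k) = F (\<beta> k)" for k
    using t(3) unfolding f1(1) f2(1) eval_at_convex_combination[symmetric] by (simp add: eval_at_def vec_eq_iff)
  have f: "maximiser ?f"
    unfolding maximiser_def
  proof (intro conjI hardy1_convex_combination f1 f2)
    have "L ?f = L F" unfolding L_def by (simp only: ev)
    then show "Re (L ?f) = M" using F_max by (simp add: maximiser_def)
  qed (use t in auto)
  have f_hardy: "?f \<in> hardy1" using f by (simp add: maximiser_def)
  \<comment> \<open>The combination is known to agree with F only at the nodes; uniqueness of
    maximisers with given node values upgrades this to the circle.\<close>
  have "AE x in \<sigma>. boundary_value ?f x = boundary_value F x" by (rule maximiser_unique[OF f F_max ev])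
  moreover have "AE x in \<sigma>. boundary_value ?f x = of_real (1 - t) * boundary_value f1 x + of_real t * boundary_value f2 x"
    using hardy1_add(2)[OF hardy1_cmult(1)[OF f1(2), of "of_real (1 - t)"] hardy1_cmult(1)[OF f2(2), of "of_real t"]]
      hardy1_cmult(2)[OF f1(2), of "of_real (1 - t)"] hardy1_cmult(2)[OF f2(2), of "of_real t"]
    by eventually_elim (simp only:)
  ultimately have comb: "AE x in \<sigma>. boundary_value F x = of_real (1 - t) * boundary_value f1 x + of_real t * boundary_value f2 x"
    by eventually_elim simp
  note i1 = hardy1_boundary_integrable[OF f1(2)] and i2 = hardy1_boundary_integrable[OF f2(2)]
  let ?S = "\<lambda>x. (1 - t) * norm (boundary_value f1 x) + t * norm (boundary_value f2 x)"
  have iS: "integrable \<sigma> ?S"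
    by (intro Bochner_Integration.integrable_add integrable_mult_right integrable_norm i1 i2)
  have "(\<integral>x. ?S x \<partial>\<sigma>) = (1 - t) * hardy1_norm f1 + t * hardy1_norm f2"
    unfolding hardy1_norm_def using i1 i2
    by (simp only: Bochner_Integration.integral_add integrable_mult_right integrable_norm integral_mult_right_zero)
  also have "\<dots> \<le> (1 - t) * 1 + t * 1" using t f1 f2 by (intro add_mono mult_left_mono) auto
  finally have S1: "(\<integral>x. ?S x \<partial>\<sigma>) \<le> 1" by simp
  have le: "AE x in \<sigma>. norm (boundary_value F x) \<le> ?S x"
    using comb
  proof eventually_elim
    case (elim x)
    have "norm (boundary_value F x) \<le> norm (of_real (1 - t) * boundary_value f1 x) + norm (of_real t * boundary_value f2 x)"
      unfolding elim by (rule norm_triangle_ineq)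
    then show ?case unfolding norm_mult norm_of_real using t by simp
  qed
  \<comment> \<open>The difference is nonnegative by the triangle inequality and its integral is at
    most 1 - 1 = 0, so the triangle inequality is an equality almost everywhere.\<close>
  have eqS: "AE x in \<sigma>. ?S x - norm (boundary_value F x) = 0"
  proof (rule integral_nonneg_eq_0_iff_AE[THEN iffD1])
    show i: "integrable \<sigma> (\<lambda>x. ?S x - norm (boundary_value F x))"
      by (intro Bochner_Integration.integrable_diff iS integrable_norm F_integrable)
    show nn: "AE x in \<sigma>. 0 \<le> ?S x - norm (boundary_value F x)" using le by eventually_elim simp
    have "(\<integral>x. ?S x - norm (boundary_value F x) \<partial>\<sigma>) = (\<integral>x. ?S x \<partial>\<sigma>) - hardy1_norm F"
      unfolding hardy1_norm_def by (rule Bochner_Integration.integral_diff[OF iS integrable_norm[OF F_integrable]])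
    then have "(\<integral>x. ?S x - norm (boundary_value F x) \<partial>\<sigma>) \<le> 0" using S1 F_norm by simp
    moreover have "0 \<le> (\<integral>x. ?S x - norm (boundary_value F x) \<partial>\<sigma>)" by (rule integral_nonneg_AE[OF nn])
    ultimately show "(\<integral>x. ?S x - norm (boundary_value F x) \<partial>\<sigma>) = 0" by simp
  qed
  \<comment> \<open>Equality gives (1 - t) |f1| \<le> |F| = |G|, hence the bound for the quotient f1
    / G.\<close>
  define C where "C = 1 / (1 - t)"
  have C: "0 \<le> C" using t by (simp add: C_def)
  have dom: "AE x in \<sigma>. norm (boundary_value f1 x) \<le> C * norm (G x)"
    using eqS F_modulus
  proof eventually_elim
    case (elim x)
    have "0 \<le> t * norm (boundary_value f2 x)" using t by simp
    then have "(1 - t) * norm (boundary_value f1 x) \<le> norm (G x)" using elim by linarith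
    then show ?case using t by (simp add: C_def field_simps)
  qed
  note Q = quotient_hardy1[OF f1(2) dom C]
  \<comment> \<open>In the disc v is f1 / F, written through G so that
    \<open>quotient_hardy1\<close> applies. The equality case makes its boundary values real, hence
    v constant.\<close>
  define v where "v z = inverse c * (f1 z / G z)" for z
  have v: "v \<in> hardy1" "AE x in \<sigma>. boundary_value v x = inverse c * boundary_value (\<lambda>z. f1 z / G z) x"
    unfolding v_def by (rule hardy1_cmult[OF Q(2)])+
  have FG: "AE x in \<sigma>. boundary_value F x = c * G x"
    using AE_space
  proof eventually_elim
    case (elim x)
    then have x: "norm x = 1" by simp
    have "((\<lambda>r. c * G (of_real r * x)) \<longlongrightarrow> c * G x) (at_left 1)"
      by (intro tendsto_intros boundary_value_continuous[OF G_continuous x])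
    then have "((\<lambda>r. F (of_real r * x)) \<longlongrightarrow> c * G x) (at_left 1)"
    proof (rule Lim_transform_eventually)
      show "\<forall>\<^sub>F r in at_left 1. c * G (of_real r * x) = F (of_real r * x)"
        using eventually_radius[of 0, simplified]
      proof eventually_elim
        case (elim r)
        then have "norm (of_real r * x) < 1" using x by (simp add: norm_mult)
        then show ?case by (rule c(2)[symmetric])
      qed
    qed
    then show ?case by (rule boundary_valueI)
  qed
  have "AE x in \<sigma>. Im (boundary_value v x) = 0"
    using v(2) Q(4) FG comb eqS AE_G_nonzero
  proof eventually_elim
    case (elim x)
    define a b where "a = of_real (1 - t) * boundary_value f1 x" and "b = of_real t * boundary_value f2 x"
    have ab: "a + b = c * G x" using elim(3,4) by (simp only: a_def b_def)
    have "norm (a + b) = norm a + norm b"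
      using elim(4,5) t unfolding a_def b_def norm_mult norm_of_real by simp
    then have im: "Im (a * cnj (a + b)) = 0" by (rule norm_add_eq_imp_real)
    have "of_real (1 - t) * boundary_value v x * (c * G x) = a"
      unfolding elim(1) elim(2) a_def using c0 elim(6) by simp
    then have "a = of_real (1 - t) * boundary_value v x * (a + b)" by (simp only: ab)
    then have "a * cnj (a + b) = of_real (1 - t) * boundary_value v x * (a + b) * cnj (a + b)"
      by (rule arg_cong[where f = "\<lambda>y. y * cnj (a + b)"])
    also have "\<dots> = of_real ((1 - t) * (norm (a + b))\<^sup>2) * boundary_value v x"
      unfolding of_real_mult complex_norm_square by (simp only: mult_ac)
    finally have e: "a * cnj (a + b) = of_real ((1 - t) * (norm (a + b))\<^sup>2) * boundary_value v x" .
    have "Im (of_real ((1 - t) * (norm (a + b))\<^sup>2) * boundary_value v x) = 0" using im unfolding e .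
    then have "(1 - t) * (norm (a + b))\<^sup>2 * Im (boundary_value v x) = 0"
      by (simp only: times_complex.sel Re_complex_of_real Im_complex_of_real mult_zero_left add_0_right)
    moreover have "a + b \<noteq> 0" unfolding ab using c0 elim(6) by simp
    ultimately show ?case using t(2) by simp
  qed
  from real_boundary_constant[OF v(1) this] have vc: "v z = of_real (Re (v 0))" if "norm z < 1" for z using that .
  define \<kappa> where "\<kappa> = Re (v 0)"
  have f1F: "f1 z = of_real \<kappa> * F z" if z: "norm z < 1" for z
  proof -
    have "f1 z = c * G z * v z" using c0 G_nonzero[OF z] by (simp add: v_def)
    then show ?thesis using vc[OF z] c(2)[OF z] by (simp add: \<kappa>_def mult.commute)
  qed
  \<comment> \<open>Solves (1 - t) \<kappa> + t \<kappa>2 = 1, the relation imposed by the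
    combination being F.\<close>
  define \<kappa>2 where "\<kappa>2 = (1 - (1 - t) * \<kappa>) / t"
  have fF: "?f z = F z" if "norm z < 1" for z
    by (rule hardy1_eqI[OF f_hardy F_hardy1 maximiser_unique[OF f F_max ev] that])
  have f2F: "f2 z = of_real \<kappa>2 * F z" if z: "norm z < 1" for z
  proof -
    have "of_real t * f2 z = F z - of_real (1 - t) * (of_real \<kappa> * F z)" using fF[OF z] f1F[OF z] by (simp add: algebra_simps)
    also have "\<dots> = of_real (1 - (1 - t) * \<kappa>) * F z" by (simp add: algebra_simps)
    also have "1 - (1 - t) * \<kappa> = t * \<kappa>2" using t by (simp add: \<kappa>2_def)
    finally show ?thesis using t by simp
  qed
  have scal: "\<bar>s\<bar> \<le> 1" if g: "g \<in> hardy1" "hardy1_norm g \<le> 1" and gF: "\<And>z. norm z < 1 \<Longrightarrow> g z = of_real s * F z" for g s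
  proof -
    have "AE x in \<sigma>. boundary_value g x = of_real s * boundary_value F x"
      using hardy1_radial_limit[OF F_hardy1] AE_space
    proof eventually_elim
      case (elim x)
      have "((\<lambda>r. of_real s * F (of_real r * x)) \<longlongrightarrow> of_real s * boundary_value F x) (at_left 1)"
        by (intro tendsto_intros elim(1))
      then have "((\<lambda>r. g (of_real r * x)) \<longlongrightarrow> of_real s * boundary_value F x) (at_left 1)"
      proof (rule Lim_transform_eventually)
        show "\<forall>\<^sub>F r in at_left 1. of_real s * F (of_real r * x) = g (of_real r * x)"
          using eventually_radius[of 0, simplified]
        proof eventually_elim
          case (elim r)
          then have "norm (of_real r * x) < 1" using \<open>x \<in> space \<sigma>\<close> by (simp add: norm_mult)
          then show ?case by (rule gF[symmetric])
        qed
      qed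
      then show ?case by (rule boundary_valueI)
    qed
    then have "hardy1_norm g = (\<integral>x. norm (of_real s * boundary_value F x) \<partial>\<sigma>)"
      by (intro hardy1_norm_eqI g(1)) measurable
    also have "\<dots> = \<bar>s\<bar> * hardy1_norm F" by (simp add: norm_mult hardy1_norm_def)
    finally show ?thesis using g(2) F_norm by simp
  qed
  \<comment> \<open>Both multiples of F have norm at most 1, so \<kappa> and \<kappa>2 are at most
    1; a proper convex combination of them equal to 1 forces both to be 1.\<close>
  have k1: "\<kappa> \<le> 1" using scal[OF f1(2,3) f1F] by simp
  have k2: "\<kappa>2 \<le> 1" using scal[OF f2(2,3) f2F] by simp
  have "t * \<kappa>2 = 1 - (1 - t) * \<kappa>" using t by (simp add: \<kappa>2_def)
  moreover have "t * \<kappa>2 \<le> t * 1" using k2 t by (intro mult_left_mono) auto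
  ultimately have "(1 - t) * 1 \<le> (1 - t) * \<kappa>" by simp
  then have "1 \<le> \<kappa>" using t by simp
  then have "\<kappa> = 1" using k1 by simp
  then have "\<kappa>2 = 1" using t by (simp add: \<kappa>2_def)
  have "p1 = p2"
    unfolding f1(1) f2(1) eval_at_def vec_eq_iff using f1F[OF \<beta>_in] f2F[OF \<beta>_in] \<open>\<kappa> = 1\<close> \<open>\<kappa>2 = 1\<close> by simp
  then show False using ne by simp
qed

end

theorem theorem2:
  fixes \<beta> :: "'n::finite \<Rightarrow> complex" and F :: "complex \<Rightarrow> complex"
  assumes "inj \<beta>"
    and "\<And>k. \<beta> k \<in> ball 0 1"
    and "\<And>k. \<beta> k \<noteq> 0"
    and "F \<in> hardy1"
    and "hardy1_norm F = 1"
    and "eval_at \<beta> F \<in> frontier (interp_body \<beta>)"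
  shows "(eval_at \<beta> F extreme_point_of interp_body \<beta> \<longleftrightarrow> outer_function F) \<and>
    (outer_function F \<longrightarrow>
      (\<exists>q :: complex poly. degree q \<le> CARD('n) - 1 \<and>
        (\<forall>z\<in>ball 0 1. poly q z \<noteq> 0) \<and>
        (\<forall>z\<in>ball 0 1. F z = (poly q z)\<^sup>2 * kernel_prod \<beta> z)))"
proof -
  have nodes: "norm (\<beta> k) < 1" for k using assms(2)[of k] by simp
  obtain \<gamma> :: "'n \<Rightarrow> complex" where pos: "0 < Re (\<Sum>k\<in>UNIV. \<gamma> k * F (\<beta> k))"
    and sup: "\<And>f. f \<in> hardy1 \<Longrightarrow> hardy1_norm f \<le> 1 \<Longrightarrow>
      Re (\<Sum>k\<in>UNIV. \<gamma> k * f (\<beta> k)) \<le> Re (\<Sum>k\<in>UNIV. \<gamma> k * F (\<beta> k))"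
    by (rule supporting_functional[OF assms(1,4,5,6)]) (rule that)
  define M where "M = Re (\<Sum>k\<in>UNIV. \<gamma> k * F (\<beta> k))"
  interpret support_functional \<beta> \<gamma> M
    by unfold_locales (rule nodes, use pos in \<open>simp add: M_def\<close>, use sup in \<open>simp add: M_def\<close>)
  have "Re (L F) = M" unfolding L_def by (rule M_def[symmetric])
  then have F: "maximiser F" using assms(4,5) by (simp add: maximiser_def)
  obtain q where q: "degree q \<le> CARD('n) - 1" "spectral_majorant \<beta> q"
    "AE x in \<sigma>. norm (boundary_value F x) = norm (spectral_majorant.G \<beta> q x)"
    by (rule maximiser_spectral_factor[OF F]) (rule that)
  interpret spectral_majorant \<beta> q by (rule q(2))
  interpret extremal_pair \<beta> \<gamma> M q F by unfold_locales (rule F, rule q(3))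
  have "\<exists>p :: complex poly. degree p \<le> CARD('n) - 1 \<and> (\<forall>z\<in>ball 0 1. poly p z \<noteq> 0) \<and>
      (\<forall>z\<in>ball 0 1. F z = (poly p z)\<^sup>2 * kernel_prod \<beta> z)" if out: "outer_function F"
  proof -
    obtain c where c: "norm c = 1" "\<And>z. norm z < 1 \<Longrightarrow> F z = c * G z" using outer_imp_multiple[OF out] by blast
    \<comment> \<open>The unimodular constant between F and G is absorbed into q through its square
      root, as q enters squared.\<close>
    have c0: "csqrt c \<noteq> 0" using c(1) by auto
    show ?thesis
    proof (intro exI[of _ "smult (csqrt c) q"] conjI ballI)
      show "degree (smult (csqrt c) q) \<le> CARD('n) - 1" using degree_smult_le q(1) by (rule order_trans)
      fix z :: complex assume "z \<in> ball 0 1"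
      then have z: "norm z < 1" by simp
      show "poly (smult (csqrt c) q) z \<noteq> 0" using c0 zero_free[OF z] by simp
      show "F z = (poly (smult (csqrt c) q) z)\<^sup>2 * kernel_prod \<beta> z"
        unfolding c(2)[OF z] G_def by (simp add: power_mult_distrib)
    qed
  qed
  then show ?thesis using extreme_imp_outer outer_imp_extreme by blast
qed

end
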